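(* Let $n\geq 2$ and $G=\mathrm{Isom}(\mathbb{H}^n)$. The comparison map $$c:H^n_{c,b}(G,\mathbb{R}_\varepsilon)\longrightarrow H^n_c(G,\mathbb{R}_\varepsilon)$$ is an isometric isomorphism.
   Context: $\mathbb{H}^n$ is real hyperbolic $n$-space and $G=\mathrm{Isom}(\mathbb{H}^n)$ its full isometry group; $\varepsilon:G\to\{+1,-1\}$ is the homomorphism equal to $+1$ exactly on orientation preserving isometries; $\mathbb{R}_\varepsilon$ is the $G$-module $\mathbb{R}$ on which $g$ acts by multiplication by $\varepsilon(g)$. The continuous cohomology $H^\bullet_c(G,\mathbb{R}_\varepsilon)$ is the cohomology of the cocomplex $$C_c(G^{q+1},\mathbb{R}_\varepsilon)^G=\{f:G^{q+1}\to\mathbb{R}\mid f \text{ continuous},\ \varepsilon(g)f(g_0,\dots,g_q)=f(gg_0,\dots,gg_q)\ \forall g\in G\}$$ with the homogeneous coboundary $\delta f(g_0,\dots,g_{q+1})=\sum_{j=0}^{q+1}(-1)^jf(g_0,\dots,\widehat{g_j},\dots,g_{q+1})$. The continuous bounded cohomology $H^\bullet_{c,b}(G,\mathbb{R}_\varepsilon)$ is the cohomology of the subcocomplex of bounded cochains. The comparison map $c$ is induced by the inclusion of bounded cochains in all cochains. The seminorm of a class $\beta$ (in either theory) is $\|\beta\|=\inf\{\|f\|_\infty\mid f \text{ a cocycle in the respective cocomplex with } [f]=\beta\}$, where $\|f\|_\infty$ is the sup norm; "isometric" refers to these seminorms. *)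

theory Defs
  imports "HOL-Analysis.Analysis" "HOL-Algebra.Bij"
begin

text \<open>
  Hyperbolic space of dimension \<open>CARD('n)\<close> in the Beltrami--Klein model: the open unit ball of
  \<open>real ^ 'n\<close>, a point \<open>x\<close> of which stands for the point \<open>(x, 1) / sqrt (1 - x \<bullet> x)\<close> of the
  hyperboloid. The distance is that of constant curvature \<open>-1\<close>; its metric topology is the Euclidean
  topology of the ball.
\<close>

definition hyp_space :: "(real ^ 'n) set" where
  "hyp_space = ball 0 1"

definition hyp_dist :: "real ^ 'n \<Rightarrow> real ^ 'n \<Rightarrow> real" where
  "hyp_dist x y = arcosh ((1 - x \<bullet> y) / (sqrt (1 - x \<bullet> x) * sqrt (1 - y \<bullet> y)))"

definition hyp_isom :: "(real ^ 'n \<Rightarrow> real ^ 'n) set" where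
  "hyp_isom = {g \<in> Bij hyp_space.
     \<forall>x\<in>hyp_space. \<forall>y\<in>hyp_space. hyp_dist (g x) (g y) = hyp_dist x y}"

definition hyp_isom_group :: "(real ^ 'n \<Rightarrow> real ^ 'n) monoid" where
  "hyp_isom_group = BijGroup hyp_space \<lparr>carrier := hyp_isom\<rparr>"

text \<open>
  The topology of pointwise convergence, which on isometries agrees with the compact-open topology.
\<close>

definition hyp_isom_topology :: "(real ^ 'n \<Rightarrow> real ^ 'n) topology" where
  "hyp_isom_topology =
     subtopology (product_topology (\<lambda>_. top_of_set hyp_space) hyp_space) hyp_isom"

text \<open>
  The ball is a global chart, and every isometry is smooth in it, so orientations are compared by the
  sign of the Jacobian determinant.
\<close>

definition orientation_preserving :: "(real ^ 'n \<Rightarrow> real ^ 'n) \<Rightarrow> bool" where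
  "orientation_preserving g \<longleftrightarrow>
     (\<forall>x\<in>hyp_space. \<exists>g'. (g has_derivative g') (at x) \<and> det (matrix g') > 0)"

definition orientation_character :: "(real ^ 'n \<Rightarrow> real ^ 'n) \<Rightarrow> real" where
  "orientation_character g = (if orientation_preserving g then 1 else - 1)"

text \<open>
  In the following, \<open>G\<close> is a group, \<open>T\<close> a topology on its carrier and \<open>e\<close> a real character of \<open>G\<close>,
  through which \<open>G\<close> acts on the coefficients \<open>real\<close>. Cochains are set to \<open>0\<close> off the set of tuples,
  so that two of them are equal as soon as they agree on tuples.
\<close>

definition tuples :: "('a, 'b) monoid_scheme \<Rightarrow> nat \<Rightarrow> (nat \<Rightarrow> 'a) set" where
  "tuples G q = {..q} \<rightarrow>\<^sub>E carrier G"

definition continuous_cochains ::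
    "('a, 'b) monoid_scheme \<Rightarrow> 'a topology \<Rightarrow> ('a \<Rightarrow> real) \<Rightarrow> nat \<Rightarrow> ((nat \<Rightarrow> 'a) \<Rightarrow> real) set" where
  "continuous_cochains G T e q =
     {f. continuous_map (product_topology (\<lambda>_. T) {..q}) euclideanreal f
       \<and> (\<forall>x. x \<notin> tuples G q \<longrightarrow> f x = 0)
       \<and> (\<forall>g\<in>carrier G. \<forall>x\<in>tuples G q. e g * f x = f (\<lambda>i\<in>{..q}. g \<otimes>\<^bsub>G\<^esub> x i))}"

definition bounded_cochains ::
    "('a, 'b) monoid_scheme \<Rightarrow> 'a topology \<Rightarrow> ('a \<Rightarrow> real) \<Rightarrow> nat \<Rightarrow> ((nat \<Rightarrow> 'a) \<Rightarrow> real) set" where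
  "bounded_cochains G T e q = {f \<in> continuous_cochains G T e q. bounded (f ` tuples G q)}"

text \<open>\<open>omit q j\<close> deletes entry \<open>j\<close> from a tuple with indices \<open>0, \<dots>, q + 1\<close>.\<close>

definition omit :: "nat \<Rightarrow> nat \<Rightarrow> (nat \<Rightarrow> 'a) \<Rightarrow> nat \<Rightarrow> 'a" where
  "omit q j x = (\<lambda>i\<in>{..q}. x (if i < j then i else Suc i))"

definition coboundary ::
    "('a, 'b) monoid_scheme \<Rightarrow> nat \<Rightarrow> ((nat \<Rightarrow> 'a) \<Rightarrow> real) \<Rightarrow> (nat \<Rightarrow> 'a) \<Rightarrow> real" where
  "coboundary G q f x =
     (if x \<in> tuples G (Suc q) then \<Sum>j\<le>Suc q. (- 1) ^ j * f (omit q j x) else 0)"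

text \<open>Below, \<open>C\<close> is either of the two cocomplexes; \<open>C q\<close> is its term in degree \<open>q\<close>.\<close>

definition cocycles ::
    "('a, 'b) monoid_scheme \<Rightarrow> (nat \<Rightarrow> ((nat \<Rightarrow> 'a) \<Rightarrow> real) set) \<Rightarrow> nat \<Rightarrow> ((nat \<Rightarrow> 'a) \<Rightarrow> real) set" where
  "cocycles G C q = {f \<in> C q. \<forall>x. coboundary G q f x = 0}"

definition coboundaries ::
    "('a, 'b) monoid_scheme \<Rightarrow> (nat \<Rightarrow> ((nat \<Rightarrow> 'a) \<Rightarrow> real) set) \<Rightarrow> nat \<Rightarrow> ((nat \<Rightarrow> 'a) \<Rightarrow> real) set" where
  "coboundaries G C q = (case q of 0 \<Rightarrow> {\<lambda>_. 0} | Suc p \<Rightarrow> coboundary G p ` C p)"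

definition cohomologous ::
    "('a, 'b) monoid_scheme \<Rightarrow> (nat \<Rightarrow> ((nat \<Rightarrow> 'a) \<Rightarrow> real) set) \<Rightarrow> nat \<Rightarrow> ((nat \<Rightarrow> 'a) \<Rightarrow> real) rel" where
  "cohomologous G C q = {(f, f'). f \<in> cocycles G C q \<and> f' \<in> cocycles G C q
     \<and> (\<lambda>x. f x - f' x) \<in> coboundaries G C q}"

definition cohomology ::
    "('a, 'b) monoid_scheme \<Rightarrow> (nat \<Rightarrow> ((nat \<Rightarrow> 'a) \<Rightarrow> real) set) \<Rightarrow> nat \<Rightarrow> ((nat \<Rightarrow> 'a) \<Rightarrow> real) set set" where
  "cohomology G C q = cocycles G C q // cohomologous G C q"

text \<open>
  The unions below, over the representatives of the given classes, are unions of equal sets.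
\<close>

definition class_add ::
    "('a, 'b) monoid_scheme \<Rightarrow> (nat \<Rightarrow> ((nat \<Rightarrow> 'a) \<Rightarrow> real) set) \<Rightarrow> nat \<Rightarrow>
     ((nat \<Rightarrow> 'a) \<Rightarrow> real) set \<Rightarrow> ((nat \<Rightarrow> 'a) \<Rightarrow> real) set \<Rightarrow> ((nat \<Rightarrow> 'a) \<Rightarrow> real) set" where
  "class_add G C q \<alpha> \<beta> = (\<Union>a\<in>\<alpha>. \<Union>b\<in>\<beta>. cohomologous G C q `` {\<lambda>x. a x + b x})"

definition class_scale ::
    "('a, 'b) monoid_scheme \<Rightarrow> (nat \<Rightarrow> ((nat \<Rightarrow> 'a) \<Rightarrow> real) set) \<Rightarrow> nat \<Rightarrow>
     real \<Rightarrow> ((nat \<Rightarrow> 'a) \<Rightarrow> real) set \<Rightarrow> ((nat \<Rightarrow> 'a) \<Rightarrow> real) set" where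
  "class_scale G C q r \<alpha> = (\<Union>a\<in>\<alpha>. cohomologous G C q `` {\<lambda>x. r * a x})"

text \<open>The map to the cohomology of \<open>C\<close> induced by the inclusion of a subcocomplex of \<open>C\<close>.\<close>

definition comparison_map ::
    "('a, 'b) monoid_scheme \<Rightarrow> (nat \<Rightarrow> ((nat \<Rightarrow> 'a) \<Rightarrow> real) set) \<Rightarrow> nat \<Rightarrow>
     ((nat \<Rightarrow> 'a) \<Rightarrow> real) set \<Rightarrow> ((nat \<Rightarrow> 'a) \<Rightarrow> real) set" where
  "comparison_map G C q \<beta> = (\<Union>f\<in>\<beta>. cohomologous G C q `` {f})"

definition sup_norm :: "('a, 'b) monoid_scheme \<Rightarrow> nat \<Rightarrow> ((nat \<Rightarrow> 'a) \<Rightarrow> real) \<Rightarrow> ennreal" where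
  "sup_norm G q f = (SUP x\<in>tuples G q. ennreal \<bar>f x\<bar>)"

text \<open>A class is the set of the cocycles representing it.\<close>

definition class_seminorm ::
    "('a, 'b) monoid_scheme \<Rightarrow> nat \<Rightarrow> ((nat \<Rightarrow> 'a) \<Rightarrow> real) set \<Rightarrow> ennreal" where
  "class_seminorm G q \<beta> = (INF f\<in>\<beta>. sup_norm G q f)"

end

(*
  An isometry of the ball is a Lorentz matrix, and a reflection fixes any points that do not span the
  Lorentz space while having determinant -1. So an equivariant function of n + 1 points of the
  hyperboloid vanishes on degenerate tuples, and one of n points vanishes.

  Averaging a cochain over independent Haar rotations from the right does not increase the sup norm,
  makes it a function of points of the hyperboloid, and is homotopic to the identity through prism
  operators, which preserve bounded cochains. By the vanishing in degree n - 1 the average of an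
  n-cocycle depends only on its class. Hence everything follows once an equivariant continuous
  cocycle F of n + 1 points is shown to be bounded.

  Bisecting the longest edge of a tuple (F is then a sum of two terms, the others being degenerate)
  bounds F by the fourth root of the largest value of - lform on it. The cocycle relation with one
  point averaged over a Lorentz invariant weight makes F Lipschitz in each point, locally and relative
  to its size, so F is small near degenerate tuples. Finally push all points along a common lightlike
  vector: at the dyadic times t the change of F is a sum of prism terms, each of them near a degenerate
  tuple, of size O(min (t / S, S / t) powr (1 / 4)) with S a characteristic scale of the tuple.
  These sum geometrically to a constant, and in the limit the tuple degenerates.
*)
theory Submission
  imports Defs "HOL-Probability.Infinite_Product_Measure"
begin

section \<open>Sequence cochains and prism operators\<close>

text \<open>The obstacle is that a continuous cocycle comes without any quantitative continuity,
  which has to be extracted from the cocycle relation and equivariance. Sizes are measured by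
  \<open>- lform x y\<close>, the hyperbolic cosine of the distance. Two exponents decide the proof.
  Moving one point by a distance with hyperbolic cosine \<open>1 + r\<close> costs a factor
  \<open>sqrt r\<close> (\<open>lipschitz\<close>), while a tuple of size \<open>c\<close> costs
  \<open>sqrt (sqrt c)\<close> (\<open>growth\<close>). In a prism term at a time \<open>t\<close>
  much smaller than the scale \<open>S\<close>, the excess \<open>r\<close> is of order
  \<open>t / S\<close> and the size \<open>c\<close> of order \<open>S / t\<close>, so the product
  is the fourth root of \<open>t / S\<close>. Any growth exponent below 1/2 would leave a positive
  power; mere continuity at degenerate tuples would give no summable rate. The orientation character
  enters the analysis only through its absolute value 1 and the value -1 at one coordinate
  reflection; other reflections are conjugated to that one by explicit involutions. Accordingly,
  invariance of Lebesgue measure is established for linear involutions and for rotations, without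
  determinants.\<close>

text \<open>A cochain of degree \<open>q\<close> is a function of an infinite sequence that depends on the entries
  \<open>0, \<dots>, q\<close> only, so that faces and prisms are reindexings of sequences.\<close>

definition skip :: "nat \<Rightarrow> nat \<Rightarrow> nat" where
  "skip j i = (if i < j then i else Suc i)"

definition splice_at :: "nat \<Rightarrow> (nat \<Rightarrow> 'a) \<Rightarrow> (nat \<Rightarrow> 'a) \<Rightarrow> nat \<Rightarrow> 'a" where
  "splice_at j g h i = (if i \<le> j then g i else h (i - 1))"

definition depends_upto :: "nat \<Rightarrow> ((nat \<Rightarrow> 'a) \<Rightarrow> 'b) \<Rightarrow> bool" where
  "depends_upto q u \<longleftrightarrow> (\<forall>x y. (\<forall>i\<le>q. x i = y i) \<longrightarrow> u x = u y)"

definition cobd :: "nat \<Rightarrow> ((nat \<Rightarrow> 'a) \<Rightarrow> real) \<Rightarrow> (nat \<Rightarrow> 'a) \<Rightarrow> real" where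
  "cobd q u x = (\<Sum>j\<le>Suc q. (- 1) ^ j * u (x \<circ> skip j))"

definition prism :: "nat \<Rightarrow> ((nat \<Rightarrow> 'a) \<Rightarrow> real) \<Rightarrow> (nat \<Rightarrow> 'a) \<Rightarrow> (nat \<Rightarrow> 'a) \<Rightarrow> real" where
  "prism p u g h = (\<Sum>j\<le>p. (- 1) ^ j * u (splice_at j g h))"

lemma depends_uptoD: "depends_upto q u \<Longrightarrow> (\<And>i. i \<le> q \<Longrightarrow> x i = y i) \<Longrightarrow> u x = u y"
  unfolding depends_upto_def by blast

lemma inj_skip: "inj (skip j)"
  by (rule injI) (auto simp: skip_def split: if_splits)

lemma splice_at_skip_less:
  "k < j \<Longrightarrow> splice_at j g h \<circ> skip k = splice_at (j - 1) (g \<circ> skip k) (h \<circ> skip k)"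
  by (rule ext) (auto simp: splice_at_def skip_def)

lemma splice_at_skip_greater:
  "Suc j < k \<Longrightarrow> splice_at j g h \<circ> skip k = splice_at j (g \<circ> skip (k - 1)) (h \<circ> skip (k - 1))"
  by (rule ext) (auto simp: splice_at_def skip_def)

lemma splice_at_skip_same: "splice_at j g h \<circ> skip j = (\<lambda>i. if i < j then g i else h i)"
  by (rule ext) (auto simp: splice_at_def skip_def)

lemma splice_at_skip_Suc: "splice_at j g h \<circ> skip (Suc j) = (\<lambda>i. if i < Suc j then g i else h i)"
  by (rule ext) (auto simp: splice_at_def skip_def)

text \<open>The \<open>j\<close>-th prism tuple runs along \<open>g\<close> up to index
  \<open>j\<close>, then along \<open>h\<close> from index \<open>j\<close> on. In its coboundary
  the faces below \<open>j\<close> and above \<open>Suc j\<close> are prism tuples of the faces of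
  \<open>g\<close> and \<open>h\<close>, and the two middle faces are the mixed tuples
  \<open>W j\<close> and \<open>W (Suc j)\<close>, which telescope. The cocycle relation is demanded
  at the prism tuples only, because the cocycles below satisfy it only on admissible
  sequences.\<close>

lemma prism_identity:
  fixes u :: "(nat \<Rightarrow> 'a) \<Rightarrow> real"
  assumes dep: "depends_upto (Suc p) u"
    and cocycle: "\<And>j. j \<le> Suc p \<Longrightarrow> cobd (Suc p) u (splice_at j g h) = 0"
  shows "(\<Sum>i\<le>Suc p. (- 1) ^ i * prism p u (g \<circ> skip i) (h \<circ> skip i)) = u h - u g"
proof -
  let ?q = "Suc p"
  define c where "c i j = (- 1) ^ (i + j) * u (splice_at j (g \<circ> skip i) (h \<circ> skip i))" for i j
  define W where "W j = u (\<lambda>i. if i < j then g i else h i)" for j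
  have row: "(- 1) ^ j * cobd ?q u (splice_at j g h)
      = W j - W (Suc j) - (\<Sum>k<j. c k (j - 1)) - (\<Sum>i=Suc j..?q. c i j)" if "j \<le> ?q" for j
  proof -
    have split: "sum f {..Suc ?q} = sum f {..<j} + (f j + f (Suc j)) + sum f {Suc (Suc j)..Suc ?q}"
      for f :: "nat \<Rightarrow> real"
    proof -
      have "{..Suc ?q} = {..<j} \<union> {j..Suc ?q}" using that by auto
      then have "sum f {..Suc ?q} = sum f {..<j} + sum f {j..Suc ?q}"
        by (simp only:, subst sum.union_disjoint) auto
      also have "sum f {j..Suc ?q} = f j + sum f {Suc j..Suc ?q}"
        using that by (intro sum.atLeast_Suc_atMost) auto
      also have "sum f {Suc j..Suc ?q} = f (Suc j) + sum f {Suc (Suc j)..Suc ?q}"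
        using that by (intro sum.atLeast_Suc_atMost) auto
      finally show ?thesis by simp
    qed
    have "cobd ?q u (splice_at j g h) =
       (\<Sum>k<j. (- 1) ^ k * u (splice_at j g h \<circ> skip k))
       + ((- 1) ^ j * W j + (- 1) ^ Suc j * W (Suc j))
       + (\<Sum>k=Suc (Suc j)..Suc ?q. (- 1) ^ k * u (splice_at j g h \<circ> skip k))"
      unfolding cobd_def split by (simp only: splice_at_skip_same splice_at_skip_Suc W_def)
    moreover have "(- 1) ^ j * (\<Sum>k<j. (- 1) ^ k * u (splice_at j g h \<circ> skip k)) = - (\<Sum>k<j. c k (j - 1))"
      unfolding sum_distrib_left sum_negf[symmetric]
    proof (rule sum.cong, simp)
      fix k assume "k \<in> {..<j}"
      then have k: "k < j" by simp
      then obtain j' where j': "j = Suc j'" by (cases j) auto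
      show "(- 1) ^ j * ((- 1) ^ k * u (splice_at j g h \<circ> skip k)) = - c k (j - 1)"
        using k by (simp add: splice_at_skip_less c_def j' power_add)
    qed
    moreover have "(- 1) ^ j * (\<Sum>k=Suc (Suc j)..Suc ?q. (- 1) ^ k * u (splice_at j g h \<circ> skip k))
        = - (\<Sum>i=Suc j..?q. c i j)"
      unfolding sum.shift_bounds_cl_Suc_ivl sum_distrib_left sum_negf[symmetric]
      by (rule sum.cong) (simp_all add: splice_at_skip_greater c_def power_add)
    moreover have "(- 1) ^ j * ((- 1) ^ j * W j + (- 1) ^ Suc j * W (Suc j)) = W j - W (Suc j)"
      by (simp add: right_diff_distrib flip: mult.assoc)
    ultimately show ?thesis by (simp add: distrib_left)
  qed
  have "0 = (\<Sum>j\<le>?q. (- 1) ^ j * cobd ?q u (splice_at j g h))"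
    by (simp add: cocycle)
  also have "\<dots> = (\<Sum>j\<le>?q. W j - W (Suc j) - (\<Sum>k<j. c k (j - 1)) - (\<Sum>i=Suc j..?q. c i j))"
    by (rule sum.cong) (auto simp: row)
  also have "\<dots> = (\<Sum>j\<le>?q. W j - W (Suc j)) - (\<Sum>j\<le>?q. \<Sum>k<j. c k (j - 1)) - (\<Sum>j\<le>?q. \<Sum>i=Suc j..?q. c i j)"
    by (simp add: sum_subtractf)
  also have "(\<Sum>j\<le>?q. W j - W (Suc j)) = W 0 - W (Suc ?q)"
    by (rule sum_telescope)
  also have "(\<Sum>j\<le>?q. \<Sum>k<j. c k (j - 1)) = (\<Sum>j\<le>p. \<Sum>k\<le>j. c k j)"
    by (subst sum.atMost_Suc_shift) (simp add: lessThan_Suc_atMost)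
  also have "(\<Sum>j\<le>?q. \<Sum>i=Suc j..?q. c i j) = (\<Sum>j\<le>p. \<Sum>i=Suc j..?q. c i j)"
    by simp
  finally have "W 0 - W (Suc ?q) = (\<Sum>j\<le>p. (\<Sum>k\<le>j. c k j) + (\<Sum>i=Suc j..?q. c i j))"
    by (simp add: sum.distrib)
  also have "\<dots> = (\<Sum>j\<le>p. \<Sum>i\<le>?q. c i j)"
  proof (rule sum.cong, simp)
    fix j assume "j \<in> {..p}"
    then have "{..?q} = {..j} \<union> {Suc j..?q}" by auto
    then show "(\<Sum>k\<le>j. c k j) + (\<Sum>i=Suc j..?q. c i j) = (\<Sum>i\<le>?q. c i j)"
      by (simp only:, subst sum.union_disjoint) auto
  qed
  also have "\<dots> = (\<Sum>i\<le>?q. \<Sum>j\<le>p. c i j)" by (rule sum.swap)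
  also have "\<dots> = (\<Sum>i\<le>?q. (- 1) ^ i * prism p u (g \<circ> skip i) (h \<circ> skip i))"
    by (simp add: c_def prism_def sum_distrib_left power_add mult.assoc)
  \<comment> \<open>\<open>W 0\<close> is \<open>u h\<close>, and \<open>W (Suc ?q)\<close> is
    \<open>u g\<close> because \<open>u\<close> sees only the entries up to
    \<open>?q\<close>.\<close>
  finally show ?thesis
    using depends_uptoD[OF dep, of g "\<lambda>i. if i < Suc ?q then g i else h i"]
    by (simp add: W_def)
qed

section \<open>The Lorentz form\<close>

text \<open>\<open>None\<close> is the time coordinate. Subtracting its contribution twice from the
  Euclidean inner product reverses its sign, and the form inherits bilinearity from the inner
  product.\<close>

definition lform :: "real ^ ('n::finite) option \<Rightarrow> real ^ ('n::finite) option \<Rightarrow> real" where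
  "lform x y = x \<bullet> y - 2 * x $ None * y $ None"

abbreviation origin :: "real ^ ('n::finite) option" where
  "origin \<equiv> axis None 1"

definition spatial :: "real ^ ('n::finite) option \<Rightarrow> real ^ ('n::finite) option" where
  "spatial x = x - x $ None *\<^sub>R origin"

definition cone :: "(real ^ ('n::finite) option) set" where
  "cone = {x. norm (spatial x) < x $ None}"

definition hyperboloid :: "(real ^ ('n::finite) option) set" where
  "hyperboloid = {x \<in> cone. lform x x = - 1}"

lemma origin_None [simp]: "origin $ None = 1" by (simp add: axis_def)

lemma inner_origin [simp]: "x \<bullet> origin = x $ None" "origin \<bullet> x = x $ None"
  by (simp_all add: inner_axis inner_axis')

lemma spatial_None [simp]: "spatial x $ None = 0" by (simp add: spatial_def)

lemma lform_spatial: "lform x y = spatial x \<bullet> spatial y - x $ None * y $ None"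
  by (simp add: lform_def spatial_def inner_diff_left inner_diff_right algebra_simps)

lemma lform_add_left: "lform (x + y) z = lform x z + lform y z"
  and lform_add_right: "lform x (y + z) = lform x y + lform x z"
  and lform_diff_left: "lform (x - y) z = lform x z - lform y z"
  and lform_diff_right: "lform x (y - z) = lform x y - lform x z"
  and lform_minus_left: "lform (- x) y = - lform x y"
  and lform_minus_right: "lform x (- y) = - lform x y"
  and lform_scale_left: "lform (c *\<^sub>R x) y = c * lform x y"
  and lform_scale_right: "lform x (c *\<^sub>R y) = c * lform x y"
  and lform_zero_left: "lform 0 y = 0"
  and lform_zero_right: "lform x 0 = 0"
  by (simp_all add: lform_def inner_add_left inner_add_right inner_diff_left inner_diff_right algebra_simps)

lemmas lform_simps = lform_add_left lform_add_right lform_diff_left lform_diff_right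
  lform_minus_left lform_minus_right lform_scale_left lform_scale_right lform_zero_left lform_zero_right

lemma lform_commute: "lform x y = lform y x"
  by (simp add: lform_def inner_commute)

lemma lform_origin [simp]: "lform x origin = - x $ None" "lform origin x = - x $ None"
  by (simp_all add: lform_def)

lemma lform_self: "lform x x = (norm (spatial x))\<^sup>2 - (x $ None)\<^sup>2"
  by (simp add: lform_spatial flip: power2_norm_eq_inner power2_eq_square)

lemma spatial_add: "spatial (x + y) = spatial x + spatial y"
  and spatial_scale: "spatial (c *\<^sub>R x) = c *\<^sub>R spatial x"
  by (simp_all add: spatial_def algebra_simps)

lemma cone_iff: "x \<in> cone \<longleftrightarrow> lform x x < 0 \<and> x $ None > 0"
proof
  assume "x \<in> cone"
  then have "norm (spatial x) < x $ None" by (simp add: cone_def)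
  then show "lform x x < 0 \<and> x $ None > 0"
    using power_strict_mono[of "norm (spatial x)" "x $ None" 2]
    by (auto simp: lform_self intro: le_less_trans[OF norm_ge_zero])
next
  assume "lform x x < 0 \<and> x $ None > 0"
  then show "x \<in> cone"
    using power2_less_imp_less[of "norm (spatial x)" "x $ None"] by (auto simp: lform_self cone_def)
qed

lemma hyperboloid_iff: "x \<in> hyperboloid \<longleftrightarrow> lform x x = - 1 \<and> x $ None > 0"
  by (auto simp: hyperboloid_def cone_iff)

lemma hyperboloid_cone: "x \<in> hyperboloid \<Longrightarrow> x \<in> cone"
  by (simp add: hyperboloid_def)

lemma origin_hyperboloid [simp]: "origin \<in> hyperboloid"
  by (simp add: hyperboloid_iff)

lemma cone_scale: "x \<in> cone \<Longrightarrow> c > 0 \<Longrightarrow> c *\<^sub>R x \<in> cone"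
  by (simp add: cone_iff lform_simps mult_pos_neg)

lemma cone_add_closed:
  assumes "x \<in> cone" "norm (spatial y) \<le> y $ None"
  shows "x + y \<in> cone"
  using assms norm_triangle_ineq[of "spatial x" "spatial y"] by (auto simp: cone_def spatial_add)

lemma cone_add: "x \<in> cone \<Longrightarrow> y \<in> cone \<Longrightarrow> x + y \<in> cone"
  by (rule cone_add_closed) (auto simp: cone_def)

lemma cone_None_pos: "x \<in> cone \<Longrightarrow> x $ None > 0"
  by (simp add: cone_iff)

text \<open>Cauchy-Schwarz on the spatial parts. The second vector may lie on the boundary of the
  cone, as the lightlike vector used later does.\<close>

lemma lform_cone_neg:
  assumes "x \<in> cone" "norm (spatial y) \<le> y $ None" "y $ None > 0"
  shows "lform x y < 0"
proof -
  have "spatial x \<bullet> spatial y \<le> norm (spatial x) * norm (spatial y)"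
    by (rule norm_cauchy_schwarz)
  also have "\<dots> \<le> norm (spatial x) * y $ None"
    using assms by (intro mult_left_mono) auto
  also have "\<dots> < x $ None * y $ None"
    using assms by (intro mult_strict_right_mono) (auto simp: cone_def)
  finally show ?thesis by (simp add: lform_spatial)
qed

lemma lform_cone_cone: "x \<in> cone \<Longrightarrow> y \<in> cone \<Longrightarrow> lform x y < 0"
  using cone_None_pos[of y] by (intro lform_cone_neg) (auto simp: cone_def)

definition normalize_cone :: "real ^ ('n::finite) option \<Rightarrow> real ^ ('n::finite) option" where
  "normalize_cone x = (1 / sqrt (- lform x x)) *\<^sub>R x"

lemma normalize_cone_hyperboloid: "x \<in> cone \<Longrightarrow> normalize_cone x \<in> hyperboloid"
  using real_sqrt_mult_self[of "- lform x x"]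
  by (simp add: hyperboloid_iff normalize_cone_def lform_simps cone_iff)

lemma normalize_cone_id: "x \<in> hyperboloid \<Longrightarrow> normalize_cone x = x"
  by (simp add: normalize_cone_def hyperboloid_iff)

text \<open>With time coordinates a and b the squared spatial norms are a^2 - 1 and b^2 - 1, and (a
  b - 1)^2 exceeds their product by (a - b)^2.\<close>

lemma reverse_cauchy_schwarz:
  assumes "x \<in> hyperboloid" "y \<in> hyperboloid"
  shows "lform x y \<le> - 1"
proof -
  have x: "(norm (spatial x))\<^sup>2 = (x $ None)\<^sup>2 - 1" "x $ None > 0"
    and y: "(norm (spatial y))\<^sup>2 = (y $ None)\<^sup>2 - 1" "y $ None > 0"
    using assms by (auto simp: hyperboloid_iff lform_self)
  have x1: "x $ None \<ge> 1"
    by (rule power2_le_imp_le) (use x zero_le_power2[of "norm (spatial x)"] in auto)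
  have y1: "y $ None \<ge> 1"
    by (rule power2_le_imp_le) (use y zero_le_power2[of "norm (spatial y)"] in auto)
  have "(norm (spatial x) * norm (spatial y))\<^sup>2 = ((x $ None)\<^sup>2 - 1) * ((y $ None)\<^sup>2 - 1)"
    by (simp add: power_mult_distrib x y)
  also have "\<dots> \<le> (x $ None * y $ None - 1)\<^sup>2"
    using zero_le_power2[of "x $ None - y $ None"] by (simp add: power2_eq_square algebra_simps)
  finally have "norm (spatial x) * norm (spatial y) \<le> x $ None * y $ None - 1"
    by (rule power2_le_imp_le) (use mult_mono[OF x1 y1] x1 y1 in auto)
  then show ?thesis
    using norm_cauchy_schwarz[of "spatial x" "spatial y"] by (simp add: lform_spatial)
qed

lemma hyperboloid_None_ge: "x \<in> hyperboloid \<Longrightarrow> x $ None \<ge> 1"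
  using reverse_cauchy_schwarz[of x origin] by simp

definition lorentz :: "(real ^ ('n::finite) option ^ ('n::finite) option) set" where
  "lorentz = {A. (\<forall>x y. lform (A *v x) (A *v y) = lform x y) \<and> (A *v origin) $ None > 0}"

lemma lform_lorentz [simp]: "A \<in> lorentz \<Longrightarrow> lform (A *v x) (A *v y) = lform x y"
  by (simp add: lorentz_def)

lemma lorentz_origin_None: "A \<in> lorentz \<Longrightarrow> (A *v origin) $ None > 0"
  by (simp only: lorentz_def mem_Collect_eq)

text \<open>The image of \<open>x\<close> is timelike and pairs negatively with the image of the
  origin, which is in the cone; a vector of the past cone would pair positively with it.\<close>

lemma lorentz_cone:
  assumes A: "A \<in> lorentz" and x: "x \<in> cone"
  shows "A *v x \<in> cone"
proof -
  have o: "A *v origin \<in> cone" using A by (simp add: cone_iff lorentz_origin_None)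
  have neg: "lform (A *v x) (A *v x) < 0" using A x by (simp add: cone_iff)
  have "lform (A *v x) (A *v origin) < 0" using A x by (simp add: cone_iff)
  moreover have "lform (- (A *v x)) (A *v origin) < 0" if "- (A *v x) \<in> cone"
    using that o by (rule lform_cone_cone)
  ultimately have "- (A *v x) \<notin> cone" by (auto simp: lform_simps)
  then have "\<not> (A *v x) $ None < 0" using neg by (simp add: cone_iff lform_simps)
  moreover have "(A *v x) $ None \<noteq> 0" using neg by (auto simp: lform_self)
  ultimately have "(A *v x) $ None > 0" by linarith
  with neg show ?thesis unfolding cone_iff by blast
qed

lemma lorentz_hyperboloid: "A \<in> lorentz \<Longrightarrow> x \<in> hyperboloid \<Longrightarrow> A *v x \<in> hyperboloid"
  by (simp add: hyperboloid_def lorentz_cone)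

lemma lorentzI:
  assumes "\<And>x y. lform (A *v x) (A *v y) = lform x y" "(A *v origin) $ None > 0"
  shows "A \<in> lorentz"
  unfolding lorentz_def using assms by blast

lemma lorentz_mult:
  assumes A: "A \<in> lorentz" and B: "B \<in> lorentz"
  shows "A ** B \<in> lorentz"
proof (rule lorentzI)
  show "lform (A ** B *v x) (A ** B *v y) = lform x y" for x y
    using A B by (simp flip: matrix_vector_mul_assoc)
  have "A *v (B *v origin) \<in> hyperboloid"
    using A B by (intro lorentz_hyperboloid) auto
  then show "(A ** B *v origin) $ None > 0"
    unfolding matrix_vector_mul_assoc hyperboloid_iff by blast
qed

lemma mat_1_lorentz: "mat 1 \<in> lorentz"
  by (rule lorentzI) simp_all

definition lreflect :: "real ^ ('n::finite) option \<Rightarrow> real ^ ('n::finite) option \<Rightarrow> real ^ ('n::finite) option" where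
  "lreflect w v = v - (2 * lform v w / lform w w) *\<^sub>R w"

lemma linear_lreflect: "linear (lreflect w)"
proof (rule linearI)
  show "lreflect w (x + y) = lreflect w x + lreflect w y" for x y
    unfolding lreflect_def lform_add_left distrib_left add_divide_distrib scaleR_left_distrib by simp
  show "lreflect w (c *\<^sub>R x) = c *\<^sub>R lreflect w x" for c x
    unfolding lreflect_def lform_scale_left scaleR_right_diff_distrib by simp
qed

lemma lform_lreflect:
  assumes "lform w w \<noteq> 0"
  shows "lform (lreflect w x) (lreflect w y) = lform x y"
proof -
  define a where "a = 2 * lform x w / lform w w"
  define b where "b = 2 * lform y w / lform w w"
  have ab: "lform x w = a * lform w w / 2" "lform y w = b * lform w w / 2"
    using assms by (simp_all add: a_def b_def)
  have "lform (lreflect w x) (lreflect w y) = lform (x - a *\<^sub>R w) (y - b *\<^sub>R w)"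
    by (simp only: lreflect_def a_def b_def)
  also have "\<dots> = lform x y - b * lform x w - a * lform y w + a * b * lform w w"
    unfolding lform_diff_left lform_diff_right lform_scale_left lform_scale_right lform_commute[of w y]
    by (simp add: right_diff_distrib)
  finally show ?thesis unfolding ab by simp
qed

lemma lreflect_lreflect:
  assumes "lform w w \<noteq> 0"
  shows "lreflect w (lreflect w x) = x"
proof -
  define a where "a = 2 * lform x w / lform w w"
  have "lform (x - a *\<^sub>R w) w = - lform x w"
    unfolding lform_diff_left lform_scale_left a_def using assms by simp
  then have "lreflect w (x - a *\<^sub>R w) = x - a *\<^sub>R w - (- a) *\<^sub>R w"
    unfolding lreflect_def a_def by simp
  then show ?thesis unfolding lreflect_def[of w x] a_def by simp
qed

text \<open>The hyperbolic point reflection about the midpoint of \<open>x\<close> and the origin;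
  the minus sign restores the time direction. It is a continuous choice of a Lorentz matrix carrying
  the origin to \<open>x\<close>, and being its own inverse it fits the involution hypotheses of the
  later changes of variables.\<close>

definition point_reflection :: "real ^ ('n::finite) option \<Rightarrow> real ^ ('n::finite) option ^ ('n::finite) option" where
  "point_reflection x = matrix (\<lambda>v. - lreflect (x + origin) v)"

lemma point_reflection_mult: "point_reflection x *v v = - lreflect (x + origin) v"
proof -
  have "linear (\<lambda>v. - lreflect (x + origin) v)"
    by (simp add: linear_lreflect linear_compose_neg)
  then have "Vector_Spaces.linear (*s) (*s) (\<lambda>v. - lreflect (x + origin) v)"
    by (simp add: linear_matrix_vector_mul_eq)
  from matrix_works[OF this] show ?thesis
    unfolding point_reflection_def .
qed

lemma
  assumes "x \<in> hyperboloid"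
  shows point_reflection_origin: "point_reflection x *v origin = x"
    and point_reflection_self: "point_reflection x *v x = origin"
    and point_reflection_lorentz: "point_reflection x \<in> lorentz"
    and point_reflection_invol: "point_reflection x ** point_reflection x = mat 1"
proof -
  let ?w = "x + origin"
  have x: "lform x x = - 1" "x $ None > 0" using assms by (auto simp: hyperboloid_iff)
  have w: "lform ?w ?w = - 2 - 2 * x $ None"
    using x by (simp add: lform_simps)
  then have nz: "lform ?w ?w \<noteq> 0" using x by simp
  have "2 * lform origin ?w / lform ?w ?w = 1" "2 * lform x ?w / lform ?w ?w = 1"
    using x nz unfolding w by (simp_all add: lform_simps field_simps)
  then show o: "point_reflection x *v origin = x" and "point_reflection x *v x = origin"
    unfolding point_reflection_mult lreflect_def by simp_all
  show "point_reflection x \<in> lorentz"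
  proof (rule lorentzI)
    show "lform (point_reflection x *v v) (point_reflection x *v v') = lform v v'" for v v'
      by (simp only: point_reflection_mult lform_minus_left lform_minus_right lform_lreflect[OF nz] minus_minus)
    show "(point_reflection x *v origin) $ None > 0" using x o by simp
  qed
  show "point_reflection x ** point_reflection x = mat 1"
  proof (rule matrix_eq[THEN iffD2], rule allI)
    fix v
    show "point_reflection x ** point_reflection x *v v = mat 1 *v v"
      unfolding matrix_vector_mul_assoc[symmetric] point_reflection_mult linear_neg[OF linear_lreflect]
        lreflect_lreflect[OF nz] by simp
  qed
qed

text \<open>Both sides are moved to the case in which \<open>z\<close> is the origin.\<close>

lemma hyperbolic_triangle:
  assumes "x \<in> hyperboloid" "y \<in> hyperboloid" "z \<in> hyperboloid"
  shows "- lform x y \<le> 2 * (lform x z * lform z y)"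
proof -
  let ?A = "point_reflection z"
  note A = point_reflection_lorentz[OF assms(3)]
  define x' where "x' = ?A *v x"
  define y' where "y' = ?A *v y"
  have "lform x z = lform (?A *v x) (?A *v z)" by (rule lform_lorentz[OF A, symmetric])
  also have "\<dots> = - x' $ None"
    by (simp only: point_reflection_self[OF assms(3)] lform_origin x'_def)
  finally have xz: "lform x z = - x' $ None" .
  have "lform z y = lform (?A *v z) (?A *v y)" by (rule lform_lorentz[OF A, symmetric])
  also have "\<dots> = - y' $ None"
    by (simp only: point_reflection_self[OF assms(3)] lform_origin y'_def)
  finally have zy: "lform z y = - y' $ None" .
  have c: "x' \<in> cone" "y' \<in> cone"
    unfolding x'_def y'_def by (rule lorentz_cone[OF A hyperboloid_cone[OF assms(1)]])
      (rule lorentz_cone[OF A hyperboloid_cone[OF assms(2)]])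
  have "- (spatial x' \<bullet> spatial y') \<le> norm (spatial x') * norm (spatial y')"
    using Cauchy_Schwarz_ineq2[of "spatial x'" "spatial y'"] by linarith
  also have "\<dots> \<le> x' $ None * y' $ None"
    using c[THEN cone_None_pos] c by (intro mult_mono) (simp_all add: cone_def less_imp_le)
  \<comment> \<open>The time coordinates are the hyperbolic cosines of the distances to
    \<open>z\<close>, so this is cosh (a + b) \<le> 2 cosh a cosh b.\<close>
  finally have "- lform x' y' \<le> 2 * (x' $ None * y' $ None)"
    by (simp add: lform_spatial)
  moreover have "lform x' y' = lform x y" unfolding x'_def y'_def by (rule lform_lorentz[OF A])
  ultimately show ?thesis by (simp add: xz zy)
qed

section \<open>Cocycles on the hyperboloid\<close>

definition reflection_matrix :: "real ^ ('n::finite) option \<Rightarrow> real ^ 'n option ^ 'n option" where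
  "reflection_matrix w = matrix (lreflect w)"

lemma reflection_matrix_mult: "reflection_matrix w *v v = lreflect w v"
proof -
  have "Vector_Spaces.linear (*s) (*s) (lreflect w)"
    by (simp add: linear_matrix_vector_mul_eq linear_lreflect)
  from matrix_works[OF this] show ?thesis
    unfolding reflection_matrix_def .
qed

lemma lform_spatial_vector: "w $ None = 0 \<Longrightarrow> lform w v = w \<bullet> v"
  by (simp add: lform_def)

lemma reflection_matrix_lorentz:
  assumes "w $ None = 0" "w \<noteq> 0"
  shows "reflection_matrix w \<in> lorentz"
proof (rule lorentzI)
  have "lform w w \<noteq> 0" using assms by (simp add: lform_spatial_vector)
  then show "lform (reflection_matrix w *v x) (reflection_matrix w *v y) = lform x y" for x y
    unfolding reflection_matrix_mult by (rule lform_lreflect)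
  show "(reflection_matrix w *v origin) $ None > 0"
    unfolding reflection_matrix_mult lreflect_def using assms by simp
qed

lemma reflection_matrix_invol:
  assumes "w $ None = 0" "w \<noteq> 0"
  shows "reflection_matrix w ** reflection_matrix w = mat 1"
proof -
  have "lform w w \<noteq> 0" using assms by (simp add: lform_spatial_vector)
  then show ?thesis
    by (subst matrix_eq) (simp add: reflection_matrix_mult lreflect_lreflect flip: matrix_vector_mul_assoc)
qed

lemma lreflect_swap:
  assumes "v $ None = 0" "b $ None = 0" "norm v = 1" "norm b = 1" "v \<noteq> b"
  shows "lreflect (v - b) v = b"
proof -
  have n: "v \<bullet> v = 1" "b \<bullet> b = 1" using assms by (simp_all add: norm_eq_1)
  have "lform v (v - b) = 1 - v \<bullet> b" "lform (v - b) (v - b) = 2 * (1 - v \<bullet> b)"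
    using assms n by (simp_all add: lform_spatial_vector inner_diff_left inner_diff_right inner_commute[of b v])
  moreover have "lform (v - b) (v - b) \<noteq> 0"
    using assms by (simp add: lform_spatial_vector)
  ultimately have "2 * lform v (v - b) / lform (v - b) (v - b) = 1" by simp
  then show ?thesis unfolding lreflect_def by simp
qed

text \<open>A proper subspace is fixed by a reflection; after moving a point of it to the origin and the
  normal vector to an axis, this is the reflection in a coordinate hyperplane.\<close>

text \<open>The reflection in a vector orthogonal to all points fixes them and reverses the sign of \<open>u\<close>.\<close>

lemma equivariant_vanishes:
  fixes e :: "real ^ ('n::finite) option ^ 'n option \<Rightarrow> real"
  assumes e_abs: "\<And>A. A \<in> lorentz \<Longrightarrow> \<bar>e A\<bar> = 1"
    and e_refl: "e (reflection_matrix (axis (Some a) 1)) = - 1"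
    and dep: "depends_upto q u"
    and equi: "\<And>A x. A \<in> lorentz \<Longrightarrow> A ** A = mat 1 \<Longrightarrow> (\<And>i. x i \<in> cone)
      \<Longrightarrow> u (\<lambda>i. A *v x i) = e A * u x"
    and x: "\<And>i. x i \<in> cone"
    and dim: "dim (x ` {..q}) \<le> CARD('n)"
  shows "u x = 0"
proof -
  have "dim (x ` {..q}) < DIM(real ^ 'n option)" using dim by simp
  from orthogonal_to_subspace_exists[OF this] obtain w
    where w: "w \<noteq> 0" "\<And>y. y \<in> span (x ` {..q}) \<Longrightarrow> orthogonal w y" by metis
  \<comment> \<open>Reversing the time coordinate of the Euclidean normal \<open>w\<close> makes it
    a Lorentz normal.\<close>
  define v where "v = w - (2 * w $ None) *\<^sub>R origin"
  have v_lform: "lform v y = w \<bullet> y" for y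
    by (simp add: v_def lform_def inner_diff_left algebra_simps)
  have v_orth: "lform v (x i) = 0" if "i \<le> q" for i
    using w(2)[of "x i"] that by (simp add: v_lform orthogonal_def span_base)
  have "v \<noteq> 0"
    using v_lform[of w] w(1) by (auto simp: lform_simps)
  \<comment> \<open>With the first point moved to the origin the normal vector is orthogonal to the
    origin, hence purely spatial, and can be scaled to Euclidean norm 1 and reflected onto an
    axis.\<close>
  define y where "y = normalize_cone (x 0)"
  have y: "y \<in> hyperboloid" unfolding y_def by (rule normalize_cone_hyperboloid[OF x])
  define A where "A = point_reflection y"
  have A: "A \<in> lorentz" unfolding A_def by (rule point_reflection_lorentz[OF y])
  define v' where "v' = A *v v"
  have "A *v v' = v"
    unfolding v'_def A_def matrix_vector_mul_assoc point_reflection_invol[OF y] by simp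
  with \<open>v \<noteq> 0\<close> have "v' \<noteq> 0" by auto
  have "lform v' origin = lform v y"
    unfolding v'_def A_def point_reflection_self[OF y, symmetric]
    by (rule lform_lorentz[OF point_reflection_lorentz[OF y]])
  also have "\<dots> = 0" using v_orth[of 0] by (simp add: y_def normalize_cone_def lform_simps)
  finally have v'0: "v' $ None = 0" by simp
  define z where "z i = A *v x i" for i
  have z: "z i \<in> cone" for i unfolding z_def by (rule lorentz_cone[OF A x])
  have z_orth: "lform v' (z i) = 0" if "i \<le> q" for i
    using v_orth[OF that] unfolding z_def v'_def lform_lorentz[OF A] .
  define b where "b = (axis (Some a) 1 :: real ^ 'n option)"
  define v1 where "v1 = (1 / norm v') *\<^sub>R v'"
  have v1: "v1 $ None = 0" "norm v1 = 1" using v'0 \<open>v' \<noteq> 0\<close> by (simp_all add: v1_def)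
  have b: "b $ None = 0" "norm b = 1" "b \<noteq> 0" by (simp_all add: b_def) (simp add: axis_def)
  have "\<exists>C\<in>lorentz. C ** C = mat 1 \<and> C *v v1 = b"
  proof (cases "v1 = b")
    case True
    then show ?thesis using mat_1_lorentz by (intro bexI[of _ "mat 1"]) auto
  next
    case False
    have "reflection_matrix (v1 - b) \<in> lorentz"
      by (rule reflection_matrix_lorentz) (use v1 b False in simp_all)
    moreover have "reflection_matrix (v1 - b) *v v1 = b"
      unfolding reflection_matrix_mult by (rule lreflect_swap) (use v1 b False in simp_all)
    moreover have "reflection_matrix (v1 - b) ** reflection_matrix (v1 - b) = mat 1"
      by (rule reflection_matrix_invol) (use v1 b False in simp_all)
    ultimately show ?thesis by blast
  qed
  then obtain C where C: "C \<in> lorentz" "C *v v1 = b" "C ** C = mat 1" by blast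
  define t where "t i = C *v z i" for i
  have t: "t i \<in> cone" for i unfolding t_def by (rule lorentz_cone[OF C(1) z])
  have t_orth: "lform (t i) b = 0" if "i \<le> q" for i
  proof -
    have "lform b (t i) = lform v1 (z i)"
      unfolding C(2)[symmetric] t_def by (rule lform_lorentz[OF C(1)])
    also have "\<dots> = 0" using z_orth[OF that] by (simp add: v1_def lform_simps)
    finally show ?thesis by (subst lform_commute)
  qed
  \<comment> \<open>The entries up to \<open>q\<close> are orthogonal to \<open>b\<close> and stay
    fixed; the later ones may move, which \<open>depends_upto\<close> permits.\<close>
  have "u t = u (\<lambda>i. reflection_matrix b *v t i)"
    by (rule depends_uptoD[OF dep]) (simp add: reflection_matrix_mult lreflect_def t_orth)
  also have "\<dots> = e (reflection_matrix b) * u t"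
    by (rule equi[OF reflection_matrix_lorentz[OF b(1,3)] reflection_matrix_invol[OF b(1,3)] t])
  also have "\<dots> = - u t" using e_refl by (simp add: b_def)
  finally have "u t = 0" by simp
  moreover have "u t = e C * u z" unfolding t_def by (rule equi[OF C(1,3) z])
  moreover have "u z = e A * u x" unfolding z_def
    by (rule equi[OF A _ x]) (simp add: A_def point_reflection_invol[OF y])
  ultimately show ?thesis using e_abs[OF A] e_abs[OF C(1)] by auto
qed

section \<open>Tuples of bounded size, and growth by bisection\<close>

lemma compact_hyperboloid_le: "compact {y \<in> hyperboloid. y $ None \<le> c}"
proof -
  have eq: "{y \<in> hyperboloid. y $ None \<le> c} = {y. lform y y = - 1 \<and> 0 \<le> y $ None \<and> y $ None \<le> c}"
    by (auto simp: hyperboloid_iff lform_self less_le) (smt (verit) zero_le_power2)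
  have "closed {y. lform y y = - 1 \<and> 0 \<le> y $ None \<and> y $ None \<le> c}"
    unfolding lform_def
    by (intro closed_Collect_conj closed_Collect_eq closed_Collect_le continuous_intros)
  moreover have "bounded {y. lform y y = - 1 \<and> 0 \<le> y $ None \<and> y $ None \<le> c}"
    unfolding bounded_iff
  proof (intro exI ballI)
    fix y assume "y \<in> {y. lform y y = - 1 \<and> 0 \<le> y $ None \<and> y $ None \<le> c}"
    then have y: "y \<bullet> y = 2 * (y $ None)\<^sup>2 - 1" "0 \<le> y $ None" "y $ None \<le> c"
      by (auto simp: lform_def power2_eq_square)
    have "(norm y)\<^sup>2 \<le> (2 * c)\<^sup>2"
      unfolding power2_norm_eq_inner y(1) using power_mono[OF y(3,2), of 2] zero_le_power2[of c]
      unfolding power_mult_distrib by (simp only: power2_eq_square[of "2 :: real"])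
    then show "norm y \<le> 2 * c" by (rule power2_le_imp_le) (use y in simp)
  qed
  ultimately show ?thesis unfolding eq using compact_eq_bounded_closed by blast
qed

text \<open>\<open>F\<close> lives on the whole future cone and is homogeneous of degree 0. In this
  model of functions on hyperbolic space midpoints are sums, and Lebesgue measure on the Lorentz
  space takes the place of hyperbolic volume. Entries with index above \<open>n\<close> are
  dummies.\<close>

locale lorentz_cocycle =
  fixes e :: "real ^ ('n::finite) option ^ 'n option \<Rightarrow> real"
    and a :: 'n
    and n :: nat
    and F :: "(nat \<Rightarrow> real ^ 'n option) \<Rightarrow> real"
  assumes n_eq: "n = CARD('n)"
    and e_abs: "\<And>A. A \<in> lorentz \<Longrightarrow> \<bar>e A\<bar> = 1"
    and e_refl: "e (reflection_matrix (axis (Some a) 1)) = - 1"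
    and dim_ge: "n \<ge> 2"
    and dep: "depends_upto n F"
    and equi: "\<And>A x. A \<in> lorentz \<Longrightarrow> (\<And>i. x i \<in> cone) \<Longrightarrow> F (\<lambda>i. A *v x i) = e A * F x"
    and homogeneous: "\<And>c x. (\<And>i. x i \<in> cone) \<Longrightarrow> (\<And>i. c i > 0) \<Longrightarrow> F (\<lambda>i. c i *\<^sub>R x i) = F x"
    and cocycle: "\<And>x. (\<And>i. x i \<in> cone) \<Longrightarrow> cobd n F x = 0"
    and cont: "continuous_on {x. \<forall>i. x i \<in> cone} F"
begin

text \<open>The \<open>n + 1\<close> points then span at most \<open>n\<close> of the
  \<open>n + 1\<close> dimensions.\<close>

lemma degenerate:
  assumes x: "\<And>i. x i \<in> cone" and i: "i \<le> n" and span: "x i \<in> span (x ` ({..n} - {i}))"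
  shows "F x = 0"
proof (rule equivariant_vanishes[OF e_abs e_refl dep equi x])
  have "x ` {..n} \<subseteq> span (x ` ({..n} - {i}))"
    using span by (auto intro: span_base)
  then have "dim (x ` {..n}) \<le> card (x ` ({..n} - {i}))" by (rule dim_le_card) simp
  also have "\<dots> \<le> card ({..n} - {i})" by (rule card_image_le) simp
  also have "\<dots> = n" using i by simp
  finally show "dim (x ` {..n}) \<le> CARD('n)" by (simp add: n_eq)
qed

lemma abs_equi:
  assumes "A \<in> lorentz" "\<And>i. x i \<in> cone"
  shows "\<bar>F (\<lambda>i. A *v x i)\<bar> = \<bar>F x\<bar>"
  using equi[OF assms] e_abs[OF assms(1)] by (simp add: abs_mult)

lemma bounded_on_bounded:
  "\<exists>K. \<forall>x. (\<forall>i. x i \<in> hyperboloid) \<longrightarrow> (\<forall>i\<le>n. \<forall>j\<le>n. - lform (x i) (x j) \<le> c) \<longrightarrow> \<bar>F x\<bar> \<le> K"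
proof -
  let ?S = "{y \<in> hyperboloid. y $ None \<le> max c 1} :: (real ^ 'n option) set"
  have "compactin (product_topology (\<lambda>_. euclidean) UNIV) (PiE UNIV (\<lambda>i::nat. ?S))"
    using compact_hyperboloid_le[of "max c 1"] by (subst compactin_PiE) auto
  then have "compact {x. \<forall>i::nat. x i \<in> ?S}"
    unfolding euclidean_product_topology by (simp add: PiE_UNIV_domain Pi_def)
  moreover have "continuous_on {x. \<forall>i::nat. x i \<in> ?S} F"
    by (rule continuous_on_subset[OF cont]) (auto intro: hyperboloid_cone)
  ultimately have "bounded (F ` {x. \<forall>i::nat. x i \<in> ?S})"
    by (intro compact_imp_bounded compact_continuous_image)
  then obtain K where K: "\<And>x. (\<And>i. x i \<in> ?S) \<Longrightarrow> \<bar>F x\<bar> \<le> K"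
    unfolding bounded_iff by auto
  have "\<bar>F x\<bar> \<le> K" if x: "\<And>i. x i \<in> hyperboloid"
    and c: "\<And>i j. i \<le> n \<Longrightarrow> j \<le> n \<Longrightarrow> - lform (x i) (x j) \<le> c" for x
  proof -
    let ?A = "point_reflection (x 0)"
    note A = point_reflection_lorentz[OF x[of 0]]
    \<comment> \<open>Moving point \<open>0\<close> to the origin turns the bound on
      \<open>- lform\<close> into a bound on time coordinates. Entries above \<open>n\<close> are
      not controlled by the hypothesis and are replaced by the origin, so that the sequence lies in
      a compact product.\<close>
    define z where "z i = (if i \<le> n then ?A *v x i else origin)" for i
    have "z i \<in> ?S" for i
    proof (cases "i \<le> n")
      case True
      have "lform origin (?A *v x i) = lform (x 0) (x i)"
        using lform_lorentz[OF A, of "x 0" "x i"] unfolding point_reflection_self[OF x] .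
      then have "(?A *v x i) $ None \<le> c" using c[of 0 i] True by simp
      moreover have "?A *v x i \<in> hyperboloid" by (rule lorentz_hyperboloid[OF A x])
      ultimately show ?thesis using True by (simp add: z_def)
    qed (simp add: z_def)
    then have "\<bar>F z\<bar> \<le> K" by (rule K)
    also have "F z = F (\<lambda>i. ?A *v x i)" by (rule depends_uptoD[OF dep]) (simp add: z_def)
    also have "\<bar>F (\<lambda>i. ?A *v x i)\<bar> = \<bar>F x\<bar>" by (rule abs_equi[OF A hyperboloid_cone[OF x]])
    finally show ?thesis .
  qed
  then show ?thesis by blast
qed

lemma case_nat_skip_0: "case_nat m v \<circ> skip 0 = v"
  by (rule ext) (simp add: skip_def)

lemma case_nat_skip_Suc: "case_nat m v \<circ> skip (Suc k) = case_nat m (v \<circ> skip k)"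
  by (rule ext) (simp add: skip_def split: nat.split)

lemma case_nat_skip_image:
  assumes "k \<le> n"
  shows "case_nat m (v \<circ> skip k) ` {..n} \<subseteq> insert m (v ` ({..n} - {k}))"
proof
  fix y assume "y \<in> case_nat m (v \<circ> skip k) ` {..n}"
  then obtain i where i: "i \<le> n" "y = case_nat m (v \<circ> skip k) i" by auto
  then show "y \<in> insert m (v ` ({..n} - {k}))"
    by (cases i) (auto simp: skip_def)
qed

text \<open>Apply the cocycle relation to \<open>v\<close> with \<open>m\<close> put in front.
  Deleting \<open>m\<close> leaves \<open>F v\<close>; deleting any \<open>v k\<close> other than
  the two ends keeps the dependent triple \<open>m\<close>, \<open>v i\<close>, \<open>v j\<close>.
  So only two further terms survive.\<close>

lemma split_edge:
  assumes v: "\<And>i. v i \<in> cone" and m: "m \<in> cone" "m \<in> span {v i, v j}"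
    and ij: "i \<le> n" "j \<le> n" "i \<noteq> j"
  shows "\<bar>F v\<bar> \<le> \<bar>F (case_nat m (v \<circ> skip i))\<bar> + \<bar>F (case_nat m (v \<circ> skip j))\<bar>"
proof -
  let ?f = "\<lambda>k. F (case_nat m (v \<circ> skip k))"
  have mv: "case_nat m w l \<in> cone" if "\<And>i. w i \<in> cone" for w l
    using m(1) that by (simp split: nat.split)
  have zero: "?f k = 0" if k: "k \<le> n" "k \<noteq> i" "k \<noteq> j" for k
  proof -
    have "case_nat m (v \<circ> skip k) 0 \<in> span (case_nat m (v \<circ> skip k) ` ({..n} - {0}))"
    proof -
      have "v l \<in> case_nat m (v \<circ> skip k) ` ({..n} - {0})" if "l \<le> n" "l \<noteq> k" for l
      proof -
        have "case_nat m (v \<circ> skip k) (if l < k then Suc l else l) = v l"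
          using that by (auto simp: skip_def split: nat.split)
        moreover have "(if l < k then Suc l else l) \<in> {..n} - {0}" using that k by auto
        ultimately show ?thesis by (metis imageI)
      qed
      then have "{v i, v j} \<subseteq> case_nat m (v \<circ> skip k) ` ({..n} - {0})"
        using ij k by auto
      from span_mono[OF this] show ?thesis using m(2) by auto
    qed
    then show ?thesis by (intro degenerate[of _ 0] mv) (use v in auto)
  qed
  have "0 = cobd n F (case_nat m v)" by (rule cocycle[symmetric]) (rule mv[OF v])
  also have "\<dots> = F v + (\<Sum>k\<le>n. (- 1) ^ Suc k * ?f k)"
    unfolding cobd_def by (subst sum.atMost_Suc_shift) (simp add: case_nat_skip_0 case_nat_skip_Suc)
  also have "(\<Sum>k\<le>n. (- 1) ^ Suc k * ?f k) = (\<Sum>k\<in>{i, j}. (- 1) ^ Suc k * ?f k)"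
    by (rule sum.mono_neutral_right) (use ij zero in auto)
  finally have "F v = (- 1) ^ i * ?f i + (- 1) ^ j * ?f j" using ij by simp
  then have "\<bar>F v\<bar> \<le> \<bar>(- 1) ^ i * ?f i\<bar> + \<bar>(- 1) ^ j * ?f j\<bar>" by (simp only: abs_triangle_ineq)
  then show ?thesis by (simp add: abs_mult)
qed

text \<open>The midpoint of an edge with \<open>- lform p q = c\<close> has \<open>- lform\<close> at most \<open>sqrt (2 * c)\<close> to all points within \<open>c\<close>
  of both ends; each step removes a bad edge.\<close>

lemma bisect:
  assumes c: "c \<ge> 2" and \<theta>: "\<theta> = sqrt (2 * c)"
    and K: "\<And>w. (\<And>i. w i \<in> hyperboloid) \<Longrightarrow> (\<And>i j. i \<le> n \<Longrightarrow> j \<le> n \<Longrightarrow> - lform (w i) (w j) \<le> \<theta>) \<Longrightarrow> \<bar>F w\<bar> \<le> K"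
  assumes "\<And>i. v i \<in> hyperboloid" "\<And>i j. i \<le> n \<Longrightarrow> j \<le> n \<Longrightarrow> - lform (v i) (v j) \<le> c"
    and "card {(p, q) \<in> v ` {..n} \<times> v ` {..n}. - lform p q > \<theta>} \<le> N"
  shows "\<bar>F v\<bar> \<le> 2 ^ N * K"
  using assms(4-)
proof (induction N arbitrary: v)
  case 0
  have "finite {(p, q) \<in> v ` {..n} \<times> v ` {..n}. - lform p q > \<theta>}"
    by (rule finite_subset[of _ "v ` {..n} \<times> v ` {..n}"]) auto
  with 0(3) have "{(p, q) \<in> v ` {..n} \<times> v ` {..n}. - lform p q > \<theta>} = {}" by simp
  then have "\<bar>F v\<bar> \<le> K" by (intro K 0(1)) force
  then show ?case by simp
next
  case (Suc N)
  note v = Suc.prems(1)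
  define S where "S = v ` {..n}"
  define bad where "bad T = {(p, q) \<in> T \<times> T. - lform p q > \<theta>}" for T :: "(real ^ 'n option) set"
  have finbad: "finite (bad T)" if "finite T" for T
    by (rule finite_subset[of _ "T \<times> T"]) (use that in \<open>auto simp: bad_def\<close>)
  have K0: "K \<ge> 0"
  proof -
    have "\<bar>F (\<lambda>_. origin)\<bar> \<le> K"
      by (rule K) (use c in \<open>auto simp: \<theta>\<close>)
    then show ?thesis by linarith
  qed
  have \<theta>1: "1 \<le> \<theta>" unfolding \<theta> using c by simp
  have \<theta>c: "\<theta> \<le> c" unfolding \<theta> by (rule real_le_lsqrt) (use c in \<open>auto simp: power2_eq_square\<close>)
  have S: "S \<subseteq> hyperboloid" "finite S" "S \<noteq> {}" unfolding S_def using v by auto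
  \<comment> \<open>Bad pairs are counted as pairs of values. Injectivity of \<open>v\<close>
    ensures that deleting an entry removes its value; a tuple with a repeated entry is
    degenerate.\<close>
  consider "bad S = {}" | "\<not> inj_on v {..n}" | "bad S \<noteq> {}" "inj_on v {..n}" by blast
  then show ?case
  proof cases
    case 1
    then have "\<bar>F v\<bar> \<le> K" by (intro K v) (force simp: bad_def S_def)
    also have "\<dots> \<le> 2 ^ Suc N * K" using mult_right_mono[of 1 "2 ^ Suc N" K] K0 by (simp only: one_le_power one_le_numeral mult_1)
    finally show ?thesis .
  next
    case 2
    then obtain i j where "i \<le> n" "j \<le> n" "i \<noteq> j" "v i = v j" by (auto simp: inj_on_def)
    then have "F v = 0" by (intro degenerate[of _ i] hyperboloid_cone v) (auto intro!: span_base)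
    then show ?thesis using K0 by simp
  next
    case 3
    \<comment> \<open>Taking the longest edge makes \<open>- lform p r\<close> and
      \<open>- lform q r\<close> at most \<open>d\<close> for every \<open>r\<close> in
      \<open>S\<close>, which keeps all edges at the midpoint good.\<close>
    let ?M = "Max ((\<lambda>(p, q). - lform p q) ` (S \<times> S))"
    have fin: "finite ((\<lambda>(p, q). - lform p q) ` (S \<times> S))" using S by simp
    have "?M \<in> (\<lambda>(p, q). - lform p q) ` (S \<times> S)" using S by (intro Max_in fin) auto
    then obtain p q where pq: "p \<in> S" "q \<in> S" "- lform p q = ?M" by auto
    have M: "- lform r s \<le> - lform p q" if "r \<in> S" "s \<in> S" for r s
      unfolding pq(3) by (rule Max_ge[OF fin]) (use that in auto)
    define d where "d = - lform p q"
    have d: "\<theta> < d" using 3(1) M unfolding d_def bad_def by force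
    have d1: "1 < d" using d \<theta>1 by simp
    obtain i j where ij: "i \<le> n" "p = v i" "j \<le> n" "q = v j" using pq unfolding S_def by auto
    have dc: "d \<le> c" unfolding d_def ij by (rule Suc.prems(2)[OF ij(1,3)])
    have pq1: "lform p p = - 1" "lform q q = - 1" using S pq by (auto simp: hyperboloid_iff)
    have "i \<noteq> j" using d1 pq1 unfolding d_def ij by auto
    define m where "m = normalize_cone (p + q)"
    have pqc: "p + q \<in> cone" using S pq by (intro cone_add hyperboloid_cone) auto
    have m: "m \<in> hyperboloid" unfolding m_def by (rule normalize_cone_hyperboloid[OF pqc])
    have "lform (p + q) (p + q) = - (2 + 2 * d)"
      unfolding d_def lform_add_left lform_add_right pq1 using lform_commute[of q p] by simp
    then have m_eq: "m = (1 / sqrt (2 + 2 * d)) *\<^sub>R (p + q)"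
      unfolding m_def normalize_cone_def by simp
    have m_lform: "- lform m r \<le> \<theta>" if r: "r \<in> insert m S" for r
    proof (cases "r = m")
      case True
      then show ?thesis using m \<theta>1 by (simp add: hyperboloid_iff)
    next
      case False
      then have "- lform p r \<le> d" "- lform q r \<le> d" using M[of p r] M[of q r] pq r unfolding d_def by auto
      then have "(- lform p r + - lform q r) / sqrt (2 + 2 * d) \<le> 2 * d / sqrt (2 + 2 * d)"
        using d1 by (intro divide_right_mono) auto
      moreover have "- lform m r = (- lform p r + - lform q r) / sqrt (2 + 2 * d)"
        unfolding m_eq lform_scale_left lform_add_left
        by (simp add: diff_divide_distrib add_divide_distrib distrib_left)
      ultimately have "- lform m r \<le> 2 * d / sqrt (2 + 2 * d)" by simp
      also have "\<dots> \<le> 2 * d / sqrt (2 * d)" using d1 by (intro divide_left_mono) auto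
      also have "\<dots> = sqrt (2 * d)" using d1 by (simp add: real_div_sqrt)
      also have "\<dots> \<le> \<theta>" unfolding \<theta> using dc by simp
      finally show ?thesis .
    qed
    have half: "\<bar>F (case_nat m (v \<circ> skip k))\<bar> \<le> 2 ^ N * K" if k: "k = i \<or> k = j" for k
    proof (rule Suc.IH)
      have kn: "k \<le> n" using k ij by auto
      let ?w = "case_nat m (v \<circ> skip k)"
      note sub = case_nat_skip_image[OF kn, of m v]
      show "?w l \<in> hyperboloid" for l using m v by (simp split: nat.split)
      have sub2: "insert m (v ` ({..n} - {k})) \<subseteq> insert m S" unfolding S_def by auto
      show "- lform (?w l) (?w l') \<le> c" if "l \<le> n" "l' \<le> n" for l l'
      proof -
        have "?w l \<in> insert m S" "?w l' \<in> insert m S" using sub sub2 that by blast+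
        then show ?thesis
          using m_lform[of "?w l"] m_lform[of "?w l'"] \<theta>c lform_commute[of m "?w l"]
            M[of "?w l" "?w l'"] dc unfolding d_def by fastforce
      qed
      have nb: "(r, s) \<in> bad S \<and> r \<noteq> m \<and> s \<noteq> m" if rs: "(r, s) \<in> bad (?w ` {..n})" for r s
      proof -
        have *: "r \<in> insert m S" "s \<in> insert m S" "- lform r s > \<theta>"
          using rs sub sub2 unfolding bad_def by auto
        then have "r \<noteq> m" "s \<noteq> m" using m_lform[of r] m_lform[of s] lform_commute[of r m] by auto
        then show ?thesis using * unfolding bad_def by auto
      qed
      \<comment> \<open>No bad pair contains \<open>m\<close>, so the bad pairs of the new tuple are
        old ones; the pair \<open>(p, q)\<close> has lost one of its ends, and the count
        drops.\<close>
      have "(p, q) \<notin> bad (?w ` {..n})"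
      proof
        assume a: "(p, q) \<in> bad (?w ` {..n})"
        then have "v k \<noteq> m" using nb[OF a] k ij by auto
        moreover have "v k \<in> ?w ` {..n}" using a k ij unfolding bad_def by auto
        ultimately have "v k \<in> v ` ({..n} - {k})" using sub by auto
        then show False using 3(2) kn unfolding inj_on_def by auto
      qed
      moreover have "(p, q) \<in> bad S" using pq d unfolding bad_def d_def by auto
      ultimately have "bad (?w ` {..n}) \<subset> bad S" using nb by auto
      then have "card (bad (?w ` {..n})) < card (bad S)" by (intro psubset_card_mono finbad S)
      then show "card {(p, q) \<in> ?w ` {..n} \<times> ?w ` {..n}. - lform p q > \<theta>} \<le> N"
        using Suc.prems(3) unfolding bad_def S_def by simp
    qed
    have "\<bar>F v\<bar> \<le> \<bar>F (case_nat m (v \<circ> skip i))\<bar> + \<bar>F (case_nat m (v \<circ> skip j))\<bar>"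
    proof (rule split_edge)
      show "m \<in> span {v i, v j}"
        unfolding m_eq ij by (intro span_scale span_add span_base) auto
    qed (use v m ij \<open>i \<noteq> j\<close> in \<open>auto intro: hyperboloid_cone\<close>)
    also have "\<dots> \<le> 2 ^ Suc N * K" using half[of i] half[of j] by simp
    finally show ?thesis .
  qed
qed

text \<open>\<open>bisect\<close> bounds \<open>F\<close> at size \<open>c\<close> by
  \<open>L\<close> times its bound at size \<open>sqrt (2 * c)\<close>. The threshold
  \<open>c1 = 2 * L ^ 8\<close> is where a bound by the fourth root of \<open>c\<close> reproduces
  itself: \<open>L\<close> times the eighth root of \<open>2 * c\<close> is the eighth root of
  \<open>c1 * c\<close>, at most the fourth root of \<open>c\<close> as soon as
  \<open>c1 \<le> c\<close>. Below \<open>c1\<close> compactness provides \<open>C\<close>.\<close>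

lemma growth:
  "\<exists>C. \<forall>c v. 1 \<le> c \<longrightarrow> (\<forall>i. v i \<in> hyperboloid) \<longrightarrow> (\<forall>i\<le>n. \<forall>j\<le>n. - lform (v i) (v j) \<le> c)
     \<longrightarrow> \<bar>F v\<bar> \<le> C * sqrt (sqrt c)"
proof -
  define small where "small c v \<longleftrightarrow> (\<forall>i. v i \<in> hyperboloid) \<and> (\<forall>i\<le>n. \<forall>j\<le>n. - lform (v i) (v j) \<le> c)"
    for c and v :: "nat \<Rightarrow> real ^ 'n option"
  \<comment> \<open>The exponent bounds the number of ordered pairs of values of an (n +
    1)-tuple.\<close>
  define L where "L = (2 :: real) ^ (Suc n * Suc n)"
  define c1 where "c1 = 2 * L ^ 8"
  have L: "L \<ge> 2" unfolding L_def by (rule self_le_power[of 2, simplified]) simp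
  have c1: "c1 \<ge> 8"
  proof -
    have "(2::real) ^ 8 \<le> L ^ 8" by (rule power_mono) (use L in auto)
    then show ?thesis by (simp add: c1_def)
  qed
  obtain C where C: "\<And>v. small c1 v \<Longrightarrow> \<bar>F v\<bar> \<le> C"
    using bounded_on_bounded[of c1] unfolding small_def by blast
  have "small c1 (\<lambda>_. origin)" using c1 by (simp add: small_def)
  from C[OF this] have C0: "C \<ge> 0" by linarith
  have step: "\<bar>F v\<bar> \<le> L * K"
    if "c \<ge> 2" "\<And>w. small (sqrt (2 * c)) w \<Longrightarrow> \<bar>F w\<bar> \<le> K" "small c v" for c v K
    unfolding L_def
  proof (rule bisect[OF that(1) refl])
    have "card {(p, q) \<in> v ` {..n} \<times> v ` {..n}. sqrt (2 * c) < - lform p q} \<le> card (v ` {..n} \<times> v ` {..n})"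
      by (rule card_mono) auto
    also have "\<dots> = card (v ` {..n}) * card (v ` {..n})" by (rule card_cartesian_product)
    also have "\<dots> \<le> Suc n * Suc n"
      using card_image_le[of "{..n}" v] by (intro mult_le_mono) auto
    finally show "card {(p, q) \<in> v ` {..n} \<times> v ` {..n}. sqrt (2 * c) < - lform p q} \<le> Suc n * Suc n" .
  qed (use that in \<open>auto simp: small_def\<close>)
  have base: "\<bar>F v\<bar> \<le> C * sqrt (sqrt c)" if "small c1 v" "1 \<le> c" for c v
  proof -
    have "C * 1 \<le> C * sqrt (sqrt c)" using C0 that(2) by (intro mult_left_mono) auto
    with C[OF that(1)] show ?thesis by simp
  qed
  have main: "\<bar>F v\<bar> \<le> C * sqrt (sqrt c)" if "1 \<le> c" "c \<le> c1 * 2 ^ k" "small c v" for c k v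
    using that
  proof (induction k arbitrary: c v)
    case 0
    then have "small c1 v" unfolding small_def by (auto intro: order.trans)
    from base[OF this 0(1)] show ?case .
  next
    case (Suc k)
    show ?case
    proof (cases "c \<le> c1")
      case True
      then have "small c1 v" using Suc(4) unfolding small_def by (auto intro: order.trans)
      from base[OF this Suc(2)] show ?thesis .
    next
      case False
      have c8: "c \<ge> 8" using False c1 by simp
      \<comment> \<open>For \<open>c \<ge> 8\<close> a step at least halves the size, so it leads
        from the range \<open>c1 * 2 ^ Suc k\<close> to the range \<open>c1 * 2 ^ k\<close>.\<close>
      have "2 * c \<le> (c / 2)\<^sup>2" using c8 by (simp add: power2_eq_square)
      then have "sqrt (2 * c) \<le> c / 2" using real_sqrt_le_mono c8 by fastforce
      then have le: "sqrt (2 * c) \<le> c1 * 2 ^ k" using Suc(3) by simp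
      have "\<bar>F v\<bar> \<le> L * (C * sqrt (sqrt (sqrt (2 * c))))"
        by (rule step[OF _ Suc.IH[OF _ le] Suc(4)]) (use c8 in auto)
      also have "\<dots> \<le> sqrt (sqrt (sqrt (L ^ 8))) * (C * sqrt (sqrt (sqrt (2 * c))))"
      proof (rule mult_right_mono)
        show "L \<le> sqrt (sqrt (sqrt (L ^ 8)))"
          by (intro real_le_rsqrt) (simp flip: power_mult)
      qed (use C0 c8 in auto)
      also have "sqrt (sqrt (sqrt (L ^ 8))) * (C * sqrt (sqrt (sqrt (2 * c)))) = C * sqrt (sqrt (sqrt (c1 * c)))"
        unfolding c1_def by (simp add: real_sqrt_mult)
      also have "\<dots> \<le> C * sqrt (sqrt (sqrt (c * c)))"
      proof -
        have "c1 * c \<le> c * c" using c8 False by (intro mult_right_mono) auto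
        then show ?thesis by (intro mult_left_mono C0 real_sqrt_le_mono)
      qed
      also have "\<dots> = C * sqrt (sqrt c)" using c8 by simp
      finally show ?thesis .
    qed
  qed
  have "\<bar>F v\<bar> \<le> C * sqrt (sqrt c)" if "1 \<le> c" "small c v" for c v
  proof -
    obtain k where "c / c1 < 2 ^ k" using real_arch_pow[of 2 "c / c1"] by auto
    then have "c \<le> c1 * 2 ^ k" using c1 by (simp add: field_simps)
    then show ?thesis by (intro main that)
  qed
  then show ?thesis unfolding small_def by blast
qed

end

section \<open>Lebesgue measure under linear involutions and isometries\<close>

lemma nn_integral_lborel_translation:
  fixes f :: "'a::euclidean_space \<Rightarrow> ennreal"
  assumes [measurable]: "f \<in> borel_measurable borel"
  shows "(\<integral>\<^sup>+x. f (c + x) \<partial>lborel) = (\<integral>\<^sup>+x. f x \<partial>lborel)"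
proof -
  have "(\<integral>\<^sup>+x. f x \<partial>lborel) = (\<integral>\<^sup>+x. f x \<partial>(distr lborel borel ((+) c)))"
    by (simp add: lborel_distr_plus)
  also have "\<dots> = (\<integral>\<^sup>+x. f (c + x) \<partial>lborel)" by (rule nn_integral_distr) auto
  finally show ?thesis ..
qed

text \<open>Integrate \<open>indicator A (T x + y) * indicator B y\<close> over \<open>x\<close> and \<open>y\<close> in both orders.\<close>

lemma emeasure_linear_vimage:
  fixes T T' :: "'a::euclidean_space \<Rightarrow> 'a"
  assumes T: "linear T" and inv: "\<And>x. T (T' x) = x"
    and A: "A \<in> sets borel"
  shows "emeasure lborel (T -` A) * emeasure lborel (ball 0 1 :: 'a set)
    = emeasure lborel A * emeasure lborel (T -` ball 0 1)"
proof -
  let ?B = "ball 0 1 :: 'a set"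
  have cont: "continuous_on UNIV T" using T by (simp add: linear_continuous_on linear_conv_bounded_linear)
  have [measurable]: "T \<in> borel_measurable borel" by (rule borel_measurable_continuous_onI[OF cont])
  have B [measurable]: "?B \<in> sets borel" by simp
  note [measurable] = A
  let ?I = "\<lambda>S x. indicator S x :: ennreal"
  have vim: "(\<integral>\<^sup>+x. ?I S (T x) \<partial>lborel) = emeasure lborel (T -` S)" if [measurable]: "S \<in> sets borel" for S
  proof -
    have "T -` S \<in> sets borel" using measurable_sets_borel[of T borel S] by simp
    then have "(\<integral>\<^sup>+x. ?I (T -` S) x \<partial>lborel) = emeasure lborel (T -` S)" by (subst nn_integral_indicator) auto
    moreover have "?I (T -` S) x = ?I S (T x)" for x by (simp add: indicator_def)
    ultimately show ?thesis by simp
  qed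
  have "(\<integral>\<^sup>+y. \<integral>\<^sup>+x. ?I A (T x + y) * ?I ?B y \<partial>lborel \<partial>lborel) = (\<integral>\<^sup>+y. emeasure lborel (T -` A) * ?I ?B y \<partial>lborel)"
  proof (rule nn_integral_cong)
    fix y
    have "(\<integral>\<^sup>+x. ?I A (T x + y) * ?I ?B y \<partial>lborel) = (\<integral>\<^sup>+x. ?I A (T (T' y + x)) \<partial>lborel) * ?I ?B y"
      using T by (subst nn_integral_multc) (auto simp: linear_add inv add.commute)
    also have "(\<integral>\<^sup>+x. ?I A (T (T' y + x)) \<partial>lborel) = (\<integral>\<^sup>+x. ?I A (T x) \<partial>lborel)"
      by (rule nn_integral_lborel_translation[of "\<lambda>x. ?I A (T x)"]) measurable
    finally show "(\<integral>\<^sup>+x. ?I A (T x + y) * ?I ?B y \<partial>lborel) = emeasure lborel (T -` A) * ?I ?B y"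
      by (simp add: vim A)
  qed
  also have "\<dots> = emeasure lborel (T -` A) * emeasure lborel ?B"
    by (subst nn_integral_cmult) auto
  finally have 1: "(\<integral>\<^sup>+y. \<integral>\<^sup>+x. ?I A (T x + y) * ?I ?B y \<partial>lborel \<partial>lborel) = emeasure lborel (T -` A) * emeasure lborel ?B" .
  have "(\<integral>\<^sup>+y. \<integral>\<^sup>+x. ?I A (T x + y) * ?I ?B y \<partial>lborel \<partial>lborel)
      = (\<integral>\<^sup>+x. \<integral>\<^sup>+y. ?I A (T x + y) * ?I ?B y \<partial>lborel \<partial>lborel)"
    by (rule lborel_pair.Fubini') measurable
  also have "\<dots> = (\<integral>\<^sup>+x. \<integral>\<^sup>+y. ?I A y * ?I ?B (y - T x) \<partial>lborel \<partial>lborel)"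
  proof (rule nn_integral_cong)
    fix x
    show "(\<integral>\<^sup>+y. ?I A (T x + y) * ?I ?B y \<partial>lborel) = (\<integral>\<^sup>+y. ?I A y * ?I ?B (y - T x) \<partial>lborel)"
    proof -
      have "(\<integral>\<^sup>+y. ?I A (T x + y) * ?I ?B (T x + y - T x) \<partial>lborel) = (\<integral>\<^sup>+y. ?I A y * ?I ?B (y - T x) \<partial>lborel)"
        by (rule nn_integral_lborel_translation[of "\<lambda>y. ?I A y * ?I ?B (y - T x)"]) measurable
      then show ?thesis by simp
    qed
  qed
  also have "\<dots> = (\<integral>\<^sup>+y. \<integral>\<^sup>+x. ?I A y * ?I ?B (y - T x) \<partial>lborel \<partial>lborel)"
    by (rule lborel_pair.Fubini') measurable
  also have "\<dots> = (\<integral>\<^sup>+y. ?I A y * emeasure lborel (T -` ?B) \<partial>lborel)"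
  proof (rule nn_integral_cong)
    fix y
    \<comment> \<open>\<open>T'\<close> absorbs the translation by \<open>y\<close>, and the sign is
      harmless because the ball is symmetric.\<close>
    have "T (- T' y + x) = - (y - T x)" for x
      by (simp add: linear_diff[OF T] inv)
    then have "?I ?B (y - T x) = ?I ?B (T (- T' y + x))" for x
      by (simp add: indicator_def norm_minus_commute)
    then have "(\<integral>\<^sup>+x. ?I ?B (y - T x) \<partial>lborel) = (\<integral>\<^sup>+x. ?I ?B (T (- T' y + x)) \<partial>lborel)"
      by simp
    also have "\<dots> = (\<integral>\<^sup>+x. ?I ?B (T x) \<partial>lborel)"
      by (rule nn_integral_lborel_translation[of "\<lambda>x. ?I ?B (T x)"]) measurable
    also have "\<dots> = emeasure lborel (T -` ?B)" by (rule vim[OF B])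
    finally have *: "(\<integral>\<^sup>+x. ?I ?B (y - T x) \<partial>lborel) = emeasure lborel (T -` ?B)" .
    have "(\<integral>\<^sup>+x. ?I A y * ?I ?B (y - T x) \<partial>lborel) = ?I A y * (\<integral>\<^sup>+x. ?I ?B (y - T x) \<partial>lborel)"
      by (rule nn_integral_cmult) measurable
    then show "(\<integral>\<^sup>+x. ?I A y * ?I ?B (y - T x) \<partial>lborel) = ?I A y * emeasure lborel (T -` ?B)"
      by (simp only: *)
  qed
  also have "\<dots> = emeasure lborel A * emeasure lborel (T -` ?B)"
    by (subst nn_integral_multc) auto
  finally show ?thesis using 1 by simp
qed

lemma emeasure_open_pos:
  fixes U :: "'a::euclidean_space set"
  assumes "open U" "U \<noteq> {}"
  shows "emeasure lborel U \<noteq> 0"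
proof -
  obtain x e where "e > 0" "ball x e \<subseteq> U" using assms by (metis ex_in_conv openE)
  moreover have "emeasure lborel (ball x e) \<noteq> 0"
    using content_ball_pos[OF \<open>e > 0\<close>, of x] by (auto simp: measure_def)
  moreover have "emeasure lborel (ball x e) \<le> emeasure lborel U"
    using calculation(2) assms by (intro emeasure_mono) auto
  ultimately show ?thesis by auto
qed

lemma emeasure_unit_ball_pos_finite:
  "emeasure lborel (ball 0 1 :: 'a::euclidean_space set) \<noteq> 0"
  "emeasure lborel (ball 0 1 :: 'a::euclidean_space set) \<noteq> \<infinity>"
proof -
  show "emeasure lborel (ball 0 1 :: 'a set) \<noteq> 0" by (rule emeasure_open_pos) auto
  show "emeasure lborel (ball 0 1 :: 'a set) \<noteq> \<infinity>"
    using emeasure_bounded_finite[of "ball 0 1 :: 'a set"] by auto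
qed

text \<open>By \<open>emeasure_linear_vimage\<close> all volumes are scaled by one factor, and the
  unit ball shows that it is 1.\<close>

lemma distr_lborel_linear:
  fixes T T' :: "'a::euclidean_space \<Rightarrow> 'a"
  assumes T: "linear T" and inv: "\<And>x. T (T' x) = x"
    and ball: "emeasure lborel (T -` ball 0 1) = emeasure lborel (ball 0 1 :: 'a set)"
  shows "distr lborel borel T = lborel"
proof (rule measure_eqI)
  fix A assume "A \<in> sets (distr lborel borel T)"
  then have A: "A \<in> sets borel" by simp
  have "continuous_on UNIV T" using T by (simp add: linear_continuous_on linear_conv_bounded_linear)
  then have "T \<in> borel_measurable borel" by (rule borel_measurable_continuous_onI)
  then have "emeasure (distr lborel borel T) A = emeasure lborel (T -` A)"
    using A by (simp add: emeasure_distr)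
  also have "\<dots> = emeasure lborel A"
    using emeasure_linear_vimage[OF T inv A] emeasure_unit_ball_pos_finite[where 'a='a]
    unfolding ball by (simp add: mult.commute[of _ "emeasure lborel (ball 0 1)"] ennreal_mult_cancel_left)
  finally show "emeasure (distr lborel borel T) A = emeasure lborel A" .
qed simp

text \<open>The volume formula is applied to the preimage of the unit ball, whose own preimage is
  the ball again. This gives equality of the squares of the two volumes.\<close>

lemma distr_lborel_involution:
  fixes T :: "'a::euclidean_space \<Rightarrow> 'a"
  assumes T: "linear T" and inv: "\<And>x. T (T x) = x"
  shows "distr lborel borel T = lborel"
proof (rule distr_lborel_linear[OF T inv])
  let ?B = "ball 0 1 :: 'a set"
  have cont: "continuous_on UNIV T" using T by (simp add: linear_continuous_on linear_conv_bounded_linear)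
  have "open (T -` ?B)" using cont by (intro open_vimage) auto
  then have "T -` ?B \<in> sets borel" by auto
  from emeasure_linear_vimage[OF T inv this]
  have "emeasure lborel (T -` (T -` ?B)) * emeasure lborel ?B = emeasure lborel (T -` ?B) * emeasure lborel (T -` ?B)" .
  moreover have "T -` (T -` ?B) = ?B" by (auto simp only: vimage_eq inv)
  ultimately have eq: "emeasure lborel ?B * emeasure lborel ?B = emeasure lborel (T -` ?B) * emeasure lborel (T -` ?B)"
    by simp
  obtain r where r: "emeasure lborel ?B = ennreal r" "r \<ge> 0"
    using emeasure_unit_ball_pos_finite(2)[where 'a='a] by (cases "emeasure lborel ?B") auto
  show "emeasure lborel (T -` ?B) = emeasure lborel ?B"
  proof (cases "emeasure lborel (T -` ?B)")
    case (real s)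
    with eq r have "r * r = s * s" by (simp flip: ennreal_mult)
    then have "r = s" using r real power2_eq_iff_nonneg[of r s] by (simp add: power2_eq_square)
    then show ?thesis using r real by simp
  next
    case top
    with eq r show ?thesis by (simp flip: ennreal_mult)
  qed
qed

lemma distr_lborel_isometry:
  fixes T T' :: "'a::euclidean_space \<Rightarrow> 'a"
  assumes T: "linear T" and inv: "\<And>x. T (T' x) = x" and norm: "\<And>x. norm (T x) = norm x"
  shows "distr lborel borel T = lborel"
proof (rule distr_lborel_linear[OF T inv])
  have "T -` ball 0 1 = ball 0 1" using norm by (auto simp: dist_norm)
  then show "emeasure lborel (T -` ball 0 1) = emeasure lborel (ball 0 1 :: 'a set)" by simp
qed

section \<open>Local regularity from a mean value property\<close>

text \<open>An averaging kernel, invariant when a Lorentz involution moves \<open>x\<close> and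
  \<open>v\<close> together. The condition on \<open>lform v v\<close> keeps \<open>v\<close> off
  the light cone, so that on the support the direction of \<open>v\<close> stays within bounded
  distance of \<open>x\<close>; the cutoff at 3 bounds \<open>v\<close> itself. As a truncated
  linear function of \<open>x\<close> the kernel is Lipschitz in \<open>x\<close>, and the cocycle
  inherits its regularity from there.\<close>

definition weight :: "real ^ ('n::finite) option \<Rightarrow> real ^ 'n option \<Rightarrow> real" where
  "weight x v = (if v \<in> cone \<and> lform v v \<le> - 1 then max 0 (3 + lform x v) else 0)"

lemma weight_nonneg: "weight x v \<ge> 0" by (simp add: weight_def)

lemma weight_cone: "v \<notin> cone \<Longrightarrow> weight x v = 0" by (simp add: weight_def)

lemma lorentz_cone_iff:
  assumes "A \<in> lorentz" "A ** A = mat 1"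
  shows "A *v v \<in> cone \<longleftrightarrow> v \<in> cone"
proof -
  have "A *v (A *v v) = v" unfolding matrix_vector_mul_assoc assms(2) by simp
  then show ?thesis using lorentz_cone[OF assms(1), of v] lorentz_cone[OF assms(1), of "A *v v"] by auto
qed

lemma weight_lorentz:
  assumes "A \<in> lorentz" "A ** A = mat 1"
  shows "weight (A *v x) (A *v v) = weight x v"
  by (simp add: weight_def lorentz_cone_iff[OF assms] assms(1))

lemma continuous_lform [continuous_intros]:
  "continuous_on S f \<Longrightarrow> continuous_on S g \<Longrightarrow> continuous_on S (\<lambda>x. lform (f x) (g x))"
  unfolding lform_def by (intro continuous_intros)

lemma continuous_spatial [continuous_intros]:
  "continuous_on S f \<Longrightarrow> continuous_on S (\<lambda>x. spatial (f x))"
  unfolding spatial_def by (intro continuous_intros)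

lemma open_cone: "open cone"
  unfolding cone_def by (intro open_Collect_less continuous_intros)

lemma borel_cone [measurable]: "cone \<in> sets borel"
  by (simp add: open_cone)

lemma measurable_lform [measurable]: "lform x \<in> borel_measurable borel"
  "(\<lambda>v. lform v v) \<in> borel_measurable borel"
  by (intro borel_measurable_continuous_onI continuous_intros)+

lemma measurable_weight [measurable]: "weight x \<in> borel_measurable borel"
  unfolding weight_def by measurable

lemma integral_lorentz:
  fixes f :: "real ^ ('n::finite) option \<Rightarrow> real"
  assumes "A ** A = mat 1" "f \<in> borel_measurable borel"
  shows "(\<integral>v. f (A *v v) \<partial>lborel) = (\<integral>v. f v \<partial>lborel)"
    and "integrable lborel (\<lambda>v. f (A *v v)) \<longleftrightarrow> integrable lborel f"
proof -
  have "A *v (A *v v) = v" for v unfolding matrix_vector_mul_assoc assms(1) by simp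
  then have d: "distr lborel borel ((*v) A) = lborel" by (intro distr_lborel_involution) auto
  have [measurable]: "(*v) A \<in> borel_measurable borel"
    by (intro borel_measurable_continuous_onI matrix_vector_mult_linear_continuous_on)
  show "(\<integral>v. f (A *v v) \<partial>lborel) = (\<integral>v. f v \<partial>lborel)"
    using integral_distr[of "(*v) A" lborel borel f] assms(2) d by simp
  show "integrable lborel (\<lambda>v. f (A *v v)) \<longleftrightarrow> integrable lborel f"
    using integrable_distr_eq[of "(*v) A" lborel borel f] assms(2) d by simp
qed

lemma norm_cone_le:
  fixes v :: "real ^ ('n::finite) option"
  assumes v: "v \<in> cone"
  shows "norm v \<le> 2 * v $ None"
proof -
  have "norm v = norm (spatial v + v $ None *\<^sub>R origin)" by (simp add: spatial_def)
  also have "\<dots> \<le> norm (spatial v) + norm (v $ None *\<^sub>R origin :: real ^ 'n option)" by (rule norm_triangle_ineq)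
  also have "\<dots> \<le> v $ None + v $ None" using v cone_None_pos[OF v] by (simp add: cone_def)
  finally show ?thesis by simp
qed

lemma integrable_weight_origin: "integrable lborel (weight origin)"
\<comment> \<open>On the support the time coordinate is at most 3, hence the norm is at most
  6.\<close>
proof (rule integrableI_bounded_set[where A="cball 0 6" and B=3])
  show "emeasure lborel (cball 0 6) < \<infinity>" by (rule emeasure_bounded_finite) simp
  show "AE x in lborel. x \<in> cball 0 6 \<longrightarrow> norm (weight origin x) \<le> 3"
    using cone_None_pos by (intro AE_I2) (force simp: weight_def)
  show "AE x in lborel. x \<notin> cball 0 6 \<longrightarrow> weight origin x = 0"
    by (intro AE_I2) (auto simp: weight_def dest: norm_cone_le)
qed auto

lemma integrable_weight:
  fixes x :: "real ^ ('n::finite) option"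
  assumes "x \<in> hyperboloid"
  shows "integrable lborel (weight x)"
    and "(\<integral>v. weight x v \<partial>lborel) = (\<integral>v. weight (origin :: real ^ 'n option) v \<partial>lborel)"
proof -
  let ?A = "point_reflection x"
  note A = point_reflection_lorentz[OF assms] point_reflection_invol[OF assms]
  have eq: "weight x (?A *v v) = weight origin v" for v
    using weight_lorentz[OF A, of origin v] unfolding point_reflection_origin[OF assms] .
  show "integrable lborel (weight x)"
    using integral_lorentz(2)[OF A(2), of "weight x"] unfolding eq by (simp add: integrable_weight_origin)
  show "(\<integral>v. weight x v \<partial>lborel) = (\<integral>v. weight (origin :: real ^ 'n option) v \<partial>lborel)"
    using integral_lorentz(1)[OF A(2), of "weight x"] unfolding eq by simp
qed

definition weight_mass :: "'n::finite itself \<Rightarrow> real" where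
  "weight_mass _ = (\<integral>v. weight (origin :: real ^ 'n option) v \<partial>lborel)"

lemma weight_mass_pos: "weight_mass TYPE('n::finite) > 0"
proof -
  let ?U = "{v \<in> cone. lform v v < - 1 \<and> v $ None < 2} :: (real ^ 'n option) set"
  have "open ?U"
    unfolding cone_def Collect_conj_eq[symmetric] mem_Collect_eq
    by (intro open_Collect_conj open_Collect_less continuous_intros)
  have "(3/2) *\<^sub>R origin \<in> ?U"
    using cone_scale[OF hyperboloid_cone[OF origin_hyperboloid], of "3/2"] by (simp add: lform_simps)
  then have "?U \<noteq> {}" by blast
  have fin: "emeasure lborel ?U < \<infinity>"
  proof (rule emeasure_bounded_finite)
    show "bounded ?U" unfolding bounded_iff by (intro exI[of _ 4]) (auto dest!: norm_cone_le)
  qed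
  have "emeasure lborel ?U = ennreal (measure lborel ?U)"
    using fin by (intro emeasure_eq_ennreal_measure) auto
  with emeasure_open_pos[OF \<open>open ?U\<close> \<open>?U \<noteq> {}\<close>] have "measure lborel ?U \<noteq> 0"
    by auto
  then have "0 < measure lborel ?U" by (simp add: zero_less_measure_iff)
  also have "\<dots> = (\<integral>v. indicator ?U v \<partial>lborel)" by simp
  also have "\<dots> \<le> (\<integral>v. weight (origin :: real ^ 'n option) v \<partial>lborel)"
  proof (rule integral_mono)
    show "integrable lborel (indicat_real ?U)"
      using fin \<open>open ?U\<close> by (intro integrable_real_indicator) auto
    show "integrable lborel (weight (origin :: real ^ 'n option))" by (rule integrable_weight_origin)
  qed (auto simp: indicator_def weight_nonneg weight_def)
  finally show ?thesis by (simp add: weight_mass_def)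
qed

lemma lform_le_norm: "\<bar>lform a b\<bar> \<le> 3 * (norm a * norm b)"
proof -
  have "\<bar>a $ None\<bar> * \<bar>b $ None\<bar> \<le> norm a * norm b"
    by (intro mult_mono) (use component_le_norm_cart in auto)
  moreover have "\<bar>a \<bullet> b\<bar> \<le> norm a * norm b" by (rule Cauchy_Schwarz_ineq2)
  moreover have "\<bar>lform a b\<bar> \<le> \<bar>a \<bullet> b\<bar> + \<bar>2 * a $ None * b $ None\<bar>"
    unfolding lform_def by (rule abs_triangle_ineq4)
  ultimately show ?thesis by (simp add: abs_mult)
qed

text \<open>As \<open>- lform v v \<ge> 1\<close>, normalising \<open>v\<close> can only shrink
  \<open>- lform x v\<close>, so the cutoff also controls the distance from \<open>x\<close> to the
  direction of \<open>v\<close>.\<close>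

lemma weight_hyperboloid:
  assumes "weight x v \<noteq> 0" "x \<in> hyperboloid"
  shows "v \<in> cone" "normalize_cone v \<in> hyperboloid" "- lform x (normalize_cone v) \<le> 3"
    "- lform x v \<le> 3" "lform v v \<le> - 1"
proof -
  show v: "v \<in> cone" "- lform x v \<le> 3" "lform v v \<le> - 1"
    using assms(1) by (auto simp: weight_def split: if_splits)
  show "normalize_cone v \<in> hyperboloid" by (rule normalize_cone_hyperboloid[OF v(1)])
  have "- lform x v > 0" using lform_cone_cone[OF hyperboloid_cone[OF assms(2)] v(1)] by simp
  moreover have "1 / sqrt (- lform v v) \<le> 1" using v(3) by simp
  ultimately have "1 / sqrt (- lform v v) * (- lform x v) \<le> 1 * (- lform x v)"
    by (intro mult_right_mono) auto
  then show "- lform x (normalize_cone v) \<le> 3" using v(2) by (simp add: normalize_cone_def lform_simps)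
qed

text \<open>Where one of the weights is nonzero, the triangle inequality bounds the time coordinate
  of \<open>v\<close> by \<open>2 * (2 * 3) = 12\<close> and thus the norm by 24. With
  \<open>lform_le_norm\<close> and the distance \<open>2 * sqrt (t $ None - 1)\<close> between
  \<open>origin\<close> and \<open>t\<close>, the constant is
  \<open>3 * 2 * 24 = 144\<close>.\<close>

lemma weight_difference_origin:
  assumes t: "t \<in> hyperboloid" and le: "t $ None \<le> 2"
  shows "\<bar>weight origin v - weight t v\<bar> \<le> 144 * sqrt (t $ None - 1) * indicator (cball 0 24) v"
proof (cases "weight origin v = 0 \<and> weight t v = 0")
  case True
  then show ?thesis using hyperboloid_None_ge[OF t] by simp
next
  case False
  have v: "v \<in> cone" "lform v v \<le> - 1"
    using False by (auto simp: weight_def split: if_splits)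
  have "v $ None \<le> 12"
  proof (cases "weight origin v = 0")
    case True
    with False have "weight t v \<noteq> 0" by simp
    note w = weight_hyperboloid[OF this t]
    have pos: "sqrt (- lform v v) > 0" using v by simp
    have nv: "- lform y v = sqrt (- lform v v) * (- lform y (normalize_cone v))" for y
      using pos by (simp add: normalize_cone_def lform_simps)
    have "- lform origin (normalize_cone v) \<le> 2 * (lform origin t * lform t (normalize_cone v))"
      by (rule hyperbolic_triangle[OF origin_hyperboloid w(2) t])
    also have "\<dots> = 2 * (t $ None * - lform t (normalize_cone v))" by simp
    finally have "- lform origin v \<le> sqrt (- lform v v) * (2 * (t $ None * - lform t (normalize_cone v)))"
      unfolding nv[of origin] using pos by (intro mult_left_mono) auto
    also have "\<dots> = 2 * (t $ None * - lform t v)" unfolding nv[of t] by simp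
    also have "\<dots> \<le> 2 * (2 * 3)"
      using w(4) le lform_cone_cone[OF hyperboloid_cone[OF t] v(1)] hyperboloid_None_ge[OF t]
      by (intro mult_left_mono mult_mono) auto
    finally show ?thesis by simp
  next
    case False
    from weight_hyperboloid(4)[OF this origin_hyperboloid] show ?thesis by simp
  qed
  then have nv: "norm v \<le> 24" using norm_cone_le[OF v(1)] by simp
  have "\<bar>weight origin v - weight t v\<bar> = \<bar>max 0 (3 + lform origin v) - max 0 (3 + lform t v)\<bar>"
    using v by (simp add: weight_def)
  also have "\<dots> \<le> \<bar>lform origin v - lform t v\<bar>" by (simp add: max_def)
  also have "\<dots> = \<bar>lform (origin - t) v\<bar>" by (simp only: lform_diff_left)
  also have "\<dots> \<le> 3 * (norm (origin - t) * norm v)" by (rule lform_le_norm)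
  also have "\<dots> \<le> 3 * (2 * sqrt (t $ None - 1) * 24)"
  proof (intro mult_left_mono mult_mono nv)
    have "(norm (origin - t))\<^sup>2 = lform (origin - t) (origin - t) + 2 * (1 - t $ None)\<^sup>2"
      unfolding lform_def power2_norm_eq_inner by (simp add: power2_eq_square algebra_simps)
    also have "lform (origin - t) (origin - t) = - 2 + 2 * t $ None"
      using t by (simp only: lform_diff_left lform_diff_right) (simp add: hyperboloid_iff)
    also have "- 2 + 2 * t $ None + 2 * (1 - t $ None)\<^sup>2 = 2 * t $ None * (t $ None - 1)"
      by (simp add: power2_eq_square algebra_simps)
    also have "\<dots> \<le> 4 * (t $ None - 1)"
      using le hyperboloid_None_ge[OF t] by (intro mult_right_mono) auto
    also have "\<dots> = (2 * sqrt (t $ None - 1))\<^sup>2"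
      using hyperboloid_None_ge[OF t] by (simp add: power_mult_distrib)
    finally show "norm (origin - t) \<le> 2 * sqrt (t $ None - 1)"
      by (rule power2_le_imp_le) (use hyperboloid_None_ge[OF t] in auto)
  qed (use hyperboloid_None_ge[OF t] in auto)
  finally show ?thesis using nv by simp
qed

lemma weight_difference:
  fixes z z' :: "real ^ ('n::finite) option"
  assumes z: "z \<in> hyperboloid" and z': "z' \<in> hyperboloid" and le: "- lform z z' \<le> 2"
  shows "(\<integral>v. \<bar>weight z v - weight z' v\<bar> \<partial>lborel)
    \<le> 144 * measure lborel (cball (0 :: real ^ 'n option) 24) * sqrt (- lform z z' - 1)"
proof -
  let ?A = "point_reflection z"
  note A = point_reflection_lorentz[OF z] point_reflection_invol[OF z]
  define t where "t = ?A *v z'"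
  have t: "t \<in> hyperboloid" unfolding t_def by (rule lorentz_hyperboloid[OF A(1) z'])
  have At: "?A *v t = z'" unfolding t_def matrix_vector_mul_assoc A(2) by simp
  have "lform (?A *v z) (?A *v z') = lform z z'" by (rule lform_lorentz[OF A(1)])
  then have t0: "t $ None = - lform z z'" unfolding point_reflection_self[OF z] t_def by simp
  have wz: "weight z (?A *v v) = weight origin v" "weight z' (?A *v v) = weight t v" for v
    using weight_lorentz[OF A, of origin v] weight_lorentz[OF A, of t v]
    unfolding point_reflection_origin[OF z] At by simp_all
  have fin: "emeasure lborel (cball (0 :: real ^ 'n option) 24) < \<infinity>"
    by (rule emeasure_bounded_finite) simp
  have "(\<integral>v. \<bar>weight z v - weight z' v\<bar> \<partial>lborel) = (\<integral>v. \<bar>weight z (?A *v v) - weight z' (?A *v v)\<bar> \<partial>lborel)"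
    by (rule integral_lorentz(1)[OF A(2), symmetric]) measurable
  also have "\<dots> \<le> (\<integral>v. 144 * sqrt (t $ None - 1) * indicator (cball (0 :: real ^ 'n option) 24) v \<partial>lborel)"
    unfolding wz
  proof (rule integral_mono)
    show "integrable lborel (\<lambda>v. \<bar>weight origin v - weight t v\<bar>)"
      by (intro integrable_abs Bochner_Integration.integrable_diff integrable_weight t origin_hyperboloid)
    show "integrable lborel (\<lambda>v. 144 * sqrt (t $ None - 1) * indicat_real (cball (0 :: real ^ 'n option) 24) v)"
      using fin by (intro integrable_mult_right integrable_real_indicator) auto
  qed (use weight_difference_origin[OF t] le t0 in auto)
  also have "\<dots> = 144 * measure lborel (cball (0 :: real ^ 'n option) 24) * sqrt (- lform z z' - 1)"
    by (simp add: t0)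
  finally show ?thesis .
qed

context lorentz_cocycle
begin

lemma F_update_measurable:
  assumes x: "\<And>i. x i \<in> cone"
  shows "(\<lambda>v. if v \<in> cone then F (\<lambda>i. if p i then v else x i) else 0) \<in> borel_measurable borel"
proof -
  have "continuous_on cone (\<lambda>v. F (\<lambda>i. if p i then v else x i))"
  proof (rule continuous_on_compose2[OF cont])
    have "continuous_on cone (\<lambda>v. if p i then v else x i)" for i by (cases "p i") auto
    then show "continuous_on cone (\<lambda>v i. if p i then v else x i)"
      by (rule continuous_on_coordinatewise_then_product)
  qed (use x in auto)
  then show ?thesis
    by (intro borel_measurable_continuous_on_if[where g="\<lambda>_. 0", simplified]) auto
qed

text \<open>The terms of the cocycle relation that contain both \<open>x j\<close> and the moving point integrate to
  an equivariant function of \<open>n\<close> points, hence to \<open>0\<close>.\<close>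

lemma mean_value_terms_vanish:
  assumes x: "\<And>i. x i \<in> cone" and j: "j \<le> n" and k: "k \<le> Suc n" "k \<noteq> j" "k \<noteq> Suc j"
  shows "(\<integral>v. (if v \<in> cone then F (splice_at j x (x(j := v)) \<circ> skip k) else 0) * weight (x j) v \<partial>lborel) = 0"
proof -
  define G where "G y v = (if v \<in> cone then F (splice_at j y (y(j := v)) \<circ> skip k) else 0) * weight (y j) v" for y v
  define u where "u y = (\<integral>v. G y v \<partial>lborel)" for y
  \<comment> \<open>The index in \<open>x\<close> of the point removed at position \<open>k\<close>.
    The inserted \<open>v\<close> occupies position \<open>Suc j\<close>, which shifts the later
    points by one.\<close>
  define k' where "k' = (if k < j then k else k - 1)"
  have k': "k' \<noteq> j" "k' \<le> n" using k j unfolding k'_def by auto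
  have tup: "splice_at j y (y(j := v)) \<circ> skip k = (\<lambda>i. if skip k i = Suc j then v else
      if skip k i \<le> j then y (skip k i) else y (skip k i - 1))" for y v
    by (rule ext) (auto simp: splice_at_def)
  have skip_k': "skip k i \<le> j \<Longrightarrow> skip k i \<noteq> k'" "Suc j < skip k i \<Longrightarrow> skip k i - 1 \<noteq> k'" for i
    using k unfolding skip_def k'_def by (auto split: if_splits)
  have G_eq: "G y v = G z v" if "\<And>i. i \<le> n \<Longrightarrow> i \<noteq> k' \<Longrightarrow> y i = z i" for y z v
  proof -
    have "F (splice_at j y (y(j := v)) \<circ> skip k) = F (splice_at j z (z(j := v)) \<circ> skip k)"
    proof (rule depends_uptoD[OF dep])
      fix i assume "i \<le> n"
      then have "skip k i - 1 \<le> n" by (auto simp: skip_def)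
      then show "(splice_at j y (y(j := v)) \<circ> skip k) i = (splice_at j z (z(j := v)) \<circ> skip k) i"
        unfolding tup using skip_k'[of i] j
        by (cases "skip k i = Suc j"; cases "skip k i \<le> j") (auto intro!: that)
    qed
    then show ?thesis using that[of j] j k' by (simp add: G_def)
  qed
  have meas: "G y \<in> borel_measurable borel" if "\<And>i. y i \<in> cone" for y
    unfolding G_def tup using that by (intro borel_measurable_times F_update_measurable measurable_weight) auto
  \<comment> \<open>The integral ignores entry \<open>k'\<close>, so this entry may be overwritten
    by \<open>x j\<close>; at most \<open>n\<close> distinct points remain.\<close>
  define z where "z = x(k' := x j)"
  have z: "z i \<in> cone" for i using x by (simp add: z_def)
  have "u z = 0"
  proof (rule equivariant_vanishes[where e = e and a = a and q = n, OF e_abs e_refl])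
    show "depends_upto n u"
      unfolding depends_upto_def u_def
      by (intro allI impI Bochner_Integration.integral_cong refl G_eq) auto
    show "u (\<lambda>i. A *v y i) = e A * u y" if A: "A \<in> lorentz" "A ** A = mat 1" and y: "\<And>i. y i \<in> cone" for A y
    proof -
      have Ay: "A *v y i \<in> cone" for i by (rule lorentz_cone[OF A(1) y])
      have "u (\<lambda>i. A *v y i) = (\<integral>v. G (\<lambda>i. A *v y i) (A *v v) \<partial>lborel)"
        unfolding u_def by (rule integral_lorentz(1)[OF A(2) meas[OF Ay], symmetric])
      also have "\<dots> = (\<integral>v. e A * G y v \<partial>lborel)"
      proof (rule Bochner_Integration.integral_cong[OF refl])
        fix v
        show "G (\<lambda>i. A *v y i) (A *v v) = e A * G y v"
        proof (cases "v \<in> cone")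
          case True
          have "F (splice_at j (\<lambda>i. A *v y i) ((\<lambda>i. A *v y i)(j := A *v v)) \<circ> skip k)
              = F (\<lambda>i. A *v (splice_at j y (y(j := v)) \<circ> skip k) i)"
            by (rule arg_cong[of _ _ F], rule ext) (simp add: splice_at_def)
          also have "\<dots> = e A * F (splice_at j y (y(j := v)) \<circ> skip k)"
            by (rule equi[OF A(1)]) (use True y in \<open>auto simp: splice_at_def\<close>)
          finally show ?thesis using True by (simp add: G_def lorentz_cone_iff[OF A] weight_lorentz[OF A])
        qed (simp add: G_def lorentz_cone_iff[OF A])
      qed
      also have "\<dots> = e A * u y" unfolding u_def by (rule integral_mult_right_zero)
      finally show ?thesis .
    qed
    have "z ` {..n} \<subseteq> x ` ({..n} - {k'})" using j k' by (auto simp: z_def)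
    then have "dim (z ` {..n}) \<le> card (x ` ({..n} - {k'}))"
      by (intro dim_le_card order.trans[OF _ span_superset]) auto
    also have "\<dots> \<le> card ({..n} - {k'})" by (rule card_image_le) simp
    also have "\<dots> = n" using k' by simp
    finally show "dim (z ` {..n}) \<le> CARD('n)" by (simp add: n_eq)
  qed (auto intro: z)
  moreover have "u x = u z" unfolding u_def
    by (intro Bochner_Integration.integral_cong refl G_eq) (simp add: z_def)
  ultimately show ?thesis by (simp add: u_def G_def)
qed

lemma F_normalize:
  assumes x: "\<And>i. x i \<in> cone" and v: "v \<in> cone"
  shows "F (\<lambda>i. if p i then v else x i) = F (\<lambda>i. if p i then normalize_cone v else x i)"
proof -
  let ?c = "\<lambda>i. if p i then 1 / sqrt (- lform v v) else 1"
  have "F (\<lambda>i. ?c i *\<^sub>R (if p i then v else x i)) = F (\<lambda>i. if p i then v else x i)"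
    by (rule homogeneous) (use x v in \<open>auto simp: cone_iff\<close>)
  moreover have "(\<lambda>i. ?c i *\<^sub>R (if p i then v else x i)) = (\<lambda>i. if p i then normalize_cone v else x i)"
    by (rule ext) (simp add: normalize_cone_def)
  ultimately show ?thesis by simp
qed

text \<open>On the support of the weight the direction of \<open>v\<close> is at bounded distance
  from \<open>y\<close>, so all tuples involved have bounded size and
  \<open>bounded_on_bounded\<close> applies.\<close>

lemma F_weight_integrable:
  assumes x: "\<And>i. x i \<in> hyperboloid" and y: "y \<in> hyperboloid"
  shows "integrable lborel (\<lambda>v. (if v \<in> cone then F (\<lambda>i. if p i then v else x i) else 0) * weight y v)"
proof -
  \<comment> \<open>A crude common bound for the finitely many pairs; 6 is the factor 2 of the
    triangle inequality times the cutoff 3.\<close>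
  define c where "c = 1 + (\<Sum>i\<le>n. \<Sum>l\<le>n. - lform (x i) (x l)) + (\<Sum>i\<le>n. 6 * (- lform y (x i)))"
  have nn: "- lform (x i) (x l) \<ge> 0" "- lform y (x i) \<ge> 0" for i l
    using reverse_cauchy_schwarz[OF x x, of i l] reverse_cauchy_schwarz[OF y x, of i] by auto
  have s0: "0 \<le> (\<Sum>i\<le>n. \<Sum>l\<le>n. - lform (x i) (x l))" "0 \<le> (\<Sum>i\<le>n. 6 * (- lform y (x i)))"
    by (intro sum_nonneg mult_nonneg_nonneg nn; simp)+
  have c1: "- lform (x i) (x l) \<le> c" if "i \<le> n" "l \<le> n" for i l
  proof -
    have "- lform (x i) (x l) \<le> (\<Sum>l\<le>n. - lform (x i) (x l))"
      using that by (intro member_le_sum nn) auto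
    also have "\<dots> \<le> (\<Sum>i\<le>n. \<Sum>l\<le>n. - lform (x i) (x l))"
      using that by (intro member_le_sum[of i "{..n}" "\<lambda>i. \<Sum>l\<le>n. - lform (x i) (x l)"] sum_nonneg nn) auto
    finally show ?thesis using s0 by (simp add: c_def)
  qed
  have c2: "6 * (- lform y (x i)) \<le> c" if "i \<le> n" for i
  proof -
    have "6 * (- lform y (x i)) \<le> (\<Sum>i\<le>n. 6 * (- lform y (x i)))"
      using that by (intro member_le_sum[of i "{..n}" "\<lambda>i. 6 * (- lform y (x i))"] mult_nonneg_nonneg nn) auto
    then show ?thesis using s0 by (simp add: c_def)
  qed
  obtain K where K: "\<And>x. (\<And>i. x i \<in> hyperboloid) \<Longrightarrow> (\<And>i j. i \<le> n \<Longrightarrow> j \<le> n \<Longrightarrow> - lform (x i) (x j) \<le> c) \<Longrightarrow> \<bar>F x\<bar> \<le> K"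
    using bounded_on_bounded[of c] by blast
  have bound: "\<bar>F (\<lambda>i. if p i then v else x i)\<bar> \<le> K" if w: "weight y v \<noteq> 0" for v
  proof -
    note v = weight_hyperboloid[OF w y]
    let ?v = "normalize_cone v"
    have vx: "- lform ?v (x i) \<le> c" if "i \<le> n" for i
    proof -
      have "- lform ?v (x i) \<le> 2 * (lform ?v y * lform y (x i))"
        by (rule hyperbolic_triangle[OF v(2) x y])
      also have "\<dots> = 2 * (- lform y ?v * - lform y (x i))" by (subst lform_commute) simp
      also have "\<dots> \<le> 2 * (3 * - lform y (x i))"
        by (intro mult_left_mono mult_right_mono v nn) auto
      finally show ?thesis using c2[OF that] by simp
    qed
    have "\<bar>F (\<lambda>i. if p i then ?v else x i)\<bar> \<le> K"
    proof (rule K)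
      show "(if p i then ?v else x i) \<in> hyperboloid" for i using v x by simp
      have "lform ?v ?v = - 1" using v(2) by (simp add: hyperboloid_iff)
      then show "- lform (if p i then ?v else x i) (if p j then ?v else x j) \<le> c" if "i \<le> n" "j \<le> n" for i j
        using c1[OF that] vx[OF that(1)] vx[OF that(2)] lform_commute[of "x i" ?v] s0 by (auto simp: c_def)
    qed
    then show ?thesis using F_normalize[OF hyperboloid_cone[OF x] v(1)] by simp
  qed
  show ?thesis
  proof (rule Bochner_Integration.integrable_bound)
    show "integrable lborel (\<lambda>v. K * weight y v)" by (intro integrable_mult_right integrable_weight y)
    show "(\<lambda>v. (if v \<in> cone then F (\<lambda>i. if p i then v else x i) else 0) * weight y v) \<in> borel_measurable lborel"
      using F_update_measurable[OF hyperboloid_cone[OF x]] by measurable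
    show "AE v in lborel. norm ((if v \<in> cone then F (\<lambda>i. if p i then v else x i) else 0) * weight y v) \<le> norm (K * weight y v)"
    proof (intro AE_I2)
      fix v
      show "norm ((if v \<in> cone then F (\<lambda>i. if p i then v else x i) else 0) * weight y v) \<le> norm (K * weight y v)"
        by (cases "weight y v = 0") (auto simp: abs_mult intro!: mult_right_mono order.trans[OF bound abs_ge_self])
    qed
  qed
qed

text \<open>Insert \<open>v\<close> after \<open>x j\<close> in the tuple and integrate the cocycle
  relation against the weight at \<open>x j\<close>. Only two terms survive, with opposite signs:
  deleting \<open>x j\<close> gives the average of \<open>F\<close> with \<open>x j\<close> replaced
  by \<open>v\<close>, and deleting \<open>v\<close> gives \<open>F x\<close> times the
  mass.\<close>

lemma mean_value:
  assumes x: "\<And>i. x i \<in> hyperboloid" and j: "j \<le> n"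
  shows "(\<integral>v. (if v \<in> cone then F (x(j := v)) else 0) * weight (x j) v \<partial>lborel) = F x * weight_mass TYPE('n)"
proof -
  define T where "T k v = (if v \<in> cone then F (splice_at j x (x(j := v)) \<circ> skip k) else 0) * weight (x j) v" for k v
  have tup: "splice_at j x (x(j := v)) \<circ> skip k = (\<lambda>i. if skip k i = Suc j then v else
      if skip k i \<le> j then x (skip k i) else x (skip k i - 1))" for v k
    by (rule ext) (auto simp: splice_at_def)
  have int: "integrable lborel (T k)" for k
    unfolding T_def tup by (rule F_weight_integrable) (use x in auto)
  have zero: "(\<Sum>k\<le>Suc n. (- 1) ^ k * T k v) = 0" for v
  proof (cases "v \<in> cone")
    case True
    have "cobd n F (splice_at j x (x(j := v))) = 0"
      by (rule cocycle) (use x True in \<open>auto simp: splice_at_def intro: hyperboloid_cone\<close>)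
    then have "0 = (\<Sum>k\<le>Suc n. (- 1) ^ k * F (splice_at j x (x(j := v)) \<circ> skip k)) * weight (x j) v"
      unfolding cobd_def by simp
    then show ?thesis using True unfolding sum_distrib_right T_def by (simp add: mult.assoc)
  qed (simp add: T_def)
  have "0 = (\<integral>v. (\<Sum>k\<le>Suc n. (- 1) ^ k * T k v) \<partial>lborel)" unfolding zero by simp
  also have "\<dots> = (\<Sum>k\<le>Suc n. (- 1) ^ k * (\<integral>v. T k v \<partial>lborel))"
    by (subst Bochner_Integration.integral_sum) (use int in auto)
  also have "\<dots> = (\<Sum>k\<in>{j, Suc j}. (- 1) ^ k * (\<integral>v. T k v \<partial>lborel))"
  proof (rule sum.mono_neutral_right)
    have "(\<integral>v. T k v \<partial>lborel) = 0" if "k \<in> {..Suc n} - {j, Suc j}" for k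
      unfolding T_def by (rule mean_value_terms_vanish) (use x j that in \<open>auto intro: hyperboloid_cone\<close>)
    then show "\<forall>k\<in>{..Suc n} - {j, Suc j}. (- 1) ^ k * (\<integral>v. T k v \<partial>lborel) = 0" by simp
  qed (use j in auto)
  finally have "(\<integral>v. T j v \<partial>lborel) = (\<integral>v. T (Suc j) v \<partial>lborel)" by simp
  moreover have "T j v = (if v \<in> cone then F (x(j := v)) else 0) * weight (x j) v" for v
  proof -
    have "(\<lambda>i. if i < j then x i else (x(j := v)) i) = x(j := v)" by auto
    then show ?thesis unfolding T_def splice_at_skip_same by simp
  qed
  moreover have "T (Suc j) v = F x * weight (x j) v" for v
  proof -
    have "(\<lambda>i. if i < Suc j then x i else (x(j := v)) i) = x" by auto
    then show ?thesis unfolding T_def splice_at_skip_Suc by (simp add: weight_cone)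
  qed
  ultimately show ?thesis using integrable_weight[OF x] by (simp add: weight_mass_def)
qed

text \<open>By \<open>mean_value\<close> both numbers are averages of the same function of
  \<open>v\<close>, so their difference is controlled by the difference of the two weights and a
  local bound \<open>S\<close> for \<open>F\<close>. For nearby points
  \<open>sqrt (- lform (x j) z - 1)\<close> is comparable to the distance. The radius 12 is
  \<open>2 * (2 * 3)\<close>, from the triangle inequality through \<open>z\<close>.\<close>

lemma lipschitz:
  "\<exists>C\<ge>0. \<forall>x j z S. (\<forall>i. x i \<in> hyperboloid) \<longrightarrow> j \<le> n \<longrightarrow> z \<in> hyperboloid \<longrightarrow> - lform (x j) z \<le> 2 \<longrightarrow>
     (\<forall>w\<in>hyperboloid. - lform (x j) w \<le> 12 \<longrightarrow> \<bar>F (x(j := w))\<bar> \<le> S) \<longrightarrow>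
     \<bar>F x - F (x(j := z))\<bar> \<le> C * sqrt (- lform (x j) z - 1) * S"
proof -
  let ?N = "weight_mass TYPE('n)"
  define C where "C = 144 * measure lborel (cball (0 :: real ^ 'n option) 24) / ?N"
  note N = weight_mass_pos[where 'n='n]
  have "\<bar>F x - F (x(j := z))\<bar> \<le> C * sqrt (- lform (x j) z - 1) * S"
    if x: "\<And>i. x i \<in> hyperboloid" and j: "j \<le> n" and z: "z \<in> hyperboloid" and le: "- lform (x j) z \<le> 2"
      and S: "\<And>w. w \<in> hyperboloid \<Longrightarrow> - lform (x j) w \<le> 12 \<Longrightarrow> \<bar>F (x(j := w))\<bar> \<le> S" for x j z S
  proof -
    let ?H = "\<lambda>v. if v \<in> cone then F (x(j := v)) else 0"
    have int: "integrable lborel (\<lambda>v. ?H v * weight y v)" if "y \<in> hyperboloid" for y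
      unfolding fun_upd_def by (rule F_weight_integrable[where p = "\<lambda>i. i = j", OF x that])
    have "\<bar>F (x(j := x j))\<bar> \<le> S" by (rule S) (use x[of j] in \<open>auto simp: hyperboloid_iff\<close>)
    then have S0: "S \<ge> 0" by linarith
    have H: "\<bar>?H v * (weight (x j) v - weight z v)\<bar> \<le> S * \<bar>weight (x j) v - weight z v\<bar>" for v
    proof (cases "weight (x j) v = 0 \<and> weight z v = 0")
      case False
      have "v \<in> cone \<and> normalize_cone v \<in> hyperboloid \<and> - lform (x j) (normalize_cone v) \<le> 12"
      proof (cases "weight (x j) v = 0")
        case True
        with False have "weight z v \<noteq> 0" by simp
        note w = weight_hyperboloid[OF this z]
        have "- lform (x j) (normalize_cone v) \<le> 2 * (lform (x j) z * lform z (normalize_cone v))"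
          by (rule hyperbolic_triangle[OF x w(2) z])
        also have "\<dots> = 2 * (- lform (x j) z * - lform z (normalize_cone v))" by simp
        also have "\<dots> \<le> 2 * (2 * 3)"
          using w le reverse_cauchy_schwarz[OF x z, of j] reverse_cauchy_schwarz[OF z w(2)]
          by (intro mult_left_mono mult_mono) auto
        finally show ?thesis using w by simp
      next
        case False
        from weight_hyperboloid[OF this x] show ?thesis by auto
      qed
      then have v: "v \<in> cone" "normalize_cone v \<in> hyperboloid" "- lform (x j) (normalize_cone v) \<le> 12" by auto
      have "F (x(j := v)) = F (x(j := normalize_cone v))"
        using F_normalize[OF hyperboloid_cone[OF x] v(1), of "\<lambda>i. i = j"] by (simp add: fun_upd_def)
      then have "\<bar>?H v\<bar> \<le> S" using S[OF v(2,3)] v(1) by simp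
      then show ?thesis by (simp only: abs_mult) (intro mult_right_mono; simp)
    qed (use S0 in simp)
    have "(F x - F (x(j := z))) * ?N = (\<integral>v. ?H v * weight (x j) v \<partial>lborel) - (\<integral>v. ?H v * weight z v \<partial>lborel)"
    proof -
      have xz: "(x(j := z)) i \<in> hyperboloid" for i using x z by simp
      show ?thesis
        using mean_value[where x = x, OF x j] mean_value[where x = "x(j := z)", OF xz j]
        unfolding fun_upd_upd fun_upd_same left_diff_distrib by linarith
    qed
    also have "\<dots> = (\<integral>v. ?H v * (weight (x j) v - weight z v) \<partial>lborel)"
      unfolding right_diff_distrib by (rule Bochner_Integration.integral_diff[symmetric]) (intro int x z)+
    finally have eq: "(F x - F (x(j := z))) * ?N = (\<integral>v. ?H v * (weight (x j) v - weight z v) \<partial>lborel)" .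
    have "\<bar>F x - F (x(j := z))\<bar> * ?N = \<bar>(F x - F (x(j := z))) * ?N\<bar>" using N by (simp add: abs_mult)
    also have "\<dots> = \<bar>\<integral>v. ?H v * (weight (x j) v - weight z v) \<partial>lborel\<bar>"
      by (simp only: eq)
    also have "\<dots> \<le> (\<integral>v. \<bar>?H v * (weight (x j) v - weight z v)\<bar> \<partial>lborel)" by (rule integral_abs_bound)
    also have "\<dots> \<le> (\<integral>v. S * \<bar>weight (x j) v - weight z v\<bar> \<partial>lborel)"
    proof (rule integral_mono)
      show "integrable lborel (\<lambda>v. \<bar>?H v * (weight (x j) v - weight z v)\<bar>)"
        unfolding right_diff_distrib by (intro integrable_abs Bochner_Integration.integrable_diff int x z)
      show "integrable lborel (\<lambda>v. S * \<bar>weight (x j) v - weight z v\<bar>)"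
        by (intro integrable_mult_right integrable_abs Bochner_Integration.integrable_diff integrable_weight x z)
    qed (rule H)
    also have "\<dots> = S * (\<integral>v. \<bar>weight (x j) v - weight z v\<bar> \<partial>lborel)" by simp
    also have "\<dots> \<le> S * (144 * measure lborel (cball (0 :: real ^ 'n option) 24) * sqrt (- lform (x j) z - 1))"
      by (intro mult_left_mono weight_difference x z le S0)
    also have "\<dots> = C * sqrt (- lform (x j) z - 1) * S * ?N" using N by (simp add: C_def)
    finally show ?thesis using N by simp
  qed
  moreover have "C \<ge> 0" using N by (simp add: C_def)
  ultimately show ?thesis by blast
qed

end

section \<open>Estimates for normalised vectors and for dyadic sums\<close>

lemma normalize_cone_lform:
  "lform (normalize_cone a) (normalize_cone b) = lform a b / (sqrt (- lform a a) * sqrt (- lform b b))"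
  by (simp add: normalize_cone_def lform_simps)

text \<open>A common lower bound \<open>t\<close> for the two normalising factors allows distances
  to be estimated without handling their square roots.\<close>

lemma normalize_cone_lform_le:
  assumes "t > 0" "- lform a a \<ge> t" "- lform b b \<ge> t" "- lform a b \<le> M * t" "M \<ge> 0"
  shows "- lform (normalize_cone a) (normalize_cone b) \<le> M"
proof -
  have "t = sqrt t * sqrt t" using assms by simp
  also have "\<dots> \<le> sqrt (- lform a a) * sqrt (- lform b b)"
    using assms by (intro mult_mono) auto
  finally have le: "t \<le> sqrt (- lform a a) * sqrt (- lform b b)" .
  have "- lform a b \<le> M * (sqrt (- lform a a) * sqrt (- lform b b))"
    using assms(4) mult_left_mono[OF le assms(5)] by linarith
  then have "(- lform a b) / (sqrt (- lform a a) * sqrt (- lform b b)) \<le> M"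
    using le assms(1) by (subst pos_divide_le_eq) auto
  then show ?thesis unfolding normalize_cone_lform by simp
qed

lemma geometric_sum_le:
  fixes q :: real
  assumes "0 \<le> q" "q < 1"
  shows "(\<Sum>k<m. q ^ k) \<le> 1 / (1 - q)"
proof -
  have "(\<Sum>k<m. q ^ k) = (1 - q ^ m) / (1 - q)"
    using assms by (simp add: sum_gp_strict)
  also have "\<dots> \<le> 1 / (1 - q)" using assms by (intro divide_right_mono) auto
  finally show ?thesis .
qed

lemma sqrt_sqrt_power: "0 \<le> x \<Longrightarrow> sqrt (sqrt (x ^ k)) = (sqrt (sqrt x)) ^ k"
  by (simp add: real_sqrt_power)

text \<open>Away from the first index \<open>k0\<close> with \<open>S \<le> 2 ^ k0 * t\<close> the
  bounds decay in both directions with ratio \<open>sqrt (sqrt (1 / 2))\<close>. Two geometric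
  series give a bound independent of \<open>t\<close>, \<open>S\<close> and
  \<open>K\<close>.\<close>

lemma dyadic_sum_le:
  fixes b :: "nat \<Rightarrow> real"
  assumes t: "t > 0" and S: "S \<ge> 0" and C: "C \<ge> 0"
    and lo: "\<And>k. 2 ^ k * t \<le> S \<Longrightarrow> b k \<le> C * sqrt (sqrt (2 ^ k * t / S))"
    and hi: "\<And>k. S \<le> 2 ^ k * t \<Longrightarrow> b k \<le> C * sqrt (sqrt (S / (2 ^ k * t)))"
  shows "(\<Sum>k<K. b k) \<le> 2 * C / (1 - sqrt (sqrt (1 / 2)))"
proof -
  define q where "q = sqrt (sqrt (1 / 2 :: real))"
  have q: "0 \<le> q" "q < 1" by (simp_all add: q_def)
  have qk: "q ^ k = sqrt (sqrt ((1 / 2) ^ k))" for k unfolding q_def by (rule sqrt_sqrt_power[symmetric]) simp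
  obtain m where "S / t < 2 ^ m" using real_arch_pow[of 2 "S / t"] by auto
  then have "S \<le> 2 ^ m * t" using t by (simp add: pos_divide_less_eq)
  define k0 where "k0 = (LEAST k. S \<le> 2 ^ k * t)"
  have k0: "S \<le> 2 ^ k0 * t" unfolding k0_def by (rule LeastI) fact
  have below: "2 ^ k * t < S" if "k < k0" for k
    using not_less_Least[of k "\<lambda>k. S \<le> 2 ^ k * t"] that unfolding k0_def by simp
  have 1: "b k \<le> C * q ^ (k0 - 1 - k)" if k: "k < k0" for k
  proof -
    have "2 ^ k * t / S \<le> (1 / 2) ^ (k0 - 1 - k)"
    proof -
      have "2 ^ (k0 - 1 - k) * (2 ^ k * t) = 2 ^ (k0 - 1) * t"
        using k by (simp flip: power_add mult.assoc)
      also have "\<dots> \<le> S" using below[of "k0 - 1"] k by simp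
      finally have le: "2 ^ (k0 - 1 - k) * (2 ^ k * t) \<le> S" .
      have "0 < 2 ^ k * t" using t by simp
      then have "S > 0" using below[OF k] by linarith
      with le show ?thesis by (simp add: power_one_over field_simps)
    qed
    then have "sqrt (sqrt (2 ^ k * t / S)) \<le> q ^ (k0 - 1 - k)" unfolding qk by simp
    then have "C * sqrt (sqrt (2 ^ k * t / S)) \<le> C * q ^ (k0 - 1 - k)" using C by (rule mult_left_mono)
    with lo[of k] below[OF k] show ?thesis by linarith
  qed
  have 2: "b (k + k0) \<le> C * q ^ k" for k
  proof -
    have ge: "2 ^ k * S \<le> 2 ^ (k + k0) * t" using mult_left_mono[OF k0, of "2 ^ k"] by (simp add: power_add mult.assoc)
    have "1 * S \<le> 2 ^ k * S" using S by (intro mult_right_mono) auto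
    then have h: "S \<le> 2 ^ (k + k0) * t" using ge by linarith
    have "S / (2 ^ (k + k0) * t) \<le> (1 / 2) ^ k"
      using ge t by (simp add: power_one_over field_simps)
    then have "sqrt (sqrt (S / (2 ^ (k + k0) * t))) \<le> q ^ k" unfolding qk by simp
    then have "C * sqrt (sqrt (S / (2 ^ (k + k0) * t))) \<le> C * q ^ k" using C by (rule mult_left_mono)
    with hi[OF h] show ?thesis by linarith
  qed
  define b' where "b' k = (if k < k0 then C * q ^ (k0 - 1 - k) else C * q ^ (k - k0))" for k
  have bb': "b k \<le> b' k" for k using 1[of k] 2[of "k - k0"] by (auto simp: b'_def)
  have b'0: "b' k \<ge> 0" for k using C q by (simp add: b'_def)
  have "(\<Sum>k<K. b k) \<le> (\<Sum>k<K. b' k)" by (intro sum_mono bb')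
  also have "\<dots> \<le> (\<Sum>k<k0 + K. b' k)" by (intro sum_mono2 b'0) auto
  also have "\<dots> = (\<Sum>k<k0. b' k) + (\<Sum>k<K. b' (k0 + k))"
    using sum.atLeastLessThan_concat[of 0 k0 "k0 + K" b'] sum.shift_bounds_nat_ivl[of b' 0 k0 K]
    by (simp add: lessThan_atLeast0 add.commute)
  also have "(\<Sum>k<k0. b' k) = C * (\<Sum>k<k0. q ^ (k0 - Suc k))" by (simp add: b'_def sum_distrib_left)
  also have "(\<Sum>k<k0. q ^ (k0 - Suc k)) = (\<Sum>k<k0. q ^ k)" by (rule sum.nat_diff_reindex)
  also have "(\<Sum>k<K. b' (k0 + k)) = C * (\<Sum>k<K. q ^ k)" by (simp add: b'_def sum_distrib_left)
  also have "C * (\<Sum>k<k0. q ^ k) + C * (\<Sum>k<K. q ^ k) \<le> C * (1 / (1 - q)) + C * (1 / (1 - q))"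
    by (intro add_mono mult_left_mono geometric_sum_le q C)
  finally show ?thesis by (simp add: q_def)
qed

context lorentz_cocycle
begin

lemma F_normalize_all:
  assumes "\<And>i. x i \<in> cone"
  shows "F (\<lambda>i. normalize_cone (x i)) = F x"
  unfolding normalize_cone_def by (rule homogeneous) (use assms in \<open>auto simp: cone_iff\<close>)

text \<open>\<open>growth\<close> supplies the local bound in \<open>lipschitz\<close>. Replacing
  \<open>x J\<close> by a point \<open>w\<close> with \<open>- lform (x J) w \<le> 12\<close>
  enlarges the size from \<open>c\<close> to at most \<open>2 * 12 * c\<close>, whence the factor
  24.\<close>

lemma near_degenerate:
  "\<exists>C\<ge>0. \<forall>x J z c r. (\<forall>i. x i \<in> hyperboloid) \<longrightarrow> J \<le> n \<longrightarrow> z \<in> hyperboloid \<longrightarrow> 1 \<le> c \<longrightarrow>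
     (\<forall>i\<le>n. \<forall>l\<le>n. - lform (x i) (x l) \<le> c) \<longrightarrow> - lform (x J) z \<le> 1 + r \<longrightarrow> r \<le> 1 \<longrightarrow>
     F (x(J := z)) = 0 \<longrightarrow> \<bar>F x\<bar> \<le> C * sqrt r * sqrt (sqrt c)"
proof -
  from lipschitz obtain L where L0: "L \<ge> 0" and "\<forall>x j z S. (\<forall>i. x i \<in> hyperboloid) \<longrightarrow> j \<le> n \<longrightarrow> z \<in> hyperboloid \<longrightarrow> - lform (x j) z \<le> 2 \<longrightarrow>
     (\<forall>w\<in>hyperboloid. - lform (x j) w \<le> 12 \<longrightarrow> \<bar>F (x(j := w))\<bar> \<le> S) \<longrightarrow>
     \<bar>F x - F (x(j := z))\<bar> \<le> L * sqrt (- lform (x j) z - 1) * S"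
    by (elim exE conjE)
  note L = this(2)[rule_format]
  from growth obtain G where "\<forall>c v. 1 \<le> c \<longrightarrow> (\<forall>i. v i \<in> hyperboloid) \<longrightarrow>
    (\<forall>i\<le>n. \<forall>j\<le>n. - lform (v i) (v j) \<le> c) \<longrightarrow> \<bar>F v\<bar> \<le> G * sqrt (sqrt c)"
    by (elim exE)
  note G = this[rule_format]
  define G' where "G' = max G 0 * sqrt (sqrt 24)"
  have main: "\<bar>F x\<bar> \<le> (L * G') * sqrt r * sqrt (sqrt c)"
    if x: "\<And>i. x i \<in> hyperboloid" and J: "J \<le> n" and z: "z \<in> hyperboloid" and c: "1 \<le> c"
      and cc: "\<And>i l. i \<le> n \<Longrightarrow> l \<le> n \<Longrightarrow> - lform (x i) (x l) \<le> c"
      and r: "- lform (x J) z \<le> 1 + r" "r \<le> 1" and F0: "F (x(J := z)) = 0" for x J z c r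
  proof -
    have S: "\<bar>F (x(J := w))\<bar> \<le> G' * sqrt (sqrt c)" if w: "w \<in> hyperboloid" "- lform (x J) w \<le> 12" for w
    proof -
      have wl: "- lform w (x l) \<le> 24 * c" if "l \<le> n" for l
      proof -
        have "- lform w (x l) \<le> 2 * (lform w (x J) * lform (x J) (x l))"
          by (rule hyperbolic_triangle[OF w(1) x x])
        also have "\<dots> = 2 * (- lform (x J) w * - lform (x J) (x l))" by (subst lform_commute) simp
        also have "\<dots> \<le> 2 * (12 * c)"
          using w cc[OF J that] reverse_cauchy_schwarz[OF x x, of J l] reverse_cauchy_schwarz[OF x w(1), of J]
          by (intro mult_left_mono mult_mono) auto
        finally show ?thesis by simp
      qed
      have ww: "lform w w = - 1" using w(1) by (simp add: hyperboloid_iff)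
      have "\<bar>F (x(J := w))\<bar> \<le> G * sqrt (sqrt (24 * c))"
      proof (rule G)
        show "- lform ((x(J := w)) i) ((x(J := w)) j) \<le> 24 * c" if "i \<le> n" "j \<le> n" for i j
          using wl[OF that(1)] wl[OF that(2)] cc[OF that] ww c lform_commute[of "x i" w] by (auto simp: fun_upd_def)
      qed (use x w c in auto)
      also have "\<dots> \<le> max G 0 * sqrt (sqrt (24 * c))" using c by (intro mult_right_mono) auto
      also have "\<dots> = G' * sqrt (sqrt c)" by (simp add: G'_def real_sqrt_mult)
      finally show ?thesis .
    qed
    have "\<bar>F x - F (x(J := z))\<bar> \<le> L * sqrt (- lform (x J) z - 1) * (G' * sqrt (sqrt c))"
      by (rule L[OF x J z _ S]) (use r in auto)
    also have "\<dots> \<le> L * sqrt r * (G' * sqrt (sqrt c))"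
      using r L0 c by (intro mult_right_mono mult_left_mono) (auto simp: G'_def)
    finally show ?thesis using F0 by (simp add: mult_ac)
  qed
  have "L * G' \<ge> 0" using L0 by (simp add: G'_def)
  then show ?thesis
    by (intro exI[of _ "L * G'"] conjI allI impI) (assumption, rule main, auto)
qed

section \<open>Boundedness by pushing along a lightlike vector\<close>

definition light :: "real ^ 'n option" where
  "light = origin + axis (Some a) 1"

lemma light: "lform light light = 0" "norm (spatial light) \<le> light $ None" "light $ None = 1"
proof -
  have *: "(axis (Some a) 1 :: real ^ 'n option) $ None = 0" by (simp add: axis_def)
  then show "light $ None = 1" by (simp add: light_def)
  have "spatial light = axis (Some a) 1" by (simp add: light_def spatial_def *)
  then show le: "norm (spatial light) \<le> light $ None" using \<open>light $ None = 1\<close> by simp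
  show "lform light light = 0"
    unfolding lform_self \<open>spatial light = axis (Some a) 1\<close> \<open>light $ None = 1\<close> by simp
qed

lemma lform_light_neg: "x \<in> cone \<Longrightarrow> lform x light < 0"
  using light by (intro lform_cone_neg) auto

text \<open>A vector of the past cone would pair positively with \<open>light\<close>. This covers
  \<open>lift t0 s x\<close> with \<open>s < t0\<close>, where \<open>lift_cone\<close> does not
  apply.\<close>

lemma cone_by_light:
  assumes "lform w w < 0" "lform w light < 0"
  shows "w \<in> cone"
proof (rule ccontr)
  assume "w \<notin> cone"
  then have "w $ None \<le> 0" using assms by (auto simp: cone_iff)
  moreover have "w $ None \<noteq> 0" using assms(1) by (auto simp: lform_self)
  ultimately have "- w \<in> cone" using assms by (simp add: cone_iff lform_simps)
  from lform_light_neg[OF this] assms(2) show False by (simp add: lform_simps)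
qed

text \<open>The complement of a lightlike vector contains no timelike vector: such a vector or its
  negative would lie in the cone and pair strictly with \<open>light\<close>.\<close>

lemma lform_light_orth:
  assumes "lform w light = 0"
  shows "lform w w \<ge> 0"
proof (rule ccontr)
  assume "\<not> lform w w \<ge> 0"
  then have neg: "lform w w < 0" by simp
  then have "w $ None \<noteq> 0" by (auto simp: lform_self)
  then have "w \<in> cone \<or> - w \<in> cone" using neg by (auto simp: cone_iff lform_simps)
  then show False using lform_light_neg[of w] lform_light_neg[of "- w"] assms by (auto simp: lform_simps)
qed

text \<open>In the scaling \<open>lform x light = - 1\<close> the cone is the upper half-space with
  \<open>light\<close> at infinity: \<open>- lform x x\<close> is the squared height of
  \<open>x\<close>, and \<open>lform (x - y) (x - y)\<close> is the squared horizontal distance.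
  Adding a multiple of \<open>light\<close> is a vertical motion, calibrated so that a point of
  squared height \<open>t0\<close> arrives at squared height \<open>t\<close>.\<close>

definition lift :: "real \<Rightarrow> real \<Rightarrow> real ^ 'n option \<Rightarrow> real ^ 'n option" where
  "lift t0 t x = x + ((t - t0) / 2) *\<^sub>R light"

text \<open>This is \<open>lform (x - y) (x - y)\<close> plus the heights \<open>- lform x x - t0\<close> and \<open>- lform y y - t0\<close>; if
  \<open>lform x light = - 1\<close>, then \<open>lift t0 t\<close> raises the height of \<open>x\<close> by \<open>t - t0\<close>.\<close>

definition energy :: "real \<Rightarrow> real ^ 'n option \<Rightarrow> real ^ 'n option \<Rightarrow> real" where
  "energy t0 x y = - 2 * lform x y - 2 * t0"

lemma energy_commute: "energy t0 x y = energy t0 y x"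
  unfolding energy_def by (subst lform_commute) simp

lemma lform_lift:
  assumes "lform x light = - 1" "lform y light = - 1"
  shows "lform (lift t0 s x) (lift t0 s' y) = - (energy t0 x y + s + s') / 2"
proof -
  have "lform light y = - 1" using assms(2) by (subst lform_commute)
  then show ?thesis
    using assms light(1) by (simp add: lift_def energy_def lform_simps field_simps)
qed

lemma lform_lift_light: "lform x light = - 1 \<Longrightarrow> lform (lift t0 s x) light = - 1"
  using light(1) by (simp add: lift_def lform_simps)

lemma lift_cone: "x \<in> cone \<Longrightarrow> t0 \<le> t \<Longrightarrow> lift t0 t x \<in> cone"
  unfolding lift_def using light(2,3) mult_left_mono[of "norm (spatial light)" 1 "(t - t0) / 2"]
  by (intro cone_add_closed) (auto simp: spatial_scale)

text \<open>The two sides differ by twice the squared horizontal distance.\<close>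

lemma energy_diag_le:
  assumes "lform x light = - 1" "lform y light = - 1"
  shows "energy t0 x x + energy t0 y y \<le> 2 * energy t0 x y"
proof -
  have "0 \<le> lform (x - y) (x - y)"
    by (rule lform_light_orth) (use assms in \<open>simp add: lform_simps\<close>)
  also have "\<dots> = lform x x + lform y y - 2 * lform x y"
    using lform_commute[of y x] by (simp add: lform_diff_left lform_diff_right)
  finally show ?thesis by (simp add: energy_def)
qed

text \<open>The parallelogram law for horizontal vectors: \<open>x - 2 *\<^sub>R y + z\<close> is
  the difference of \<open>x - y\<close> and \<open>y - z\<close>, and its square is nonnegative.
  The height terms have the favourable sign.\<close>

lemma energy_triangle:
  assumes "lform x light = - 1" "lform y light = - 1" "lform z light = - 1"
    and "t0 \<le> - lform x x" "t0 \<le> - lform y y" "t0 \<le> - lform z z"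
  shows "energy t0 x z \<le> 2 * energy t0 x y + 2 * energy t0 y z"
proof -
  let ?w = "x - 2 *\<^sub>R y + z"
  have "0 \<le> lform ?w ?w"
    by (rule lform_light_orth) (use assms in \<open>simp add: lform_simps\<close>)
  also have "\<dots> = lform x x + 4 * lform y y + lform z z - 4 * lform x y + 2 * lform x z - 4 * lform y z"
    using lform_commute[of y x] lform_commute[of z x] lform_commute[of z y]
    by (simp add: lform_simps algebra_simps)
  finally show ?thesis using assms by (simp add: energy_def)
qed

lemma normalize_cone_scale:
  assumes "x \<in> cone"
  shows "x = sqrt (- lform x x) *\<^sub>R normalize_cone x"
  using assms by (simp add: normalize_cone_def cone_iff)

lemma sqrt_mult_sqrt_sqrt: "u \<ge> 0 \<Longrightarrow> sqrt u * sqrt (sqrt w) = sqrt (sqrt (u * u * w))"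
  by (simp add: real_sqrt_mult)

text \<open>The tuple contains \<open>y j\<close> at the times \<open>t\<close> and
  \<open>2 * t\<close>: two points \<open>T j\<close> and \<open>T (Suc j)\<close> on one vertical
  line, at bounded distance. Let \<open>S\<close> be the largest energy to another point, attained
  by \<open>y i0\<close> and found at position \<open>I\<close>. If \<open>t \<le> S\<close>, the
  geodesic from \<open>T j\<close> towards \<open>T I\<close> starts almost vertically and passes
  near \<open>T (Suc j)\<close>. If \<open>S \<le> t\<close>, then \<open>T I\<close> is near the
  vertical line. In both cases one point is close to the plane spanned by two others, and
  \<open>near_degenerate\<close> applies.\<close>

lemma term_bound:
  "\<exists>C\<ge>0. \<forall>y t0 t j i0. (\<forall>i. y i \<in> cone \<and> lform (y i) light = - 1 \<and> t0 \<le> - lform (y i) (y i)) \<longrightarrow>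
     0 < t0 \<longrightarrow> t0 \<le> t \<longrightarrow> j < n \<longrightarrow> i0 < n \<longrightarrow> i0 \<noteq> j \<longrightarrow>
     (\<forall>i<n. i \<noteq> j \<longrightarrow> energy t0 (y i) (y j) \<le> energy t0 (y i0) (y j)) \<longrightarrow>
     (t \<le> energy t0 (y i0) (y j) \<longrightarrow> \<bar>F (splice_at j (\<lambda>i. lift t0 t (y i)) (\<lambda>i. lift t0 (2 * t) (y i)))\<bar>
        \<le> C * sqrt (sqrt (t / energy t0 (y i0) (y j)))) \<and>
     (energy t0 (y i0) (y j) \<le> t \<longrightarrow> \<bar>F (splice_at j (\<lambda>i. lift t0 t (y i)) (\<lambda>i. lift t0 (2 * t) (y i)))\<bar>
        \<le> C * sqrt (sqrt (energy t0 (y i0) (y j) / t)))"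
proof -
  from near_degenerate obtain C where C0: "C \<ge> 0" and
    "\<forall>x J z c r. (\<forall>i. x i \<in> hyperboloid) \<longrightarrow> J \<le> n \<longrightarrow> z \<in> hyperboloid \<longrightarrow> 1 \<le> c \<longrightarrow>
     (\<forall>i\<le>n. \<forall>l\<le>n. - lform (x i) (x l) \<le> c) \<longrightarrow> - lform (x J) z \<le> 1 + r \<longrightarrow> r \<le> 1 \<longrightarrow>
     F (x(J := z)) = 0 \<longrightarrow> \<bar>F x\<bar> \<le> C * sqrt r * sqrt (sqrt c)"
    by (elim exE conjE)
  note nd = this(2)[rule_format]
  define C' where "C' = C * sqrt (sqrt 4)"
  have main: "(t \<le> S \<longrightarrow> \<bar>F T\<bar> \<le> C' * sqrt (sqrt (t / S))) \<and> (S \<le> t \<longrightarrow> \<bar>F T\<bar> \<le> C' * sqrt (sqrt (S / t)))"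
    if y: "\<And>i. y i \<in> cone" "\<And>i. lform (y i) light = - 1" "\<And>i. t0 \<le> - lform (y i) (y i)"
      and t: "0 < t0" "t0 \<le> t" and j: "j < n" "i0 < n" "i0 \<noteq> j"
      and S: "S = energy t0 (y i0) (y j)" and max: "\<And>i. i < n \<Longrightarrow> i \<noteq> j \<Longrightarrow> energy t0 (y i) (y j) \<le> S"
      and T: "T = splice_at j (\<lambda>i. lift t0 t (y i)) (\<lambda>i. lift t0 (2 * t) (y i))"
    for y t0 t j i0 S T
  proof -
    define E where "E i l = energy t0 (y i) (y l)" for i l
    \<comment> \<open>Index \<open>j\<close> occurs twice in \<open>splice_at j\<close>: position
      \<open>i\<close> holds the point with index \<open>\<iota> i\<close> at time
      \<open>\<sigma> i\<close>.\<close>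
    define \<iota> where "\<iota> i = (if i \<le> j then i else i - 1)" for i
    define \<sigma> where "\<sigma> i = (if i \<le> j then t else 2 * t)" for i
    have T_eq: "T i = lift t0 (\<sigma> i) (y (\<iota> i))" for i by (simp add: T splice_at_def \<iota>_def \<sigma>_def)
    have \<sigma>: "t \<le> \<sigma> i" "\<sigma> i \<le> 2 * t" for i using t by (simp_all add: \<sigma>_def)
    have tpos: "0 < t" using t by simp
    have lfT: "lform (T i) (T l) = - (E (\<iota> i) (\<iota> l) + \<sigma> i + \<sigma> l) / 2" for i l
      unfolding T_eq E_def by (rule lform_lift[OF y(2) y(2)])
    have Tc: "T i \<in> cone" for i unfolding T_eq by (rule lift_cone[OF y(1)]) (use t \<sigma>[of i] in linarith)
    have diag: "E i i \<ge> 0" for i using y(3)[of i] by (simp add: E_def energy_def)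
    have ineq: "E i i + E l l \<le> 2 * E i l" for i l unfolding E_def by (rule energy_diag_le[OF y(2) y(2)])
    have comm: "E i l = E l i" for i l unfolding E_def by (rule energy_commute)
    have SE: "S = E i0 j" by (simp add: S E_def)
    have S0: "S \<ge> 0" using ineq[of i0 j] diag[of i0] diag[of j] SE by linarith
    have Ej: "E i j \<le> 2 * S" if "i < n" for i
    proof (cases "i = j")
      case True
      then show ?thesis using ineq[of i0 j] diag[of i0] SE by simp
    next
      case False
      then show ?thesis using max[OF that False] S0 by (simp add: E_def)
    qed
    have E4: "E i l \<le> 4 * S" if "i < n" "l < n" for i l
    proof (cases "i = j \<or> l = j")
      case True
      then show ?thesis using Ej[OF that(1)] Ej[OF that(2)] comm[of i l] S0 by auto
    next
      case False
      have "E i l \<le> 2 * E i j + 2 * E j l" unfolding E_def by (rule energy_triangle[OF y(2) y(2) y(2) y(3) y(3) y(3)])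
      also have "E i j \<le> S" using max[OF that(1)] False by (simp add: E_def)
      also have "E j l \<le> S" using max[OF that(2)] False comm[of j l] by (simp add: E_def)
      finally show ?thesis by simp
    qed
    have \<iota>: "\<iota> i < n" if "i \<le> n" for i using that j by (auto simp: \<iota>_def)
    define x where "x i = normalize_cone (T i)" for i
    have x: "x i \<in> hyperboloid" for i unfolding x_def by (rule normalize_cone_hyperboloid[OF Tc])
    have Fx: "F x = F T" unfolding x_def by (rule F_normalize_all[OF Tc])
    \<comment> \<open>Energies are at most \<open>4 * S\<close>, times at most \<open>2 * t\<close>,
      and every \<open>- lform (T i) (T i)\<close> is at least \<open>t\<close>.\<close>
    define c where "c = 2 * S / t + 2"
    have c1: "1 \<le> c" using S0 tpos by (simp add: c_def)
    have QT: "- lform (T i) (T i) = E (\<iota> i) (\<iota> i) / 2 + \<sigma> i" for i using lfT[of i i] by simp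
    have cc: "- lform (x i) (x l) \<le> c" if "i \<le> n" "l \<le> n" for i l
      unfolding x_def
    proof (rule normalize_cone_lform_le[OF tpos])
      show "t \<le> - lform (T i) (T i)" "t \<le> - lform (T l) (T l)"
        using QT[of i] QT[of l] diag[of "\<iota> i"] diag[of "\<iota> l"] \<sigma>[of i] \<sigma>[of l] by linarith+
      have "c * t = 2 * S + 2 * t" using tpos by (simp add: c_def field_simps)
      moreover have "(E (\<iota> i) (\<iota> l) + \<sigma> i + \<sigma> l) / 2 \<le> (4 * S + 4 * t) / 2"
        using E4[OF \<iota>[OF that(1)] \<iota>[OF that(2)]] \<sigma>[of i] \<sigma>[of l] by (intro divide_right_mono) linarith+
      moreover have "- lform (T i) (T l) = (E (\<iota> i) (\<iota> l) + \<sigma> i + \<sigma> l) / 2"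
        unfolding lfT by (simp only: minus_divide_left[symmetric] minus_minus)
      ultimately show "- lform (T i) (T l) \<le> c * t" by simp
    qed (use c1 in simp)
    define I where "I = (if i0 < j then i0 else Suc i0)"
    have I: "I \<le> n" "I \<noteq> j" "I \<noteq> Suc j" "\<iota> I = i0" using j by (auto simp: I_def \<iota>_def)
    have ij: "\<iota> j = j" "\<iota> (Suc j) = j" "\<sigma> j = t" "\<sigma> (Suc j) = 2 * t" by (simp_all add: \<iota>_def \<sigma>_def)
    have Tspan: "T i \<in> span (x(J := z) ` ({..n} - {J}))" if "i \<le> n" "i \<noteq> J" for i J z
    proof -
      have "x i \<in> x(J := z) ` ({..n} - {J})" using that by (intro image_eqI[of _ _ i]) auto
      then have "sqrt (- lform (T i) (T i)) *\<^sub>R x i \<in> span (x(J := z) ` ({..n} - {J}))"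
        by (intro span_scale span_base)
      then show ?thesis unfolding x_def by (simp only: normalize_cone_scale[OF Tc, symmetric])
    qed
    have zero: "F (x(J := normalize_cone z0)) = 0"
      if "z0 \<in> cone" "J \<le> n" "z0 \<in> span (x(J := normalize_cone z0) ` ({..n} - {J}))" for J z0
    proof (rule degenerate[of _ J])
      show "(x(J := normalize_cone z0)) i \<in> cone" for i
        using x normalize_cone_hyperboloid[OF that(1)] by (auto intro: hyperboloid_cone)
      show "(x(J := normalize_cone z0)) J \<in> span (x(J := normalize_cone z0) ` ({..n} - {J}))"
        using span_scale[OF that(3), of "1 / sqrt (- lform z0 z0)"] by (simp add: normalize_cone_def)
    qed (rule that(2))
    show ?thesis
    proof (intro conjI impI)
      assume tS: "t \<le> S"
      then have Spos: "0 < S" using tpos by linarith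
      \<comment> \<open>Chosen so that the cross term in \<open>- lform z0 z0\<close> is exactly
        \<open>t\<close>. Then \<open>- lform z0 z0\<close> agrees with \<open>az\<close>, the value
        belonging to \<open>T (Suc j)\<close>, up to a term quadratic in
        \<open>\<epsilon>\<close>.\<close>
      define \<epsilon> where "\<epsilon> = t / (S + t + \<sigma> I)"
      have \<epsilon>: "0 < \<epsilon>" "\<epsilon> \<le> t / S" "\<epsilon> * (S + t + \<sigma> I) = t"
        unfolding \<epsilon>_def using tpos Spos \<sigma>[of I] by (auto intro!: divide_left_mono divide_pos_pos mult_pos_pos)
      have "t / S \<le> 1" using tS Spos by simp
      with \<epsilon>(2) have "\<epsilon> \<le> 1" by linarith
      define z0 where "z0 = T j + \<epsilon> *\<^sub>R T I"
      have z0: "z0 \<in> cone" unfolding z0_def by (intro cone_add cone_scale Tc \<epsilon>)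
      define az where "az = E j j / 2 + 2 * t"
      have az: "2 * t \<le> az" using diag[of j] by (simp add: az_def)
      have l1: "lform (T j) (T I) = - (S + t + \<sigma> I) / 2" "lform (T I) (T j) = - (S + t + \<sigma> I) / 2"
        using lfT[of j I] lfT[of I j] comm[of j i0] by (simp_all add: I ij SE)
      have Q0: "- lform z0 z0 = az + \<epsilon> * \<epsilon> * (- lform (T I) (T I))"
        unfolding z0_def lform_add_left lform_add_right lform_scale_left lform_scale_right l1
        using \<epsilon>(3) QT[of j] by (simp add: ij az_def algebra_simps)
      have l2: "lform (T (Suc j)) (T j) = - (E j j + 3 * t) / 2" "lform (T (Suc j)) (T I) = - (S + 2 * t + \<sigma> I) / 2"
        using lfT[of "Suc j" j] lfT[of "Suc j" I] comm[of j i0] by (simp_all add: I ij SE)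
      have l3: "- lform (T (Suc j)) z0 = az + \<epsilon> * t / 2"
      proof -
        have e: "\<epsilon> * (S + 2 * t + \<sigma> I) = t + \<epsilon> * t" using \<epsilon>(3) by (simp add: algebra_simps)
        have "- lform (T (Suc j)) z0 = (E j j + 3 * t) / 2 + (\<epsilon> * (S + 2 * t + \<sigma> I)) / 2"
          unfolding z0_def lform_add_right lform_scale_right l2 by (simp add: field_simps)
        then show ?thesis unfolding e by (simp add: az_def field_simps)
      qed
      have "- lform (x (Suc j)) (normalize_cone z0) \<le> 1 + \<epsilon> / 4"
        unfolding x_def
      proof (rule normalize_cone_lform_le[where t = az])
        show "az \<le> - lform (T (Suc j)) (T (Suc j))" using QT[of "Suc j"] by (simp add: ij az_def)
        have "0 \<le> \<epsilon> * \<epsilon> * (- lform (T I) (T I))" using Tc[of I] by (simp add: cone_iff mult_nonneg_nonpos)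
        then show "az \<le> - lform z0 z0" unfolding Q0 by simp
        have "\<epsilon> * (2 * t) \<le> \<epsilon> * az" using az \<epsilon>(1) by (intro mult_left_mono) auto
        then show "- lform (T (Suc j)) z0 \<le> (1 + \<epsilon> / 4) * az" unfolding l3 by (simp add: algebra_simps)
      qed (use az tpos \<epsilon>(1) in auto)
      moreover have "F (x(Suc j := normalize_cone z0)) = 0"
      proof (rule zero[OF z0])
        show "z0 \<in> span (x(Suc j := normalize_cone z0) ` ({..n} - {Suc j}))"
          unfolding z0_def by (intro span_add span_scale Tspan) (use I j in auto)
      qed (use j in simp)
      ultimately have "\<bar>F x\<bar> \<le> C * sqrt (\<epsilon> / 4) * sqrt (sqrt c)"
        by (intro nd[OF x _ normalize_cone_hyperboloid[OF z0] c1 cc]) (use j \<open>\<epsilon> \<le> 1\<close> in auto)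
      also have "\<dots> \<le> C * sqrt (t / S) * sqrt (sqrt (4 * (S / t)))"
      proof (intro mult_mono mult_left_mono C0)
        show "sqrt (\<epsilon> / 4) \<le> sqrt (t / S)" using \<epsilon>(1,2) by (intro real_sqrt_le_mono) linarith
        have "2 \<le> 2 * (S / t)" using tS tpos by (simp add: le_divide_eq)
        then show "sqrt (sqrt c) \<le> sqrt (sqrt (4 * (S / t)))" unfolding c_def by simp
      qed (use C0 Spos tpos c1 \<epsilon>(1) in auto)
      \<comment> \<open>The balance of exponents: the square root of \<open>t / S\<close> against
        the fourth root of \<open>4 * (S / t)\<close> leaves the fourth root of
        \<open>4 * (t / S)\<close>.\<close>
      also have "\<dots> = C * sqrt (sqrt ((t / S) * (t / S) * (4 * (S / t))))"
      proof -
        have "0 \<le> t / S" using Spos tpos by simp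
        from sqrt_mult_sqrt_sqrt[OF this] show ?thesis by (simp only: mult.assoc)
      qed
      also have "(t / S) * (t / S) * (4 * (S / t)) = 4 * (t / S)" using Spos tpos by (simp add: field_simps)
      also have "C * sqrt (sqrt (4 * (t / S))) = C' * sqrt (sqrt (t / S))" by (simp only: C'_def real_sqrt_mult mult.assoc)
      finally show "\<bar>F T\<bar> \<le> C' * sqrt (sqrt (t / S))" using Fx by simp
    next
      assume St: "S \<le> t"
      \<comment> \<open>The time at which \<open>y j\<close> reaches the height of
        \<open>T I\<close>: \<open>z0\<close> is the point of the vertical line at that
        height.\<close>
      define s where "s = E i0 i0 / 2 + \<sigma> I - E j j / 2"
      define z0 where "z0 = lift t0 s (y j)"
      define az where "az = E i0 i0 / 2 + \<sigma> I"
      have az: "t \<le> az" using diag[of i0] \<sigma>[of I] by (simp add: az_def)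
      have Q0: "- lform z0 z0 = az"
        unfolding z0_def using lform_lift[OF y(2) y(2), of t0 s j s j] by (simp add: E_def s_def az_def)
      have z0: "z0 \<in> cone"
        by (rule cone_by_light) (use Q0 az tpos lform_lift_light[OF y(2), of t0 s j] in \<open>auto simp: z0_def\<close>)
      have l: "- lform (T I) z0 = (S + \<sigma> I + s) / 2"
        unfolding z0_def T_eq I SE E_def using lform_lift[OF y(2) y(2), of t0 "\<sigma> I" i0 s j] by simp
      have "- lform (x I) (normalize_cone z0) \<le> 1 + S / (2 * t)"
        unfolding x_def
      proof (rule normalize_cone_lform_le[where t = az])
        show "az \<le> - lform (T I) (T I)" using QT[of I] by (simp add: I az_def)
        have "S / (2 * t) * t \<le> S / (2 * t) * az" using az S0 tpos by (intro mult_left_mono) auto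
        then have "S / 2 \<le> S / (2 * t) * az" using tpos by simp
        then show "- lform (T I) z0 \<le> (1 + S / (2 * t)) * az"
          unfolding l s_def using diag[of i0] diag[of j] by (simp add: az_def distrib_right)
      qed (use az tpos S0 Q0 in auto)
      moreover have "F (x(I := normalize_cone z0)) = 0"
      proof (rule zero[OF z0 I(1)])
        \<comment> \<open>The two vertical points recover \<open>light\<close>, so their plane
          contains the whole vertical line and in particular \<open>z0\<close>.\<close>
        have "T (Suc j) - T j = (t / 2) *\<^sub>R light" by (simp add: T_eq ij lift_def flip: scaleR_left_diff_distrib) (simp add: field_simps)
        then have "light = (2 / t) *\<^sub>R (T (Suc j) - T j)" using tpos by simp
        moreover have "z0 = T j + ((s - t) / 2) *\<^sub>R light"
        proof -
          have "(s - t0) / 2 = (t - t0) / 2 + (s - t) / 2" by (simp add: diff_divide_distrib)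
          then show ?thesis by (simp only: z0_def T_eq ij lift_def scaleR_left_distrib add.assoc)
        qed
        ultimately have "z0 = T j + ((s - t) / 2) *\<^sub>R ((2 / t) *\<^sub>R (T (Suc j) - T j))" by metis
        also have "\<dots> \<in> span (x(I := normalize_cone z0) ` ({..n} - {I}))"
          by (intro span_add span_scale span_diff Tspan) (use I j in auto)
        finally show "z0 \<in> span (x(I := normalize_cone z0) ` ({..n} - {I}))" .
      qed
      ultimately have "\<bar>F x\<bar> \<le> C * sqrt (S / (2 * t)) * sqrt (sqrt c)"
        by (intro nd[OF x I(1) normalize_cone_hyperboloid[OF z0] c1 cc]) (use St tpos in auto)
      also have "\<dots> \<le> C * sqrt (sqrt (S / t)) * sqrt (sqrt 4)"
      proof (intro mult_mono mult_left_mono C0 real_sqrt_le_mono)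
        have u: "0 \<le> S / t" "S / t \<le> 1" using S0 St tpos by auto
        have "S / (2 * t) \<le> S / t" using S0 tpos by (intro divide_left_mono) auto
        also have "S / t \<le> sqrt (S / t)"
          by (rule real_le_rsqrt) (use mult_right_mono[OF u(2,1)] in \<open>simp only: power2_eq_square mult_1\<close>)
        finally show "S / (2 * t) \<le> sqrt (S / t)" .
        show "c \<le> 4" using u by (simp add: c_def)
      qed (use C0 S0 tpos c1 in auto)
      finally show "\<bar>F T\<bar> \<le> C' * sqrt (sqrt (S / t))" using Fx by (simp add: C'_def mult_ac)
    qed
  qed
  have "C' \<ge> 0" using C0 by (simp add: C'_def)
  then show ?thesis
    by (intro exI[of _ C'] conjI[of "0 \<le> C'"] allI impI) (assumption, rule main, auto)
qed


theorem bounded_cocycle: "\<exists>K. \<forall>x. (\<forall>i. x i \<in> cone) \<longrightarrow> \<bar>F x\<bar> \<le> K"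
proof -
  from term_bound obtain C where C0: "C \<ge> 0" and
    "\<forall>y t0 t j i0. (\<forall>i. y i \<in> cone \<and> lform (y i) light = - 1 \<and> t0 \<le> - lform (y i) (y i)) \<longrightarrow>
     0 < t0 \<longrightarrow> t0 \<le> t \<longrightarrow> j < n \<longrightarrow> i0 < n \<longrightarrow> i0 \<noteq> j \<longrightarrow>
     (\<forall>i<n. i \<noteq> j \<longrightarrow> energy t0 (y i) (y j) \<le> energy t0 (y i0) (y j)) \<longrightarrow>
     (t \<le> energy t0 (y i0) (y j) \<longrightarrow> \<bar>F (splice_at j (\<lambda>i. lift t0 t (y i)) (\<lambda>i. lift t0 (2 * t) (y i)))\<bar>
        \<le> C * sqrt (sqrt (t / energy t0 (y i0) (y j)))) \<and>
     (energy t0 (y i0) (y j) \<le> t \<longrightarrow> \<bar>F (splice_at j (\<lambda>i. lift t0 t (y i)) (\<lambda>i. lift t0 (2 * t) (y i)))\<bar>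
        \<le> C * sqrt (sqrt (energy t0 (y i0) (y j) / t)))"
    by (elim exE conjE)
  note tb = this(2)[rule_format]
  obtain K where "\<forall>x. (\<forall>i. x i \<in> hyperboloid) \<longrightarrow> (\<forall>i\<le>n. \<forall>j\<le>n. - lform (x i) (x j) \<le> 2) \<longrightarrow> \<bar>F x\<bar> \<le> K"
    using bounded_on_bounded[of 2] by (elim exE)
  note K = this[rule_format]
  define B where "B = 2 * C / (1 - sqrt (sqrt (1 / 2)))"
  \<comment> \<open>\<open>K\<close> bounds the final tuple; each of the \<open>Suc n\<close> faces
    carries \<open>n\<close> prism terms, and each of these sums over time to at most
    \<open>B\<close>.\<close>
  have "\<bar>F x0\<bar> \<le> K + real (Suc n) * (real n * B)" if x0: "\<And>i. x0 i \<in> cone" for x0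
  proof -
    \<comment> \<open>Letting the dummy entries repeat point \<open>0\<close> makes a minimum over
      finitely many entries a lower bound for all of them.\<close>
    define x where "x i = (if i \<le> n then x0 i else x0 0)" for i
    have x: "x i \<in> cone" for i using x0 by (simp add: x_def)
    define y where "y i = (1 / - lform (x i) light) *\<^sub>R x i" for i
    have neg: "lform (x i) light < 0" for i by (rule lform_light_neg[OF x])
    have y: "y i \<in> cone" "lform (y i) light = - 1" for i
    proof -
      have "0 < 1 / - lform (x i) light" using neg[of i] by simp
      then show "y i \<in> cone" unfolding y_def by (rule cone_scale[OF x])
      show "lform (y i) light = - 1" unfolding y_def lform_scale_left using neg[of i] by simp
    qed
    have "F y = F x" unfolding y_def by (rule homogeneous) (use x neg in auto)
    also have "F x = F x0" by (rule depends_uptoD[OF dep]) (simp add: x_def)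
    finally have Fy: "F y = F x0" .
    define t0 where "t0 = Min ((\<lambda>i. - lform (y i) (y i)) ` {..n})"
    have "t0 \<in> (\<lambda>i. - lform (y i) (y i)) ` {..n}" unfolding t0_def by (rule Min_in) auto
    then have t0: "0 < t0" using y(1) by (auto simp: cone_iff)
    have t0_le: "t0 \<le> - lform (y i) (y i)" for i
    proof -
      have "y i = y (if i \<le> n then i else 0)" by (simp add: y_def x_def)
      moreover have "t0 \<le> - lform (y (if i \<le> n then i else 0)) (y (if i \<le> n then i else 0))"
        unfolding t0_def by (rule Min_le) auto
      ultimately show ?thesis by simp
    qed
    define P where "P k i = lift t0 (2 ^ k * t0) (y i)" for k i
    have tk: "t0 \<le> 2 ^ k * t0" for k :: nat using t0 by simp
    have P: "P k i \<in> cone" for k i unfolding P_def by (rule lift_cone[OF y(1) tk])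
    have P0: "P 0 = y" by (rule ext) (simp add: P_def lift_def)
    define b where "b r j k = \<bar>F (splice_at j (P k \<circ> skip r) (P (Suc k) \<circ> skip r))\<bar>" for r j k
    have n: "n = Suc (n - 1)" using dim_ge by simp
    have step: "\<bar>F (P (Suc k)) - F (P k)\<bar> \<le> (\<Sum>r\<le>n. \<Sum>j<n. b r j k)" for k
    proof -
      have "(\<Sum>i\<le>Suc (n - 1). (- 1) ^ i * prism (n - 1) F (P k \<circ> skip i) (P (Suc k) \<circ> skip i)) = F (P (Suc k)) - F (P k)"
      proof (rule prism_identity)
        show "depends_upto (Suc (n - 1)) F" using dep n by simp
        show "cobd (Suc (n - 1)) F (splice_at j (P k) (P (Suc k))) = 0" for j
          using cocycle[of "splice_at j (P k) (P (Suc k))"] P n by (simp add: splice_at_def)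
      qed
      then have "F (P (Suc k)) - F (P k) = (\<Sum>r\<le>n. (- 1) ^ r * prism (n - 1) F (P k \<circ> skip r) (P (Suc k) \<circ> skip r))"
        using n by simp
      then have "\<bar>F (P (Suc k)) - F (P k)\<bar> \<le> (\<Sum>r\<le>n. \<bar>(- 1) ^ r * prism (n - 1) F (P k \<circ> skip r) (P (Suc k) \<circ> skip r)\<bar>)"
        by (simp only: sum_abs)
      also have "\<dots> \<le> (\<Sum>r\<le>n. \<Sum>j<n. b r j k)"
      proof (rule sum_mono)
        fix r
        have "\<bar>(- 1) ^ r * prism (n - 1) F (P k \<circ> skip r) (P (Suc k) \<circ> skip r)\<bar>
            = \<bar>\<Sum>j\<le>n - 1. (- 1) ^ j * F (splice_at j (P k \<circ> skip r) (P (Suc k) \<circ> skip r))\<bar>"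
          by (simp add: abs_mult prism_def)
        also have "\<dots> \<le> (\<Sum>j\<le>n - 1. \<bar>(- 1) ^ j * F (splice_at j (P k \<circ> skip r) (P (Suc k) \<circ> skip r))\<bar>)"
          by (rule sum_abs)
        also have "\<dots> = (\<Sum>j\<le>n - 1. b r j k)" by (simp add: abs_mult b_def)
        also have "{..n - 1} = {..<n}" using n by (metis lessThan_Suc_atMost)
        finally show "\<bar>(- 1) ^ r * prism (n - 1) F (P k \<circ> skip r) (P (Suc k) \<circ> skip r)\<bar> \<le> (\<Sum>j<n. b r j k)" .
      qed
      finally show ?thesis .
    qed
    have bsum: "(\<Sum>k<m. b r j k) \<le> B" if j: "j < n" for r j m
    proof -
      define y' where "y' = y \<circ> skip r"
      have y': "y' i \<in> cone \<and> lform (y' i) light = - 1 \<and> t0 \<le> - lform (y' i) (y' i)" for i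
        using y t0_le by (simp add: y'_def)
      let ?g = "\<lambda>i. energy t0 (y' i) (y' j)"
      have fin: "finite (?g ` ({..<n} - {j}))" by simp
      \<comment> \<open>A face has the \<open>n\<close> indices below \<open>n\<close>, so
        \<open>n \<ge> 2\<close> provides one different from \<open>j\<close>.\<close>
      have "(if j = 0 then 1 else 0) \<in> {..<n} - {j}" using dim_ge j by auto
      then have ne: "?g ` ({..<n} - {j}) \<noteq> {}" by blast
      from Max_in[OF fin ne] obtain i0 where "Max (?g ` ({..<n} - {j})) = ?g i0" "i0 \<in> {..<n} - {j}"
        by (rule imageE)
      then have i0: "i0 < n" "i0 \<noteq> j" "?g i0 = Max (?g ` ({..<n} - {j}))" by simp_all
      have max: "?g i \<le> ?g i0" if "i < n" "i \<noteq> j" for i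
        unfolding i0(3) by (rule Max_ge[OF fin]) (use that in auto)
      have S0: "0 \<le> ?g i0"
        using energy_diag_le[of "y' i0" "y' j" t0] y'[of i0] y'[of j] by (simp add: energy_def)
      have bT: "b r j k = \<bar>F (splice_at j (\<lambda>i. lift t0 (2 ^ k * t0) (y' i)) (\<lambda>i. lift t0 (2 * (2 ^ k * t0)) (y' i)))\<bar>" for k
        by (simp add: b_def y'_def P_def comp_def mult.assoc)
      note T = tb[of y' t0 _ j i0, OF y' t0 tk j i0(1,2) max]
      show ?thesis
        unfolding B_def
        by (rule dyadic_sum_le[OF t0 S0 C0]) (use T in \<open>simp_all add: bT\<close>)
    qed
    \<comment> \<open>The pushing stops at a finite time: after \<open>m\<close> doublings every
      energy is at most the time \<open>2 ^ m * t0\<close>, the normalised points have pairwise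
      \<open>- lform\<close> at most 2, and compactness bounds the tuple by
      \<open>K\<close>.\<close>
    obtain m where m: "(\<Sum>i\<le>n. \<Sum>l\<le>n. energy t0 (y i) (y l)) / t0 < 2 ^ m"
      using real_arch_pow[of 2 "(\<Sum>i\<le>n. \<Sum>l\<le>n. energy t0 (y i) (y l)) / t0"] by auto
    have e0: "0 \<le> energy t0 (y i) (y l)" for i l
      using energy_diag_le[OF y(2) y(2), of t0 i l] t0_le[of i] t0_le[of l] by (simp add: energy_def)
    have e: "energy t0 (y i) (y l) \<le> 2 ^ m * t0" if "i \<le> n" "l \<le> n" for i l
    proof -
      have "energy t0 (y i) (y l) \<le> (\<Sum>l\<le>n. energy t0 (y i) (y l))"
        using that by (intro member_le_sum e0) auto
      also have "\<dots> \<le> (\<Sum>i\<le>n. \<Sum>l\<le>n. energy t0 (y i) (y l))"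
        using that by (intro member_le_sum[of i "{..n}" "\<lambda>i. \<Sum>l\<le>n. energy t0 (y i) (y l)"] sum_nonneg e0) auto
      also have "\<dots> \<le> 2 ^ m * t0" using m t0 by (simp add: pos_divide_less_eq)
      finally show ?thesis .
    qed
    have "\<bar>F (\<lambda>i. normalize_cone (P m i))\<bar> \<le> K"
    proof (rule K)
      show "normalize_cone (P m i) \<in> hyperboloid" for i by (rule normalize_cone_hyperboloid[OF P])
      let ?t = "2 ^ m * t0"
      have tpos: "0 < ?t" using t0 by simp
      have lf: "lform (P m i) (P m l) = - (energy t0 (y i) (y l) + ?t + ?t) / 2" for i l
        unfolding P_def by (rule lform_lift[OF y(2) y(2)])
      have lf': "- lform (P m i) (P m l) = energy t0 (y i) (y l) / 2 + ?t" for i l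
        unfolding lf by (simp only: minus_divide_left[symmetric] minus_minus add_divide_distrib)
      show "- lform (normalize_cone (P m i)) (normalize_cone (P m l)) \<le> 2" if "i \<le> n" "l \<le> n" for i l
        by (rule normalize_cone_lform_le[OF tpos]; (unfold lf')?)
          (use e[OF that] e0[of i i] e0[of l l] tpos in linarith)+
    qed
    then have last: "\<bar>F (P m)\<bar> \<le> K" by (simp only: F_normalize_all[OF P])
    have "F (P m) - F (P 0) = (\<Sum>k<m. F (P (Suc k)) - F (P k))"
      by (rule sum_lessThan_telescope[symmetric])
    then have "\<bar>F (P m) - F (P 0)\<bar> \<le> (\<Sum>k<m. \<bar>F (P (Suc k)) - F (P k)\<bar>)" by (simp only: sum_abs)
    also have "\<dots> \<le> (\<Sum>k<m. \<Sum>r\<le>n. \<Sum>j<n. b r j k)" by (intro sum_mono step)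
    also have "\<dots> = (\<Sum>r\<le>n. \<Sum>k<m. \<Sum>j<n. b r j k)" by (rule sum.swap)
    also have "\<dots> = (\<Sum>r\<le>n. \<Sum>j<n. \<Sum>k<m. b r j k)" by (intro sum.cong refl sum.swap)
    also have "\<dots> \<le> (\<Sum>r\<le>n. \<Sum>j<n. B)" by (intro sum_mono bsum) simp
    also have "\<dots> = real (Suc n) * (real n * B)" by simp
    finally show ?thesis using last unfolding P0 Fy by linarith
  qed
  then show ?thesis by blast
qed

end

section \<open>Averaging over the stabilizer of the origin\<close>

definition stabilizer :: "(real ^ ('n::finite) option ^ 'n option) set" where
  "stabilizer = {k \<in> lorentz. k *v origin = origin}"

lemma stabilizer_lorentz: "k \<in> stabilizer \<Longrightarrow> k \<in> lorentz"
  and stabilizer_origin: "k \<in> stabilizer \<Longrightarrow> k *v origin = origin"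
  by (auto simp: stabilizer_def)

lemma mat_1_stabilizer: "mat 1 \<in> stabilizer"
  by (simp add: stabilizer_def mat_1_lorentz)

lemma stabilizer_inner:
  assumes "k \<in> stabilizer"
  shows "(k *v x) \<bullet> (k *v y) = x \<bullet> y"
proof -
  have None: "(k *v x) $ None = x $ None" for x
  proof -
    have "lform (k *v x) (k *v origin) = lform x origin"
      by (rule lform_lorentz[OF stabilizer_lorentz[OF assms]])
    then show ?thesis unfolding stabilizer_origin[OF assms] by simp
  qed
  have "lform (k *v x) (k *v y) = lform x y" by (rule lform_lorentz[OF stabilizer_lorentz[OF assms]])
  then show ?thesis by (simp add: lform_def None)
qed

lemma stabilizer_norm: "k \<in> stabilizer \<Longrightarrow> norm (k *v x) = norm x"
  by (simp add: norm_eq_sqrt_inner stabilizer_inner)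

lemma stabilizerI:
  assumes inner: "\<And>x y. (k *v x) \<bullet> (k *v y) = x \<bullet> y" and o: "k *v origin = origin"
  shows "k \<in> stabilizer"
proof -
  have None: "(k *v x) $ None = x $ None" for x
    using inner[of x origin] unfolding o by simp
  have "k \<in> lorentz" by (rule lorentzI) (simp_all add: lform_def inner None)
  then show ?thesis using o by (simp add: stabilizer_def)
qed

lemma stabilizer_mult: "k \<in> stabilizer \<Longrightarrow> l \<in> stabilizer \<Longrightarrow> k ** l \<in> stabilizer"
  unfolding stabilizer_def by (auto simp: lorentz_mult simp flip: matrix_vector_mul_assoc)

lemma stabilizer_inverse:
  assumes "k \<in> stabilizer"
  shows "transpose k \<in> stabilizer" "k ** transpose k = mat 1" "transpose k ** k = mat 1"
proof -
  have "orthogonal_transformation ((*v) k)"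
    unfolding orthogonal_transformation_def using stabilizer_inner[OF assms] by simp
  then have "orthogonal_matrix k" by (simp add: orthogonal_transformation_matrix)
  then show e: "k ** transpose k = mat 1" "transpose k ** k = mat 1"
    by (simp_all add: orthogonal_matrix_def)
  have t: "k *v (transpose k *v x) = x" "transpose k *v (k *v x) = x" for x
    unfolding matrix_vector_mul_assoc e by simp_all
  show "transpose k \<in> stabilizer"
  proof (rule stabilizerI)
    show "(transpose k *v x) \<bullet> (transpose k *v y) = x \<bullet> y" for x y
      using stabilizer_inner[OF assms, of "transpose k *v x" "transpose k *v y"] unfolding t by simp
    show "transpose k *v origin = origin" using t(2)[of origin] unfolding stabilizer_origin[OF assms] .
  qed
qed

lemma continuous_on_matrix_vector_mult [continuous_intros]:
  fixes f :: "'a::topological_space \<Rightarrow> real ^ 'm ^ 'k"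
  shows "continuous_on S f \<Longrightarrow> continuous_on S g \<Longrightarrow> continuous_on S (\<lambda>x. f x *v g x)"
  unfolding matrix_vector_mult_def by (intro continuous_intros)

lemma continuous_on_matrix_matrix_mult [continuous_intros]:
  fixes f :: "'a::topological_space \<Rightarrow> real ^ 'm ^ 'k" and g :: "'a \<Rightarrow> real ^ 'l ^ 'm"
  shows "continuous_on S f \<Longrightarrow> continuous_on S g \<Longrightarrow> continuous_on S (\<lambda>x. f x ** g x)"
  unfolding matrix_matrix_mult_def by (intro continuous_intros)

lemma compact_stabilizer: "compact (stabilizer :: (real ^ ('n::finite) option ^ 'n option) set)"
proof -
  let ?S = "(\<Inter>x. \<Inter>y. {k :: real ^ 'n option ^ 'n option. (k *v x) \<bullet> (k *v y) = x \<bullet> y})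
    \<inter> {k. k *v origin = origin}"
  have eq: "stabilizer = ?S"
    by (auto simp: stabilizer_inner stabilizer_origin intro!: stabilizerI)
  have "closed ?S"
    by (intro closed_Int closed_INT ballI closed_Collect_eq continuous_intros)
  then have "closed (stabilizer :: (real ^ 'n option ^ 'n option) set)" unfolding eq .
  moreover have "bounded (stabilizer :: (real ^ 'n option ^ 'n option) set)"
    unfolding bounded_iff
  proof (intro exI ballI)
    fix k :: "real ^ 'n option ^ 'n option" assume k: "k \<in> stabilizer"
    have "\<bar>k $ i $ j\<bar> \<le> 1" for i j
    proof -
      have "k $ i $ j = (k *v axis j 1) $ i" by (simp add: matrix_vector_mult_basis column_def)
      also have "\<bar>\<dots>\<bar> \<le> norm (k *v axis j 1)" by (rule component_le_norm_cart)
      finally show ?thesis using stabilizer_norm[OF k] by simp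
    qed
    then have "(\<Sum>i\<in>UNIV. \<Sum>j\<in>UNIV. \<bar>k $ i $ j\<bar>) \<le> (\<Sum>i\<in>(UNIV :: 'n option set). \<Sum>j\<in>(UNIV :: 'n option set). 1)"
      by (intro sum_mono)
    moreover have "norm k \<le> (\<Sum>i\<in>UNIV. norm (k $ i))"
      unfolding norm_vec_def[of k] by (rule L2_set_le_sum) simp
    moreover have "(\<Sum>i\<in>UNIV. norm (k $ i)) \<le> (\<Sum>i\<in>UNIV. \<Sum>j\<in>UNIV. \<bar>k $ i $ j\<bar>)"
      by (intro sum_mono norm_le_l1_cart)
    ultimately show "norm k \<le> (\<Sum>i\<in>(UNIV :: 'n option set). \<Sum>j\<in>(UNIV :: 'n option set). 1)" by linarith
  qed
  ultimately show ?thesis using compact_eq_bounded_closed by blast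
qed

text \<open>Haar measure on the stabilizer is the law of the Gram--Schmidt frame of a random matrix whose
  law is invariant under the stabilizer.\<close>

definition frame_rank :: "('n::finite) option \<Rightarrow> nat" where
  "frame_rank i = (case i of None \<Rightarrow> 0 | Some b \<Rightarrow> Suc (to_nat_on UNIV b))"

lemma frame_rank_inj: "frame_rank i = frame_rank j \<Longrightarrow> i = j"
  by (auto simp: frame_rank_def countable_finite split: option.splits dest: inj_onD[OF inj_on_to_nat_on])

text \<open>Overwriting the column of rank 0 by the origin makes the resulting orthonormal frame fix
  the origin.\<close>

definition frame_col :: "real ^ ('n::finite) option ^ 'n option \<Rightarrow> 'n option \<Rightarrow> real ^ 'n option" where
  "frame_col A i = (if i = None then origin else column i A)"

function gram_schmidt :: "real ^ ('n::finite) option ^ 'n option \<Rightarrow> 'n option \<Rightarrow> real ^ 'n option" where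
  "gram_schmidt A i = sgn (frame_col A i -
     (\<Sum>j\<in>{j. frame_rank j < frame_rank i}. (frame_col A i \<bullet> gram_schmidt A j) *\<^sub>R gram_schmidt A j))"
  by pat_completeness auto
termination by (relation "Wellfounded.measure (\<lambda>(A, i). frame_rank i)") auto

declare gram_schmidt.simps [simp del]

definition frame_matrix :: "real ^ ('n::finite) option ^ 'n option \<Rightarrow> real ^ 'n option ^ 'n option" where
  "frame_matrix A = (\<chi> r c. frame_col A c $ r)"

lemma column_matrix_mult: "column i (k ** A) = k *v column i A"
  by (simp add: vec_eq_iff column_def matrix_matrix_mult_def matrix_vector_mult_def)

lemma column_frame_matrix: "column i (frame_matrix A) = frame_col A i"
  by (simp add: vec_eq_iff column_def frame_matrix_def)

lemma frame_col_stabilizer: "k \<in> stabilizer \<Longrightarrow> frame_col (k ** A) i = k *v frame_col A i"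
  by (simp add: frame_col_def column_matrix_mult stabilizer_origin)

lemma frame_matrix_stabilizer: "k \<in> stabilizer \<Longrightarrow> frame_matrix (k ** A) = k ** frame_matrix A"
  by (simp add: vec_eq_iff frame_matrix_def frame_col_stabilizer)
     (simp add: matrix_matrix_mult_def matrix_vector_mult_def frame_matrix_def)

text \<open>The construction uses only inner products, norms and the origin, all of which the
  stabilizer preserves; induction on the rank.\<close>

lemma gram_schmidt_stabilizer:
  fixes A :: "real ^ ('n::finite) option ^ 'n option"
  assumes k: "k \<in> stabilizer"
  shows "gram_schmidt (k ** A) i = k *v gram_schmidt A i"
proof (induction "frame_rank i" arbitrary: i rule: less_induct)
  case less
  have sgn: "sgn (k *v x) = k *v sgn x" for x
    by (simp add: sgn_div_norm stabilizer_norm[OF k] matrix_vector_mult_scaleR)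
  let ?J = "{j :: 'n option. frame_rank j < frame_rank i}"
  have "(\<Sum>j\<in>?J. (frame_col (k ** A) i \<bullet> gram_schmidt (k ** A) j) *\<^sub>R gram_schmidt (k ** A) j)
     = (\<Sum>j\<in>?J. k *v ((frame_col A i \<bullet> gram_schmidt A j) *\<^sub>R gram_schmidt A j))"
  proof (rule sum.cong[OF refl])
    fix j assume "j \<in> ?J"
    then have "gram_schmidt (k ** A) j = k *v gram_schmidt A j" using less by simp
    then show "(frame_col (k ** A) i \<bullet> gram_schmidt (k ** A) j) *\<^sub>R gram_schmidt (k ** A) j
        = k *v ((frame_col A i \<bullet> gram_schmidt A j) *\<^sub>R gram_schmidt A j)"
      by (simp only: frame_col_stabilizer[OF k] stabilizer_inner[OF k] matrix_vector_mult_scaleR)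
  qed
  also have "\<dots> = k *v (\<Sum>j\<in>?J. (frame_col A i \<bullet> gram_schmidt A j) *\<^sub>R gram_schmidt A j)"
    by (rule linear_sum[OF matrix_vector_mul_linear, symmetric])
  finally have "frame_col (k ** A) i - (\<Sum>j\<in>?J. (frame_col (k ** A) i \<bullet> gram_schmidt (k ** A) j) *\<^sub>R gram_schmidt (k ** A) j)
     = k *v (frame_col A i - (\<Sum>j\<in>?J. (frame_col A i \<bullet> gram_schmidt A j) *\<^sub>R gram_schmidt A j))"
    by (simp only: frame_col_stabilizer[OF k] matrix_vector_mult_diff_distrib)
  then have "gram_schmidt (k ** A) i = sgn (k *v (frame_col A i - (\<Sum>j\<in>?J. (frame_col A i \<bullet> gram_schmidt A j) *\<^sub>R gram_schmidt A j)))"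
    by (subst gram_schmidt.simps) (rule arg_cong[of _ _ sgn])
  also have "\<dots> = k *v gram_schmidt A i"
    unfolding sgn by (rule arg_cong[of _ _ "(*v) k"]) (rule gram_schmidt.simps[symmetric])
  finally show ?case .
qed

definition good_frame :: "(real ^ ('n::finite) option ^ 'n option) set" where
  "good_frame = {A. det (frame_matrix A) \<noteq> 0}"

lemma gram_schmidt_orthonormal:
  fixes A :: "real ^ ('n::finite) option ^ 'n option"
  assumes A: "A \<in> good_frame"
  shows "norm (gram_schmidt A i) = 1 \<and> (\<forall>j. frame_rank j < frame_rank i \<longrightarrow> gram_schmidt A i \<bullet> gram_schmidt A j = 0)
    \<and> gram_schmidt A i \<in> span (frame_col A ` {j. frame_rank j \<le> frame_rank i})"
proof (induction "frame_rank i" arbitrary: i rule: less_induct)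
  case less
  let ?J = "{j :: 'n option. frame_rank j < frame_rank i}"
  let ?g = "gram_schmidt A"
  define c where "c j = frame_col A i \<bullet> ?g j" for j
  define res where "res = frame_col A i - (\<Sum>j\<in>?J. c j *\<^sub>R ?g j)"
  have g: "?g i = sgn res" unfolding gram_schmidt.simps[of _ i] res_def c_def ..
  have IH: "norm (?g j) = 1" "\<And>l. frame_rank l < frame_rank j \<Longrightarrow> ?g j \<bullet> ?g l = 0"
    "?g j \<in> span (frame_col A ` {l. frame_rank l \<le> frame_rank j})" if "j \<in> ?J" for j
    using less[of j] that by auto
  have span: "?g j \<in> span (frame_col A ` ?J)" if "j \<in> ?J" for j
    by (rule set_mp[OF span_mono IH(3)[OF that]]) (use that in auto)
  have "invertible (frame_matrix A)" using A by (simp add: good_frame_def invertible_det_nz)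
  then obtain N where N: "N ** frame_matrix A = mat 1" unfolding invertible_def by auto
  have Nc: "N *v frame_col A j = axis j 1" for j
  proof -
    have "N *v frame_col A j = column j (N ** frame_matrix A)"
      by (simp add: column_matrix_mult column_frame_matrix)
    then show ?thesis unfolding N by (simp add: vec_eq_iff column_def mat_def axis_def)
  qed
  have "res \<noteq> 0"
  proof
    assume "res = 0"
    then have "frame_col A i = (\<Sum>j\<in>?J. c j *\<^sub>R ?g j)" by (simp add: res_def)
    also have "\<dots> \<in> span (frame_col A ` ?J)" by (intro span_sum span_scale span)
    finally have mem: "frame_col A i \<in> span (frame_col A ` ?J)" .
    \<comment> \<open>The inverse of the frame sends its columns to the standard basis, so
      coordinate \<open>i\<close> vanishes on the span of the earlier columns but not on column
      \<open>i\<close>.\<close>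
    have "(N *v x) $ i = 0" if "x \<in> span (frame_col A ` ?J)" for x
      using that
    proof (induction rule: span_induct)
      case base
      show ?case by (simp add: subspace_def matrix_vector_right_distrib matrix_vector_mult_scaleR)
    next
      case (step x)
      then show ?case by (auto simp: Nc axis_def)
    qed
    from this[OF mem] show False by (simp add: Nc)
  qed
  have gg: "?g j \<bullet> ?g l = (if j = l then 1 else 0)" if "j \<in> ?J" "l \<in> ?J" for j l
  proof (cases "j = l")
    case True
    then show ?thesis using IH(1)[OF that(1)] by (simp add: norm_eq_1)
  next
    case False
    then have "frame_rank j < frame_rank l \<or> frame_rank l < frame_rank j"
      using frame_rank_inj[of j l] by linarith
    then show ?thesis using IH(2)[OF that(1), of l] IH(2)[OF that(2), of j] False by (auto simp: inner_commute)
  qed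
  have orth: "res \<bullet> ?g l = 0" if l: "l \<in> ?J" for l
  proof -
    have "(\<Sum>j\<in>?J. c j *\<^sub>R ?g j) \<bullet> ?g l = (\<Sum>j\<in>?J. if j = l then c j else 0)"
      unfolding inner_sum_left by (rule sum.cong) (use gg l in auto)
    also have "\<dots> = c l" using l by (simp add: sum.delta)
    finally show ?thesis by (simp add: res_def inner_diff_left c_def)
  qed
  have "res \<in> span (frame_col A ` {j. frame_rank j \<le> frame_rank i})"
    unfolding res_def
  proof (intro span_diff span_sum span_scale)
    show "frame_col A i \<in> span (frame_col A ` {j. frame_rank j \<le> frame_rank i})" by (intro span_base) auto
    show "?g j \<in> span (frame_col A ` {j. frame_rank j \<le> frame_rank i})" if "j \<in> ?J" for j
      by (rule set_mp[OF span_mono span[OF that]]) auto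
  qed
  then show ?case
    using \<open>res \<noteq> 0\<close> orth unfolding g by (simp add: sgn_div_norm span_scale)
qed

text \<open>The default \<open>mat 1\<close> keeps the values in the stabilizer for every matrix, so
  the map is measurable into it; the random matrix itself is drawn from good frames.\<close>

definition frame_rotation :: "real ^ ('n::finite) option ^ 'n option \<Rightarrow> real ^ 'n option ^ 'n option" where
  "frame_rotation A = (if A \<in> good_frame then (\<chi> r c. gram_schmidt A c $ r) else mat 1)"

lemma column_gram_schmidt: "column c (\<chi> r c. gram_schmidt A c $ r) = gram_schmidt A c"
  by (simp add: vec_eq_iff column_def)

lemma frame_rotation_stabilizer:
  fixes A :: "real ^ ('n::finite) option ^ 'n option"
  shows "frame_rotation A \<in> stabilizer"
proof (cases "A \<in> good_frame")
  case True
  let ?k = "\<chi> r c. gram_schmidt A c $ r"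
  note gs = gram_schmidt_orthonormal[OF True]
  have "orthogonal_matrix ?k"
    unfolding orthogonal_matrix_orthonormal_columns column_gram_schmidt
  proof (intro conjI allI impI)
    fix i j :: "'n option" assume "i \<noteq> j"
    then have "frame_rank i < frame_rank j \<or> frame_rank j < frame_rank i"
      using frame_rank_inj[of i j] by linarith
    then show "orthogonal (gram_schmidt A i) (gram_schmidt A j)"
      using gs[of i] gs[of j] by (auto simp: orthogonal_def inner_commute)
  qed (use gs in blast)
  then have "orthogonal_transformation ((*v) ?k)"
    by (simp add: orthogonal_transformation_matrix)
  moreover have "?k *v origin = origin"
  proof -
    have "{j :: 'n option. frame_rank j < frame_rank (None :: 'n option)} = {}" by (simp add: frame_rank_def)
    then have "gram_schmidt A None = origin"
      by (subst gram_schmidt.simps) (simp add: frame_col_def sgn_div_norm)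
    then show ?thesis by (simp only: matrix_vector_mult_basis column_gram_schmidt)
  qed
  ultimately have "?k \<in> stabilizer"
    by (intro stabilizerI) (auto simp: orthogonal_transformation_def)
  then show ?thesis using True by (simp add: frame_rotation_def)
qed (simp add: frame_rotation_def mat_1_stabilizer)

lemma good_frame_stabilizer:
  assumes "k \<in> stabilizer"
  shows "k ** A \<in> good_frame \<longleftrightarrow> A \<in> good_frame"
proof -
  have "det k * det (transpose k) = 1"
    using arg_cong[OF stabilizer_inverse(2)[OF assms], of det] by (simp add: det_mul det_I)
  then have "det k \<noteq> 0" by auto
  then show ?thesis by (simp add: good_frame_def frame_matrix_stabilizer[OF assms] det_mul)
qed

lemma frame_rotation_equivariant:
  assumes "k \<in> stabilizer" "A \<in> good_frame"
  shows "frame_rotation (k ** A) = k ** frame_rotation A"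
proof -
  have "(\<chi> r c. (k *v gram_schmidt A c) $ r) = k ** (\<chi> r c. gram_schmidt A c $ r)"
    by (simp add: vec_eq_iff matrix_matrix_mult_def matrix_vector_mult_def)
  then show ?thesis
    using assms by (simp add: frame_rotation_def good_frame_stabilizer gram_schmidt_stabilizer)
qed

lemma continuous_frame_col: "continuous_on S (\<lambda>A. frame_col A i)"
  unfolding frame_col_def column_def by (cases "i = None") (auto intro!: continuous_intros)

lemma open_good_frame: "open good_frame"
proof -
  have "continuous_on UNIV (\<lambda>A. det (frame_matrix A))"
    unfolding det_def frame_matrix_def
    by (simp, intro continuous_intros continuous_frame_col)
  then show ?thesis unfolding good_frame_def
    by (intro open_Collect_neq continuous_intros)
qed

lemma measurable_gram_schmidt [measurable]: "(\<lambda>A. gram_schmidt A i) \<in> borel_measurable borel"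
proof (induction "frame_rank i" arbitrary: i rule: less_induct)
  case less
  have [measurable]: "(\<lambda>A. frame_col A i) \<in> borel_measurable borel"
    by (rule borel_measurable_continuous_onI[OF continuous_frame_col])
  have "(\<lambda>A. \<Sum>j\<in>{j. frame_rank j < frame_rank i}. (frame_col A i \<bullet> gram_schmidt A j) *\<^sub>R gram_schmidt A j) \<in> borel_measurable borel"
    by (intro borel_measurable_sum borel_measurable_scaleR borel_measurable_inner) (use less in auto)
  then show ?case unfolding gram_schmidt.simps[of _ i] sgn_div_norm by measurable
qed

lemma measurable_frame_rotation [measurable]:
  "(frame_rotation :: real ^ ('n::finite) option ^ 'n option \<Rightarrow> _) \<in> borel_measurable borel"
proof -
  have [measurable]: "(good_frame :: (real ^ 'n option ^ 'n option) set) \<in> sets borel" by (simp add: open_good_frame)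
  have 1: "(\<lambda>A :: real ^ 'n option ^ 'n option. \<chi> r c. gram_schmidt A c $ r) \<in> borel_measurable borel"
  proof (subst borel_measurable_euclidean_space, intro ballI)
    fix b :: "real ^ 'n option ^ 'n option" assume "b \<in> Basis"
    then obtain r c where b: "b = axis r (axis c 1)" by (auto simp: Basis_vec_def)
    have "(\<lambda>A :: real ^ 'n option ^ 'n option. gram_schmidt A c \<bullet> axis r 1) \<in> borel_measurable borel" by measurable
    then show "(\<lambda>A :: real ^ 'n option ^ 'n option. (\<chi> r c. gram_schmidt A c $ r) \<bullet> b) \<in> borel_measurable borel"
      by (simp add: b inner_axis)
  qed
  show ?thesis unfolding frame_rotation_def using 1 by measurable
qed

text \<open>A bounded open set of good frames, invariant under the stabilizer, that carries the
  uniform law. The radius exceeds the norm of the identity, which makes the set nonempty and its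
  measure positive.\<close>

definition frame_domain :: "(real ^ ('n::finite) option ^ 'n option) set" where
  "frame_domain = good_frame \<inter> ball 0 (norm (mat 1 :: real ^ 'n option ^ 'n option) + 1)"

lemma norm_stabilizer_mult:
  fixes A :: "real ^ ('n::finite) option ^ 'n option"
  assumes "k \<in> stabilizer"
  shows "norm (k ** A) = norm A"
proof -
  have inner: "B \<bullet> B = (\<Sum>j\<in>UNIV. column j B \<bullet> column j B)" for B :: "real ^ 'n option ^ 'n option"
    unfolding inner_vec_def[of B B] inner_vec_def[of "B $ _" "B $ _"] inner_vec_def[of "column _ B" "column _ B"]
    by (subst sum.swap) (simp add: column_def)
  have "(k ** A) \<bullet> (k ** A) = A \<bullet> A"
    unfolding inner[of A] inner[of "k ** A"] by (simp add: column_matrix_mult stabilizer_inner[OF assms])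
  then show ?thesis by (simp add: norm_eq_sqrt_inner)
qed

lemma frame_domain_stabilizer: "k \<in> stabilizer \<Longrightarrow> k ** A \<in> frame_domain \<longleftrightarrow> A \<in> frame_domain"
  by (simp add: frame_domain_def good_frame_stabilizer norm_stabilizer_mult)

lemma frame_domain_emeasure:
  "emeasure lborel (frame_domain :: (real ^ ('n::finite) option ^ 'n option) set) \<noteq> 0"
  "emeasure lborel (frame_domain :: (real ^ ('n::finite) option ^ 'n option) set) \<noteq> \<infinity>"
  and open_frame_domain: "open (frame_domain :: (real ^ ('n::finite) option ^ 'n option) set)"
proof -
  show op: "open (frame_domain :: (real ^ 'n option ^ 'n option) set)"
    unfolding frame_domain_def by (intro open_Int open_good_frame open_ball)
  have "frame_matrix (mat 1) = (mat 1 :: real ^ 'n option ^ 'n option)"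
    by (simp add: vec_eq_iff frame_matrix_def frame_col_def column_def mat_def axis_def)
  then have "(mat 1 :: real ^ 'n option ^ 'n option) \<in> frame_domain"
    by (simp add: frame_domain_def good_frame_def)
  then show "emeasure lborel (frame_domain :: (real ^ 'n option ^ 'n option) set) \<noteq> 0"
    by (intro emeasure_open_pos op) auto
  have "bounded (frame_domain :: (real ^ 'n option ^ 'n option) set)"
    unfolding frame_domain_def by (intro bounded_Int) auto
  then show "emeasure lborel (frame_domain :: (real ^ 'n option ^ 'n option) set) \<noteq> \<infinity>"
    using emeasure_bounded_finite by (metis less_irrefl infinity_ennreal_def)
qed

lemma distr_lborel_stabilizer:
  fixes k :: "real ^ ('n::finite) option ^ 'n option"
  assumes "k \<in> stabilizer"
  shows "distr lborel borel ((**) k :: real ^ 'n option ^ 'n option \<Rightarrow> _) = lborel"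
proof (rule distr_lborel_isometry)
  show "linear ((**) k :: real ^ 'n option ^ 'n option \<Rightarrow> _)"
  proof (rule linearI)
    show "k ** (A + B) = k ** A + k ** B" for A B :: "real ^ 'n option ^ 'n option"
      by (rule matrix_add_ldistrib)
    show "k ** (c *\<^sub>R A) = c *\<^sub>R (k ** A)" for c and A :: "real ^ 'n option ^ 'n option"
      by (simp add: vec_eq_iff matrix_matrix_mult_def sum_distrib_left mult_ac)
  qed
  show "k ** (transpose k ** A) = A" for A :: "real ^ 'n option ^ 'n option"
    by (simp add: matrix_mul_assoc stabilizer_inverse[OF assms])
qed (rule norm_stabilizer_mult[OF assms])

definition haar :: "(real ^ ('n::finite) option ^ 'n option) measure" where
  "haar = distr (uniform_measure lborel frame_domain) (restrict_space borel stabilizer) frame_rotation"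

lemma borel_stabilizer [measurable]: "stabilizer \<in> sets borel"
  by (simp add: borel_closed compact_imp_closed compact_stabilizer)

lemma frame_rotation_measurable_stabilizer:
  "frame_rotation \<in> uniform_measure lborel frame_domain \<rightarrow>\<^sub>M restrict_space borel stabilizer"
  by (rule measurable_restrict_space2) (auto simp: frame_rotation_stabilizer)

lemma sets_haar: "sets haar = sets (restrict_space borel stabilizer)"
  and space_haar: "space haar = stabilizer"
  by (simp_all add: haar_def space_restrict_space)

lemma prob_space_haar: "prob_space haar"
  unfolding haar_def
  by (intro prob_space.prob_space_distr prob_space_uniform_measure frame_domain_emeasure
      frame_rotation_measurable_stabilizer)

lemma emeasure_haar:
  fixes S :: "(real ^ ('n::finite) option ^ 'n option) set"
  assumes "S \<in> sets haar"
  shows "emeasure haar S = emeasure lborel (frame_domain \<inter> frame_rotation -` S)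
    / emeasure lborel (frame_domain :: (real ^ 'n option ^ 'n option) set)"
proof -
  have S: "S \<in> sets borel" using assms by (auto simp: sets_haar sets_restrict_space)
  have [measurable]: "(frame_domain :: (real ^ 'n option ^ 'n option) set) \<in> sets borel"
    by (simp add: open_frame_domain)
  have "frame_rotation -` S \<in> sets borel" using measurable_sets_borel[OF measurable_frame_rotation S] by simp
  moreover have "emeasure haar S = emeasure (uniform_measure lborel frame_domain) (frame_rotation -` S)"
    unfolding haar_def using assms
    by (subst emeasure_distr[OF frame_rotation_measurable_stabilizer]) (simp_all add: sets_haar)
  ultimately show ?thesis by simp
qed

lemma stabilizer_mult_measurable:
  assumes "k \<in> stabilizer"
  shows "(**) k \<in> haar \<rightarrow>\<^sub>M haar"
proof -
  have "continuous_on UNIV ((**) k)" by (intro continuous_intros)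
  then have "(**) k \<in> borel_measurable borel" by (rule borel_measurable_continuous_onI)
  then have "(**) k \<in> restrict_space borel stabilizer \<rightarrow>\<^sub>M restrict_space borel stabilizer"
    by (intro measurable_restrict_space3) (auto simp: stabilizer_mult[OF assms])
  then show ?thesis by (simp cong: measurable_cong_sets add: sets_haar)
qed

text \<open>A rotation preserves \<open>frame_domain\<close> and commutes there with
  \<open>frame_rotation\<close>, so the claim reduces to the invariance of Lebesgue measure on
  matrices under left multiplication.\<close>

lemma emeasure_haar_invariant:
  fixes S :: "(real ^ ('n::finite) option ^ 'n option) set"
  assumes k: "k \<in> stabilizer" and S: "S \<in> sets haar"
  shows "emeasure haar ((**) k -` S \<inter> stabilizer) = emeasure haar S"
proof -
  have S': "(**) k -` S \<inter> stabilizer \<in> sets haar"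
    using measurable_sets[OF stabilizer_mult_measurable[OF k] S] by (simp add: space_haar)
  have Sb: "S \<in> sets borel" using S by (auto simp: sets_haar sets_restrict_space)
  have "frame_domain \<inter> frame_rotation -` ((**) k -` S \<inter> stabilizer) = (**) k -` (frame_domain \<inter> frame_rotation -` S)"
    by (auto simp: frame_domain_stabilizer[OF k] frame_rotation_stabilizer)
      (auto simp: frame_rotation_equivariant[OF k] frame_domain_def)
  moreover have "emeasure lborel ((**) k -` (frame_domain \<inter> frame_rotation -` S)) = emeasure lborel (frame_domain \<inter> frame_rotation -` S)"
  proof -
    have "continuous_on UNIV ((**) k :: real ^ 'n option ^ 'n option \<Rightarrow> _)" by (intro continuous_intros)
    then have km: "((**) k :: real ^ 'n option ^ 'n option \<Rightarrow> _) \<in> borel_measurable borel" by (rule borel_measurable_continuous_onI)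
    have "frame_domain \<inter> frame_rotation -` S \<in> sets borel"
      using measurable_sets_borel[OF measurable_frame_rotation Sb] by (intro sets.Int) (auto simp: open_frame_domain)
    then have "emeasure (distr lborel borel ((**) k)) (frame_domain \<inter> frame_rotation -` S)
       = emeasure lborel ((**) k -` (frame_domain \<inter> frame_rotation -` S))"
      using km by (subst emeasure_distr) auto
    then show ?thesis unfolding distr_lborel_stabilizer[OF k] by simp
  qed
  ultimately show ?thesis unfolding emeasure_haar[OF S] emeasure_haar[OF S'] by simp
qed

text \<open>One independent copy for each entry. The infinite product matches cochains on infinite
  sequences: deleting an entry becomes a reindexing that preserves the measure.\<close>

definition haar_seq :: "(nat \<Rightarrow> real ^ ('n::finite) option ^ 'n option) measure" where
  "haar_seq = PiM UNIV (\<lambda>_. haar)"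

definition stabilizer_seq :: "(nat \<Rightarrow> real ^ ('n::finite) option ^ 'n option) set" where
  "stabilizer_seq = {\<omega>. \<forall>i. \<omega> i \<in> stabilizer}"

lemma space_haar_seq: "space haar_seq = stabilizer_seq"
  by (auto simp: haar_seq_def stabilizer_seq_def space_PiM space_haar PiE_UNIV_domain)

interpretation haar_product: product_prob_space "\<lambda>_ :: nat. haar" UNIV
  by (simp add: product_prob_space_def product_prob_space_axioms_def product_sigma_finite_def
      prob_space_haar prob_space_imp_sigma_finite)

lemma prob_space_haar_seq: "prob_space haar_seq"
  unfolding haar_seq_def by (intro prob_space_PiM prob_space_haar)

lemma compact_stabilizer_seq: "compact stabilizer_seq"
proof -
  have "compactin (product_topology (\<lambda>_. euclidean) UNIV) (PiE UNIV (\<lambda>i::nat. stabilizer))"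
    using compact_stabilizer by (subst compactin_PiE) auto
  then show ?thesis
    unfolding euclidean_product_topology stabilizer_seq_def by (simp add: PiE_UNIV_domain Pi_def)
qed

lemma haar_seq_measurable:
  assumes "continuous_on stabilizer_seq (f :: _ \<Rightarrow> real)"
  shows "f \<in> borel_measurable haar_seq"
proof -
  have "(\<lambda>\<omega>. \<omega>) \<in> haar_seq \<rightarrow>\<^sub>M restrict_space borel stabilizer_seq"
  proof (rule measurable_restrict_space2)
    show "(\<lambda>\<omega>. \<omega>) \<in> borel_measurable haar_seq"
    proof (rule measurable_coordinatewise_then_product)
      fix i
      have "(\<lambda>\<omega>. \<omega> i) \<in> haar_seq \<rightarrow>\<^sub>M haar" unfolding haar_seq_def by measurable
      moreover have "(\<lambda>x. x) \<in> haar \<rightarrow>\<^sub>M borel"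
        unfolding haar_def by (simp add: measurable_restrict_space1)
      ultimately show "(\<lambda>\<omega>. \<omega> i) \<in> borel_measurable haar_seq" by (rule measurable_compose)
    qed
  qed (simp add: space_haar_seq)
  then show ?thesis
    by (rule measurable_compose[OF _ borel_measurable_continuous_on_restrict[OF assms]])
qed

text \<open>The product measure is determined by its values on finite cylinders, where the shift
  acts factor by factor and each factor is invariant.\<close>

lemma haar_seq_shift:
  fixes k :: "nat \<Rightarrow> real ^ ('n::finite) option ^ 'n option"
  assumes k: "k \<in> stabilizer_seq" and f: "continuous_on stabilizer_seq (f :: _ \<Rightarrow> real)"
  shows "(\<integral>\<omega>. f (\<lambda>i. k i ** \<omega> i) \<partial>haar_seq) = (\<integral>\<omega>. f \<omega> \<partial>haar_seq)"
proof -
  let ?T = "\<lambda>(\<omega> :: nat \<Rightarrow> real ^ 'n option ^ 'n option) i. k i ** \<omega> i"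
  have ki: "k i \<in> stabilizer" for i using k by (simp add: stabilizer_seq_def)
  have T: "?T \<in> haar_seq \<rightarrow>\<^sub>M haar_seq"
    unfolding haar_seq_def
  proof (rule measurable_PiM_single')
    show "(\<lambda>\<omega>. k i ** \<omega> i) \<in> (\<Pi>\<^sub>M i\<in>UNIV. haar) \<rightarrow>\<^sub>M haar" for i
      by (rule measurable_compose[OF _ stabilizer_mult_measurable[OF ki]]) (simp add: measurable_component_singleton)
  qed (auto simp: space_PiM space_haar stabilizer_mult ki PiE_iff)
  have "distr haar_seq haar_seq ?T = haar_seq"
    unfolding haar_seq_def
  proof (rule haar_product.PiM_eq)
    fix J :: "nat set" and F
    assume J: "finite J" "J \<subseteq> UNIV" and F: "\<And>j. j \<in> J \<Longrightarrow> F j \<in> sets (haar :: (real ^ 'n option ^ 'n option) measure)"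
    let ?E = "prod_emb UNIV (\<lambda>_. haar) J (Pi\<^sub>E J F)"
    have "?T -` ?E \<inter> space haar_seq = prod_emb UNIV (\<lambda>_. haar) J (\<Pi>\<^sub>E j\<in>J. (**) (k j) -` F j \<inter> stabilizer)"
      by (auto simp: prod_emb_def space_haar_seq stabilizer_seq_def space_PiM space_haar PiE_iff stabilizer_mult ki)
    moreover have "emeasure (distr (PiM UNIV (\<lambda>_. haar)) (PiM UNIV (\<lambda>_. haar)) ?T) ?E
        = emeasure (PiM UNIV (\<lambda>_. haar)) (?T -` ?E \<inter> space haar_seq)"
      using T J F unfolding haar_seq_def by (intro emeasure_distr sets_PiM_I) auto
    moreover have "(**) (k j) -` F j \<inter> stabilizer \<in> sets haar" if "j \<in> J" for j
      using measurable_sets[OF stabilizer_mult_measurable[OF ki] F[OF that], of j] by (simp add: space_haar)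
    ultimately show "emeasure (distr (PiM UNIV (\<lambda>_. haar)) (PiM UNIV (\<lambda>_. haar)) ?T) ?E = (\<Prod>j\<in>J. emeasure haar (F j))"
      using J F by (simp add: haar_product.emeasure_PiM_emb emeasure_haar_invariant[OF ki])
  qed simp
  then have "(\<integral>\<omega>. f \<omega> \<partial>haar_seq) = (\<integral>\<omega>. f \<omega> \<partial>(distr haar_seq haar_seq ?T))" by simp
  also have "\<dots> = (\<integral>\<omega>. f (\<lambda>i. k i ** \<omega> i) \<partial>haar_seq)"
    by (rule integral_distr[OF T haar_seq_measurable[OF f]])
  finally show ?thesis ..
qed

text \<open>Distinct coordinates of an independent sequence form a sequence with the same law. For
  \<open>skip j\<close> this makes averaging commute with faces.\<close>

lemma haar_seq_reindex:
  fixes f :: "(nat \<Rightarrow> real ^ ('n::finite) option ^ 'n option) \<Rightarrow> real"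
  assumes s: "inj s" and f: "continuous_on stabilizer_seq f"
  shows "(\<integral>\<omega>. f (\<omega> \<circ> s) \<partial>haar_seq) = (\<integral>\<omega>. f \<omega> \<partial>haar_seq)"
proof -
  have T: "(\<lambda>\<omega> :: nat \<Rightarrow> real ^ 'n option ^ 'n option. \<omega> \<circ> s) \<in> haar_seq \<rightarrow>\<^sub>M haar_seq"
    unfolding haar_seq_def
    by (rule measurable_PiM_single') (auto simp: space_PiM PiE_iff intro!: measurable_component_singleton)
  have "distr haar_seq haar_seq (\<lambda>\<omega> :: nat \<Rightarrow> real ^ 'n option ^ 'n option. \<omega> \<circ> s) = haar_seq"
    using distr_PiM_reindex[of UNIV "\<lambda>_. haar" s UNIV] s prob_space_haar
    by (simp add: haar_seq_def comp_def restrict_UNIV)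
  then have "(\<integral>\<omega>. f \<omega> \<partial>haar_seq) = (\<integral>\<omega>. f \<omega> \<partial>(distr haar_seq haar_seq (\<lambda>\<omega> :: nat \<Rightarrow> real ^ 'n option ^ 'n option. \<omega> \<circ> s)))" by simp
  also have "\<dots> = (\<integral>\<omega>. f (\<omega> \<circ> s) \<partial>haar_seq)"
    by (rule integral_distr[OF T haar_seq_measurable[OF f]])
  finally show ?thesis ..
qed

lemma haar_seq_bounded_integrable:
  fixes f :: "(nat \<Rightarrow> real ^ ('n::finite) option ^ 'n option) \<Rightarrow> real"
  assumes f: "continuous_on stabilizer_seq f"
  shows "integrable haar_seq f"
proof -
  interpret prob_space "haar_seq :: (nat \<Rightarrow> real ^ 'n option ^ 'n option) measure" by (rule prob_space_haar_seq)
  have "bounded (f ` stabilizer_seq)"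
    by (intro compact_imp_bounded compact_continuous_image f compact_stabilizer_seq)
  then obtain B where "\<And>\<omega>. \<omega> \<in> stabilizer_seq \<Longrightarrow> \<bar>f \<omega>\<bar> \<le> B" unfolding bounded_iff by auto
  then show ?thesis
    by (intro integrable_const_bound[of _ B] haar_seq_measurable f AE_I2) (simp add: space_haar_seq)
qed

lemma haar_seq_integral_bound:
  fixes f :: "(nat \<Rightarrow> real ^ ('n::finite) option ^ 'n option) \<Rightarrow> real"
  assumes f: "continuous_on stabilizer_seq f" and B: "\<And>\<omega>. \<omega> \<in> stabilizer_seq \<Longrightarrow> \<bar>f \<omega>\<bar> \<le> B"
  shows "\<bar>\<integral>\<omega>. f \<omega> \<partial>haar_seq\<bar> \<le> B"
proof -
  interpret prob_space "haar_seq :: (nat \<Rightarrow> real ^ 'n option ^ 'n option) measure" by (rule prob_space_haar_seq)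
  have "\<bar>\<integral>\<omega>. f \<omega> \<partial>haar_seq\<bar> \<le> (\<integral>\<omega>. \<bar>f \<omega>\<bar> \<partial>haar_seq)" by (rule integral_abs_bound)
  also have "\<dots> \<le> (\<integral>\<omega>. B \<partial>(haar_seq :: (nat \<Rightarrow> real ^ 'n option ^ 'n option) measure))"
    by (intro integral_mono integrable_abs haar_seq_bounded_integrable f) (auto simp: space_haar_seq B)
  also have "\<dots> = B" by (simp add: prob_space)
  finally show ?thesis .
qed

text \<open>A convergent sequence of parameters together with its limit is compact, and so is
  \<open>stabilizer_seq\<close>; this yields one dominating constant for dominated
  convergence.\<close>

lemma haar_seq_integral_continuous:
  fixes f :: "'s::metric_space \<Rightarrow> (nat \<Rightarrow> real ^ ('n::finite) option ^ 'n option) \<Rightarrow> real"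
  assumes f: "continuous_on (S \<times> stabilizer_seq) (\<lambda>(s, \<omega>). f s \<omega>)"
  shows "continuous_on S (\<lambda>s. \<integral>\<omega>. f s \<omega> \<partial>haar_seq)"
proof (rule continuous_on_sequentiallyI)
  fix u :: "nat \<Rightarrow> 's" and a assume u: "\<forall>m. u m \<in> S" "a \<in> S" "u \<longlonglongrightarrow> a"
  interpret prob_space "haar_seq :: (nat \<Rightarrow> real ^ 'n option ^ 'n option) measure" by (rule prob_space_haar_seq)
  let ?C = "insert a (range u)"
  have C: "compact ?C" using compactin_sequence_with_limit[of euclidean u a "range u"] u(3) by simp
  have CS: "?C \<subseteq> S" using u by auto
  have "continuous_on (?C \<times> stabilizer_seq) (\<lambda>(s, \<omega>). f s \<omega>)"
    by (rule continuous_on_subset[OF f]) (use CS in auto)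
  then have "compact ((\<lambda>(s, \<omega>). f s \<omega>) ` (?C \<times> stabilizer_seq))"
    by (rule compact_continuous_image) (rule compact_Times[OF C compact_stabilizer_seq])
  then have "bounded ((\<lambda>(s, \<omega>). f s \<omega>) ` (?C \<times> stabilizer_seq))" by (rule compact_imp_bounded)
  then obtain B where B0: "\<forall>y\<in>(\<lambda>(s, \<omega>). f s \<omega>) ` (?C \<times> stabilizer_seq). norm y \<le> B"
    unfolding bounded_iff by (elim exE)
  have B: "\<bar>f s \<omega>\<bar> \<le> B" if "s \<in> ?C" "\<omega> \<in> stabilizer_seq" for s \<omega>
  proof -
    have "(\<lambda>(s, \<omega>). f s \<omega>) (s, \<omega>) \<in> (\<lambda>(s, \<omega>). f s \<omega>) ` (?C \<times> stabilizer_seq)"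
      by (rule imageI) (use that in simp)
    from bspec[OF B0 this] show ?thesis by simp
  qed
  have fs: "continuous_on stabilizer_seq (f s)" if "s \<in> S" for s
  proof -
    have "continuous_on stabilizer_seq (\<lambda>\<omega>. (\<lambda>(s, \<omega>). f s \<omega>) (s, \<omega>))"
      by (rule continuous_on_compose2[OF f continuous_on_Pair[OF continuous_on_const continuous_on_id]]) (use that in auto)
    then show ?thesis by simp
  qed
  show "(\<lambda>m. \<integral>\<omega>. f (u m) \<omega> \<partial>haar_seq) \<longlonglongrightarrow> (\<integral>\<omega>. f a \<omega> \<partial>haar_seq)"
  proof (rule integral_dominated_convergence[where w = "\<lambda>_. B"])
    show "AE \<omega> in haar_seq. (\<lambda>m. f (u m) \<omega>) \<longlonglongrightarrow> f a \<omega>"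
    proof (rule AE_I2)
      fix \<omega> :: "nat \<Rightarrow> real ^ 'n option ^ 'n option" assume "\<omega> \<in> space haar_seq"
      then have w: "\<omega> \<in> stabilizer_seq" by (simp add: space_haar_seq)
      have "continuous_on S (\<lambda>s. (\<lambda>(s, \<omega>). f s \<omega>) (s, \<omega>))"
        by (rule continuous_on_compose2[OF f continuous_on_Pair[OF continuous_on_id continuous_on_const]]) (use w in auto)
      then have "continuous_on S (\<lambda>s. f s \<omega>)" by simp
      then show "(\<lambda>m. f (u m) \<omega>) \<longlonglongrightarrow> f a \<omega>"
        using u unfolding continuous_on_sequentially by (auto simp: comp_def)
    qed
    show "AE \<omega> in haar_seq. norm (f (u m) \<omega>) \<le> B" for m
      by (intro AE_I2) (simp add: space_haar_seq B)
  qed (use u haar_seq_measurable[OF fs] in auto)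
qed

section \<open>Cochains on sequences of Lorentz matrices\<close>

definition lorentz_seq :: "(nat \<Rightarrow> real ^ ('n::finite) option ^ 'n option) set" where
  "lorentz_seq = {g. \<forall>i. g i \<in> lorentz}"

lemma lorentz_seqD: "g \<in> lorentz_seq \<Longrightarrow> g i \<in> lorentz"
  by (simp add: lorentz_seq_def)

lemma lorentz_seq_skip: "g \<in> lorentz_seq \<Longrightarrow> g \<circ> skip j \<in> lorentz_seq"
  by (simp add: lorentz_seq_def)

lemma lorentz_seq_stabilizer: "g \<in> lorentz_seq \<Longrightarrow> \<omega> \<in> stabilizer_seq \<Longrightarrow> (\<lambda>i. g i ** \<omega> i) \<in> lorentz_seq"
  by (simp add: lorentz_seq_def stabilizer_seq_def lorentz_mult stabilizer_lorentz)

lemma lorentz_seq_splice: "g \<in> lorentz_seq \<Longrightarrow> h \<in> lorentz_seq \<Longrightarrow> splice_at j g h \<in> lorentz_seq"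
  by (simp add: lorentz_seq_def splice_at_def)

lemma point_reflection_normalize_lorentz_seq:
  "(\<And>i. v i \<in> cone) \<Longrightarrow> (\<lambda>i. point_reflection (normalize_cone (v i))) \<in> lorentz_seq"
  by (simp add: lorentz_seq_def point_reflection_lorentz normalize_cone_hyperboloid)

lemma normalize_cone_lorentz: "A \<in> lorentz \<Longrightarrow> normalize_cone (A *v x) = A *v normalize_cone x"
  by (simp add: normalize_cone_def matrix_vector_mult_scaleR)

lemma continuous_point_reflection: "continuous_on hyperboloid point_reflection"
proof -
  have nz: "lform (x + origin) (x + origin) \<noteq> 0" if "x \<in> hyperboloid" for x :: "real ^ ('a::finite) option"
    using cone_add[OF hyperboloid_cone[OF that] hyperboloid_cone[OF origin_hyperboloid]]
    by (auto simp: cone_iff)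
  show ?thesis
    unfolding point_reflection_def matrix_def lreflect_def
    by (intro continuous_intros) (use nz in auto)
qed

lemma continuous_normalize_cone: "continuous_on cone normalize_cone"
  unfolding normalize_cone_def by (intro continuous_intros) (auto simp: cone_iff)

locale sign_character =
  fixes e :: "real ^ ('n::finite) option ^ 'n option \<Rightarrow> real"
    and a :: 'n
    and n :: nat
  assumes n_eq: "n = CARD('n)"
    and e_abs: "\<And>A. A \<in> lorentz \<Longrightarrow> \<bar>e A\<bar> = 1"
    and e_refl: "e (reflection_matrix (axis (Some a) 1)) = - 1"
    and dim_ge: "n \<ge> 2"
begin

definition mcochain :: "nat \<Rightarrow> ((nat \<Rightarrow> real ^ 'n option ^ 'n option) \<Rightarrow> real) \<Rightarrow> bool" where
  "mcochain q u \<longleftrightarrow> depends_upto q u \<and> continuous_on lorentz_seq u \<and>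
     (\<forall>A\<in>lorentz. \<forall>g\<in>lorentz_seq. u (\<lambda>i. A ** g i) = e A * u g)"

definition average :: "((nat \<Rightarrow> real ^ 'n option ^ 'n option) \<Rightarrow> real) \<Rightarrow> (nat \<Rightarrow> real ^ 'n option ^ 'n option) \<Rightarrow> real" where
  "average u g = (\<integral>\<omega>. u (\<lambda>i. g i ** \<omega> i) \<partial>haar_seq)"

definition homotopy :: "nat \<Rightarrow> ((nat \<Rightarrow> real ^ 'n option ^ 'n option) \<Rightarrow> real) \<Rightarrow> (nat \<Rightarrow> real ^ 'n option ^ 'n option) \<Rightarrow> real" where
  "homotopy p u g = (\<integral>\<omega>. prism p u g (\<lambda>i. g i ** \<omega> i) \<partial>haar_seq)"

lemma mcochainD:
  assumes "mcochain q u"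
  shows "depends_upto q u" "continuous_on lorentz_seq u"
    "\<And>A g. A \<in> lorentz \<Longrightarrow> g \<in> lorentz_seq \<Longrightarrow> u (\<lambda>i. A ** g i) = e A * u g"
proof -
  note u = assms[unfolded mcochain_def]
  show "depends_upto q u" by (rule conjunct1[OF u])
  show "continuous_on lorentz_seq u" by (rule conjunct1[OF conjunct2[OF u]])
  show "u (\<lambda>i. A ** g i) = e A * u g" if "A \<in> lorentz" "g \<in> lorentz_seq" for A g
    by (rule bspec[OF bspec[OF conjunct2[OF conjunct2[OF u]] that(1)] that(2)])
qed

lemma continuous_joint:
  fixes u :: "(nat \<Rightarrow> real ^ 'n option ^ 'n option) \<Rightarrow> real"
  assumes u: "continuous_on lorentz_seq u"
  shows "continuous_on (lorentz_seq \<times> stabilizer_seq) (\<lambda>(g, \<omega>). u (\<lambda>i. g i ** \<omega> i))"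
    and "continuous_on (lorentz_seq \<times> stabilizer_seq) (\<lambda>(g, \<omega>). prism p u g (\<lambda>i. g i ** \<omega> i))"
proof -
  let ?D = "lorentz_seq \<times> stabilizer_seq :: ((nat \<Rightarrow> real ^ 'n option ^ 'n option) \<times> (nat \<Rightarrow> real ^ 'n option ^ 'n option)) set"
  have "continuous_on ?D fst" "continuous_on ?D snd"
    by (rule continuous_on_fst[OF continuous_on_id], rule continuous_on_snd[OF continuous_on_id])
  then have c: "continuous_on ?D (\<lambda>x. fst x i)" "continuous_on ?D (\<lambda>x. snd x i)" for i
    by (simp_all only: continuous_on_product_then_coordinatewise)
  have "continuous_on ?D (\<lambda>x. u (\<lambda>i. fst x i ** snd x i))"
  proof (rule continuous_on_compose2[OF u])
    show "continuous_on ?D (\<lambda>x i. fst x i ** snd x i)"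
      by (intro continuous_on_coordinatewise_then_product continuous_on_matrix_matrix_mult c)
  qed (auto simp: lorentz_seq_stabilizer)
  then show "continuous_on ?D (\<lambda>(g, \<omega>). u (\<lambda>i. g i ** \<omega> i))" by (simp add: case_prod_beta')
  have "continuous_on ?D (\<lambda>x. u (splice_at j (fst x) (\<lambda>i. fst x i ** snd x i)))" for j
  proof (rule continuous_on_compose2[OF u])
    have "continuous_on ?D (\<lambda>x. splice_at j (fst x) (\<lambda>i. fst x i ** snd x i) i)" for i
      unfolding splice_at_def by (cases "i \<le> j") (simp_all add: c continuous_on_matrix_matrix_mult)
    then show "continuous_on ?D (\<lambda>x. splice_at j (fst x) (\<lambda>i. fst x i ** snd x i))"
      by (rule continuous_on_coordinatewise_then_product)
  qed (auto simp: lorentz_seq_stabilizer lorentz_seq_splice)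
  then have "continuous_on ?D (\<lambda>x. prism p u (fst x) (\<lambda>i. fst x i ** snd x i))"
    unfolding prism_def by (intro continuous_on_sum continuous_on_mult continuous_on_const)
  then show "continuous_on ?D (\<lambda>(g, \<omega>). prism p u g (\<lambda>i. g i ** \<omega> i))" by (simp add: case_prod_beta')
qed

lemma continuous_section:
  fixes u :: "(nat \<Rightarrow> real ^ 'n option ^ 'n option) \<Rightarrow> real"
  assumes u: "continuous_on lorentz_seq u" and g: "g \<in> lorentz_seq"
  shows "continuous_on stabilizer_seq (\<lambda>\<omega>. u (\<lambda>i. g i ** \<omega> i))"
    and "continuous_on stabilizer_seq (\<lambda>\<omega>. prism p u g (\<lambda>i. g i ** \<omega> i))"
proof -
  have "continuous_on stabilizer_seq (\<lambda>\<omega>. (\<lambda>(g, \<omega>). u (\<lambda>i. g i ** \<omega> i)) (g, \<omega>))"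
    by (rule continuous_on_compose2[OF continuous_joint(1)[OF u] continuous_on_Pair[OF continuous_on_const continuous_on_id]])
      (use g in auto)
  then show "continuous_on stabilizer_seq (\<lambda>\<omega>. u (\<lambda>i. g i ** \<omega> i))" by simp
  have "continuous_on stabilizer_seq (\<lambda>\<omega>. (\<lambda>(g, \<omega>). prism p u g (\<lambda>i. g i ** \<omega> i)) (g, \<omega>))"
    by (rule continuous_on_compose2[OF continuous_joint(2)[OF u] continuous_on_Pair[OF continuous_on_const continuous_on_id]])
      (use g in auto)
  then show "continuous_on stabilizer_seq (\<lambda>\<omega>. prism p u g (\<lambda>i. g i ** \<omega> i))" by simp
qed

lemma average_mcochain:
  assumes u: "mcochain q u"
  shows "mcochain q (average u)"
  unfolding mcochain_def
proof (intro conjI ballI)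
  note u = mcochainD[OF u]
  show "depends_upto q (average u)"
    unfolding depends_upto_def average_def
    by (intro allI impI Bochner_Integration.integral_cong refl depends_uptoD[OF u(1)]) simp
  show "continuous_on lorentz_seq (average u)"
    unfolding average_def by (rule haar_seq_integral_continuous[OF continuous_joint(1)[OF u(2)]])
  fix A :: "real ^ 'n option ^ 'n option" and g :: "nat \<Rightarrow> real ^ 'n option ^ 'n option"
  assume A: "A \<in> lorentz" and g: "g \<in> lorentz_seq"
  have "average u (\<lambda>i. A ** g i) = (\<integral>\<omega>. e A * u (\<lambda>i. g i ** \<omega> i) \<partial>haar_seq)"
    unfolding average_def
  proof (rule Bochner_Integration.integral_cong[OF refl])
    fix \<omega> :: "nat \<Rightarrow> real ^ 'n option ^ 'n option" assume "\<omega> \<in> space haar_seq"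
    then have "(\<lambda>i. g i ** \<omega> i) \<in> lorentz_seq" using g by (simp add: space_haar_seq lorentz_seq_stabilizer)
    from u(3)[OF A this] show "u (\<lambda>i. A ** g i ** \<omega> i) = e A * u (\<lambda>i. g i ** \<omega> i)"
      by (simp add: matrix_mul_assoc)
  qed
  also have "\<dots> = e A * average u g" unfolding average_def by (rule integral_mult_right_zero)
  finally show "average u (\<lambda>i. A ** g i) = e A * average u g" .
qed

lemma average_bound:
  assumes u: "mcochain q u" and B: "\<And>g. g \<in> lorentz_seq \<Longrightarrow> \<bar>u g\<bar> \<le> B" and g: "g \<in> lorentz_seq"
  shows "\<bar>average u g\<bar> \<le> B"
  unfolding average_def
  by (rule haar_seq_integral_bound[OF continuous_section(1)[OF mcochainD(2)[OF u] g]])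
    (rule B[OF lorentz_seq_stabilizer[OF g]])

lemma homotopy_mcochain:
  assumes u: "mcochain (Suc p) u"
  shows "mcochain p (homotopy p u)"
  unfolding mcochain_def
proof (intro conjI ballI)
  note u = mcochainD[OF u]
  show "depends_upto p (homotopy p u)"
    unfolding depends_upto_def homotopy_def prism_def
    by (intro allI impI Bochner_Integration.integral_cong refl sum.cong arg_cong2[of _ _ _ _ "(*)"] depends_uptoD[OF u(1)])
      (auto simp: splice_at_def)
  show "continuous_on lorentz_seq (homotopy p u)"
    unfolding homotopy_def by (rule haar_seq_integral_continuous[OF continuous_joint(2)[OF u(2)]])
  fix A :: "real ^ 'n option ^ 'n option" and g :: "nat \<Rightarrow> real ^ 'n option ^ 'n option"
  assume A: "A \<in> lorentz" and g: "g \<in> lorentz_seq"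
  have "homotopy p u (\<lambda>i. A ** g i) = (\<integral>\<omega>. e A * prism p u g (\<lambda>i. g i ** \<omega> i) \<partial>haar_seq)"
    unfolding homotopy_def
  proof (rule Bochner_Integration.integral_cong[OF refl])
    fix \<omega> :: "nat \<Rightarrow> real ^ 'n option ^ 'n option" assume "\<omega> \<in> space haar_seq"
    then have h: "(\<lambda>i. g i ** \<omega> i) \<in> lorentz_seq" using g by (simp add: space_haar_seq lorentz_seq_stabilizer)
    have "u (splice_at j (\<lambda>i. A ** g i) (\<lambda>i. A ** g i ** \<omega> i)) = e A * u (splice_at j g (\<lambda>i. g i ** \<omega> i))" for j
    proof -
      have "splice_at j (\<lambda>i. A ** g i) (\<lambda>i. A ** g i ** \<omega> i) = (\<lambda>i. A ** splice_at j g (\<lambda>i. g i ** \<omega> i) i)"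
        by (rule ext) (simp add: splice_at_def matrix_mul_assoc)
      then show ?thesis using u(3)[OF A lorentz_seq_splice[OF g h]] by simp
    qed
    then show "prism p u (\<lambda>i. A ** g i) (\<lambda>i. A ** g i ** \<omega> i) = e A * prism p u g (\<lambda>i. g i ** \<omega> i)"
      by (simp add: prism_def sum_distrib_left mult_ac)
  qed
  also have "\<dots> = e A * homotopy p u g" unfolding homotopy_def by (rule integral_mult_right_zero)
  finally show "homotopy p u (\<lambda>i. A ** g i) = e A * homotopy p u g" .
qed

lemma homotopy_bound:
  assumes u: "mcochain q u" and B: "\<And>g. g \<in> lorentz_seq \<Longrightarrow> \<bar>u g\<bar> \<le> B" and g: "g \<in> lorentz_seq"
  shows "\<bar>homotopy p u g\<bar> \<le> real (Suc p) * B"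
  unfolding homotopy_def
proof (rule haar_seq_integral_bound[OF continuous_section(2)[OF mcochainD(2)[OF u] g]])
  fix \<omega> :: "nat \<Rightarrow> real ^ 'n option ^ 'n option" assume \<omega>: "\<omega> \<in> stabilizer_seq"
  have "\<bar>prism p u g (\<lambda>i. g i ** \<omega> i)\<bar> \<le> (\<Sum>j\<le>p. \<bar>(- 1) ^ j * u (splice_at j g (\<lambda>i. g i ** \<omega> i))\<bar>)"
    unfolding prism_def by (rule sum_abs)
  also have "\<dots> \<le> (\<Sum>j\<le>p. B)"
    by (intro sum_mono) (simp add: abs_mult B lorentz_seq_splice lorentz_seq_stabilizer g \<omega>)
  finally show "\<bar>prism p u g (\<lambda>i. g i ** \<omega> i)\<bar> \<le> real (Suc p) * B" by simp
qed

lemma average_skip: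
  assumes u: "mcochain q u" and g: "g \<in> lorentz_seq"
  shows "average u (g \<circ> skip j) = (\<integral>\<omega>. u ((\<lambda>i. g i ** \<omega> i) \<circ> skip j) \<partial>haar_seq)"
  unfolding average_def
  using haar_seq_reindex[OF inj_skip continuous_section(1)[OF mcochainD(2)[OF u] lorentz_seq_skip[OF g]], of j j]
  by (simp add: comp_def)

lemma skip_integrable:
  assumes u: "mcochain q u" and g: "g \<in> lorentz_seq"
  shows "integrable haar_seq (\<lambda>\<omega>. u ((\<lambda>i. g i ** \<omega> i) \<circ> skip j))"
proof (rule haar_seq_bounded_integrable)
  have "continuous_on stabilizer_seq (\<lambda>\<omega>. \<omega> \<circ> skip j)"
    unfolding comp_def
    by (rule continuous_on_coordinatewise_then_product, rule continuous_on_product_then_coordinatewise[OF continuous_on_id])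
  moreover have "(\<lambda>\<omega>. \<omega> \<circ> skip j) ` stabilizer_seq \<subseteq> stabilizer_seq"
    by (auto simp: stabilizer_seq_def)
  ultimately have "continuous_on stabilizer_seq (\<lambda>\<omega>. u (\<lambda>i. (g \<circ> skip j) i ** (\<omega> \<circ> skip j) i))"
    by (rule continuous_on_compose2[OF continuous_section(1)[OF mcochainD(2)[OF u] lorentz_seq_skip[OF g]]])
  then show "continuous_on stabilizer_seq (\<lambda>\<omega>. u ((\<lambda>i. g i ** \<omega> i) \<circ> skip j))" by (simp add: comp_def)
qed

lemma average_cobd:
  assumes u: "mcochain q u" and g: "g \<in> lorentz_seq"
  shows "cobd q (average u) g = (\<integral>\<omega>. cobd q u (\<lambda>i. g i ** \<omega> i) \<partial>haar_seq)"
  unfolding cobd_def average_skip[OF u g]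
  by (subst Bochner_Integration.integral_sum) (auto intro!: integrable_mult_right skip_integrable[OF u g])

text \<open>Integrate \<open>prism_identity\<close> between \<open>g\<close> and its rotated copy. A
  face of the rotated copy has the law of the rotated face, so the face terms assemble into the
  coboundary of \<open>homotopy\<close>.\<close>

lemma homotopy_identity:
  assumes u: "mcochain (Suc p) u" and z: "\<And>g. g \<in> lorentz_seq \<Longrightarrow> cobd (Suc p) u g = 0" and g: "g \<in> lorentz_seq"
  shows "cobd p (homotopy p u) g = average u g - u g"
proof -
  interpret H: prob_space "haar_seq :: (nat \<Rightarrow> real ^ 'n option ^ 'n option) measure" by (rule prob_space_haar_seq)
  have h: "(\<lambda>i. g i ** \<omega> i) \<in> lorentz_seq" if "\<omega> \<in> stabilizer_seq" for \<omega>
    using g that by (rule lorentz_seq_stabilizer)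
  note cs = continuous_section(2)[OF mcochainD(2)[OF u] lorentz_seq_skip[OF g], of p]
  have hs: "homotopy p u (g \<circ> skip j) = (\<integral>\<omega>. prism p u (g \<circ> skip j) ((\<lambda>i. g i ** \<omega> i) \<circ> skip j) \<partial>haar_seq)" for j
    unfolding homotopy_def using haar_seq_reindex[OF inj_skip cs, of j j] by (simp add: comp_def)
  have int: "integrable haar_seq (\<lambda>\<omega>. prism p u (g \<circ> skip j) ((\<lambda>i. g i ** \<omega> i) \<circ> skip j))" for j
  proof (rule haar_seq_bounded_integrable)
    have "continuous_on stabilizer_seq (\<lambda>\<omega>. \<omega> \<circ> skip j)"
      unfolding comp_def
      by (rule continuous_on_coordinatewise_then_product, rule continuous_on_product_then_coordinatewise[OF continuous_on_id])
    moreover have "(\<lambda>\<omega>. \<omega> \<circ> skip j) ` stabilizer_seq \<subseteq> stabilizer_seq" by (auto simp: stabilizer_seq_def)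
    ultimately have "continuous_on stabilizer_seq (\<lambda>\<omega>. prism p u (g \<circ> skip j) (\<lambda>i. (g \<circ> skip j) i ** (\<omega> \<circ> skip j) i))"
      by (rule continuous_on_compose2[OF cs])
    then show "continuous_on stabilizer_seq (\<lambda>\<omega>. prism p u (g \<circ> skip j) ((\<lambda>i. g i ** \<omega> i) \<circ> skip j))"
      by (simp add: comp_def)
  qed
  have "cobd p (homotopy p u) g
      = (\<integral>\<omega>. (\<Sum>j\<le>Suc p. (- 1) ^ j * prism p u (g \<circ> skip j) ((\<lambda>i. g i ** \<omega> i) \<circ> skip j)) \<partial>haar_seq)"
    unfolding cobd_def hs
    by (subst Bochner_Integration.integral_sum) (auto intro!: integrable_mult_right int)
  also have "\<dots> = (\<integral>\<omega>. u (\<lambda>i. g i ** \<omega> i) - u g \<partial>haar_seq)"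
  proof (rule Bochner_Integration.integral_cong[OF refl])
    fix \<omega> :: "nat \<Rightarrow> real ^ 'n option ^ 'n option" assume "\<omega> \<in> space haar_seq"
    then have "(\<lambda>i. g i ** \<omega> i) \<in> lorentz_seq" by (simp add: space_haar_seq h)
    then show "(\<Sum>j\<le>Suc p. (- 1) ^ j * prism p u (g \<circ> skip j) ((\<lambda>i. g i ** \<omega> i) \<circ> skip j)) = u (\<lambda>i. g i ** \<omega> i) - u g"
      by (intro prism_identity mcochainD(1)[OF u] z lorentz_seq_splice g)
  qed
  also have "\<dots> = average u g - u g"
    unfolding average_def
    by (subst Bochner_Integration.integral_diff)
      (auto intro!: haar_seq_bounded_integrable continuous_section(1)[OF mcochainD(2)[OF u] g] simp: H.prob_space)
  finally show ?thesis .
qed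

lemma average_stabilizer:
  assumes u: "mcochain q u" and g: "g \<in> lorentz_seq" and k: "k \<in> stabilizer_seq"
  shows "average u (\<lambda>i. g i ** k i) = average u g"
  unfolding average_def
  using haar_seq_shift[OF k continuous_section(1)[OF mcochainD(2)[OF u] g]] by (simp add: matrix_mul_assoc)

section \<open>Averages as functions of points of hyperbolic space\<close>

definition descend :: "((nat \<Rightarrow> real ^ 'n option ^ 'n option) \<Rightarrow> real) \<Rightarrow> (nat \<Rightarrow> real ^ 'n option) \<Rightarrow> real" where
  "descend u v = average u (\<lambda>i. point_reflection (normalize_cone (v i)))"

text \<open>If \<open>P\<close> is the point reflection carrying the origin to
  \<open>g i *v origin\<close>, then \<open>P ** g i\<close> fixes the origin and \<open>g i\<close>
  is \<open>P ** (P ** g i)\<close>. The average does not see the second factor.\<close>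

lemma average_descend:
  assumes u: "mcochain q u" and g: "g \<in> lorentz_seq"
  shows "average u g = descend u (\<lambda>i. g i *v origin)"
proof -
  have x: "g i *v origin \<in> hyperboloid" for i
    by (rule lorentz_hyperboloid[OF lorentz_seqD[OF g] origin_hyperboloid])
  let ?P = "\<lambda>i. point_reflection (g i *v origin)"
  have P: "?P \<in> lorentz_seq" using x by (simp add: lorentz_seq_def point_reflection_lorentz)
  define k where "k i = ?P i ** g i" for i
  have "k \<in> stabilizer_seq"
    unfolding stabilizer_seq_def stabilizer_def k_def
    using x P g by (simp add: lorentz_seq_def lorentz_mult point_reflection_self flip: matrix_vector_mul_assoc)
  from average_stabilizer[OF u P this]
  have "average u (\<lambda>i. ?P i ** (?P i ** g i)) = average u ?P" by (simp only: k_def)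
  then show ?thesis
    using x by (simp add: matrix_mul_assoc point_reflection_invol descend_def normalize_cone_id)
qed

lemma descend_dep:
  assumes "mcochain q u"
  shows "depends_upto q (descend u)"
  unfolding depends_upto_def descend_def
  by (intro allI impI depends_uptoD[OF mcochainD(1)[OF average_mcochain[OF assms]]]) simp

text \<open>The reflection attached to \<open>A *v v i\<close> differs from
  \<open>A ** ?P i\<close>, but both carry the origin to the same point, which is all that the
  average sees.\<close>

lemma descend_equi:
  assumes u: "mcochain q u" and A: "A \<in> lorentz" and v: "\<And>i. v i \<in> cone"
  shows "descend u (\<lambda>i. A *v v i) = e A * descend u v"
proof -
  let ?P = "\<lambda>i. point_reflection (normalize_cone (v i))"
  note P = point_reflection_normalize_lorentz_seq[of v, OF v]
  have AP: "(\<lambda>i. A ** ?P i) \<in> lorentz_seq" using A P by (simp add: lorentz_seq_def lorentz_mult)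
  have "descend u (\<lambda>i. A *v v i) = descend u (\<lambda>i. (A ** ?P i) *v origin)"
    unfolding descend_def
    by (simp add: point_reflection_origin[OF normalize_cone_hyperboloid[OF v]] normalize_cone_lorentz[OF A]
        normalize_cone_id normalize_cone_hyperboloid v lorentz_hyperboloid[OF A] flip: matrix_vector_mul_assoc)
  also have "\<dots> = average u (\<lambda>i. A ** ?P i)" by (rule average_descend[OF u AP, symmetric])
  also have "\<dots> = e A * average u ?P" by (rule mcochainD(3)[OF average_mcochain[OF u] A P])
  finally show ?thesis by (simp only: descend_def)
qed

text \<open>In degree \<open>n - 1\<close> there are only \<open>n\<close> points, too few to span
  the Lorentz space.\<close>

lemma average_vanishes:
  assumes u: "mcochain p u" and p: "Suc p = n" and g: "g \<in> lorentz_seq"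
  shows "average u g = 0"
proof -
  let ?v = "\<lambda>i. g i *v origin"
  have v: "?v i \<in> cone" for i
    by (rule lorentz_cone[OF lorentz_seqD[OF g] hyperboloid_cone[OF origin_hyperboloid]])
  have "descend u ?v = 0"
  proof (rule equivariant_vanishes[where e = e and a = a and q = p, OF e_abs e_refl descend_dep[OF u] descend_equi[OF u]])
    have "dim (?v ` {..p}) \<le> card (?v ` {..p})" by (rule dim_le_card') simp
    also have "\<dots> \<le> card {..p}" by (rule card_image_le) simp
    finally show "dim (?v ` {..p}) \<le> CARD('n)" using p n_eq by simp
  qed (auto simp: v)
  then show ?thesis by (simp add: average_descend[OF u g])
qed

lemma average_cocycle:
  assumes u: "mcochain q u" and z: "\<And>g. g \<in> lorentz_seq \<Longrightarrow> cobd q u g = 0" and g: "g \<in> lorentz_seq"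
  shows "cobd q (average u) g = 0"
proof -
  have "(\<integral>\<omega>. cobd q u (\<lambda>i. g i ** \<omega> i) \<partial>haar_seq) = (\<integral>\<omega>. 0 \<partial>(haar_seq :: (nat \<Rightarrow> real ^ 'n option ^ 'n option) measure))"
    by (rule Bochner_Integration.integral_cong[OF refl]) (simp add: z lorentz_seq_stabilizer g space_haar_seq)
  then show ?thesis unfolding average_cobd[OF u g] by simp
qed

lemma average_cocycle_bounded:
  assumes u: "mcochain n u" and z: "\<And>g. g \<in> lorentz_seq \<Longrightarrow> cobd n u g = 0"
  shows "\<exists>K. \<forall>g\<in>lorentz_seq. \<bar>average u g\<bar> \<le> K"
proof -
  have z': "cobd n (average u) g = 0" if "g \<in> lorentz_seq" for g
    by (rule average_cocycle[OF u z that])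
  interpret lorentz_cocycle e a n "descend u"
  proof
    show "descend u (\<lambda>i. A *v x i) = e A * descend u x" if "A \<in> lorentz" "\<And>i. x i \<in> cone" for A x
      by (rule descend_equi[OF u that])
    show "descend u (\<lambda>i. c i *\<^sub>R x i) = descend u x" if "\<And>i. x i \<in> cone" "\<And>i. c i > 0" for c x
    proof -
      have "normalize_cone (c i *\<^sub>R x i) = normalize_cone (x i)" for i
      proof -
        have "sqrt (- lform (c i *\<^sub>R x i) (c i *\<^sub>R x i)) = c i * sqrt (- lform (x i) (x i))"
        proof -
          have "- lform (c i *\<^sub>R x i) (c i *\<^sub>R x i) = (c i)\<^sup>2 * (- lform (x i) (x i))"
            by (simp add: lform_scale_left lform_scale_right power2_eq_square)
          then show ?thesis using that(2)[of i] by (simp only: real_sqrt_mult real_sqrt_abs)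
        qed
        then show ?thesis using that(2)[of i] by (simp add: normalize_cone_def)
      qed
      then show ?thesis by (simp add: descend_def)
    qed
    show "cobd n (descend u) x = 0" if "\<And>i. x i \<in> cone" for x
    proof -
      have "cobd n (descend u) x = cobd n (average u) (\<lambda>i. point_reflection (normalize_cone (x i)))"
        by (simp add: cobd_def descend_def comp_def)
      then show ?thesis using z'[OF point_reflection_normalize_lorentz_seq[of x, OF that]] by simp
    qed
    show "continuous_on {x. \<forall>i. x i \<in> cone} (descend u)"
      unfolding descend_def
    proof (rule continuous_on_compose2[OF mcochainD(2)[OF average_mcochain[OF u]]])
      have "continuous_on {x :: nat \<Rightarrow> real ^ 'n option. \<forall>i. x i \<in> cone} (\<lambda>x. point_reflection (normalize_cone (x i)))" for i :: nat
      proof (rule continuous_on_compose2[OF continuous_point_reflection])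
        show "continuous_on {x :: nat \<Rightarrow> real ^ 'n option. \<forall>i. x i \<in> cone} (\<lambda>x. normalize_cone (x i))"
          by (rule continuous_on_compose2[OF continuous_normalize_cone
                continuous_on_product_then_coordinatewise[OF continuous_on_id]]) auto
      qed (auto simp: normalize_cone_hyperboloid)
      then show "continuous_on {x :: nat \<Rightarrow> real ^ 'n option. \<forall>i. x i \<in> cone} (\<lambda>x i. point_reflection (normalize_cone (x i)))"
        by (rule continuous_on_coordinatewise_then_product)
    qed (auto intro!: point_reflection_normalize_lorentz_seq)
  qed (use n_eq e_abs e_refl dim_ge descend_dep[OF u] in auto)
  obtain K where "\<forall>x. (\<forall>i. x i \<in> cone) \<longrightarrow> \<bar>descend u x\<bar> \<le> K" using bounded_cocycle by (elim exE)
  note K = this[rule_format]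
  have "\<bar>average u g\<bar> \<le> K" if g: "g \<in> lorentz_seq" for g
    unfolding average_descend[OF u g]
    by (rule K, rule lorentz_cone[OF lorentz_seqD[OF g] hyperboloid_cone[OF origin_hyperboloid]])
  then show ?thesis by (intro exI[of _ K] ballI)
qed

end

section \<open>Isometries of the Klein ball as Lorentz matrices\<close>

definition lift_point :: "real ^ ('n::finite) \<Rightarrow> real ^ 'n option" where
  "lift_point p = (\<chi> i. case i of None \<Rightarrow> 1 | Some b \<Rightarrow> p $ b)"

definition klein :: "real ^ ('n::finite) \<Rightarrow> real ^ 'n option" where
  "klein p = normalize_cone (lift_point p)"

definition unklein :: "real ^ ('n::finite) option \<Rightarrow> real ^ 'n" where
  "unklein x = (\<chi> b. x $ Some b / x $ None)"

lemma inner_option: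
  fixes x y :: "real ^ ('n::finite) option"
  shows "x \<bullet> y = x $ None * y $ None + (\<Sum>b\<in>UNIV. x $ Some b * y $ Some b)"
  by (simp add: inner_vec_def UNIV_option_conv sum.reindex)

lemma lift_point_None [simp]: "lift_point p $ None = 1"
  and lift_point_Some [simp]: "lift_point p $ Some b = p $ b"
  by (simp_all add: lift_point_def)

lemma lform_lift_point: "lform (lift_point p) (lift_point q) = p \<bullet> q - 1"
  by (simp add: lform_def inner_option inner_vec_def[of p q])

lemma hyp_space_iff: "p \<in> hyp_space \<longleftrightarrow> p \<bullet> p < 1"
  by (simp add: hyp_space_def norm_eq_sqrt_inner)

lemma lift_point_cone: "lift_point p \<in> cone \<longleftrightarrow> p \<in> hyp_space"
  by (simp add: cone_iff lform_lift_point hyp_space_iff)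

lemma klein_hyperboloid: "p \<in> hyp_space \<Longrightarrow> klein p \<in> hyperboloid"
  unfolding klein_def by (rule normalize_cone_hyperboloid) (simp add: lift_point_cone)

lemma unklein_scale: "c \<noteq> 0 \<Longrightarrow> unklein (c *\<^sub>R x) = unklein x"
  by (simp add: unklein_def)

lemma unklein_klein:
  assumes "p \<in> hyp_space"
  shows "unklein (klein p) = p"
proof -
  have "1 / sqrt (- lform (lift_point p) (lift_point p)) \<noteq> 0"
    using assms by (simp add: lform_lift_point hyp_space_iff)
  then have "unklein (klein p) = unklein (lift_point p)"
    unfolding klein_def normalize_cone_def by (rule unklein_scale)
  then show ?thesis by (simp add: unklein_def vec_eq_iff)
qed

lemma lift_point_unklein:
  assumes "x \<in> cone"
  shows "lift_point (unklein x) = (1 / x $ None) *\<^sub>R x"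
proof -
  have "lift_point (unklein x) $ i = ((1 / x $ None) *\<^sub>R x) $ i" for i
    using cone_None_pos[OF assms] by (cases i) (simp_all add: unklein_def)
  then show ?thesis by (simp add: vec_eq_iff)
qed

lemma unklein_hyp_space:
  assumes "x \<in> cone"
  shows "unklein x \<in> hyp_space"
proof -
  have "lift_point (unklein x) \<in> cone"
    unfolding lift_point_unklein[OF assms] using cone_None_pos[OF assms] by (intro cone_scale assms) simp
  then show ?thesis by (simp only: lift_point_cone)
qed

lemma klein_unklein:
  assumes "x \<in> hyperboloid"
  shows "klein (unklein x) = x"
proof -
  have pos: "x $ None > 0" and Q: "lform x x = - 1" using assms by (auto simp: hyperboloid_iff)
  have "sqrt (- lform ((1 / x $ None) *\<^sub>R x) ((1 / x $ None) *\<^sub>R x)) = 1 / x $ None"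
  proof -
    have "- lform ((1 / x $ None) *\<^sub>R x) ((1 / x $ None) *\<^sub>R x) = (1 / x $ None)\<^sup>2"
      unfolding lform_scale_left lform_scale_right Q by (simp add: power2_eq_square)
    then show ?thesis using pos by (simp only: real_sqrt_abs) simp
  qed
  then show ?thesis
    unfolding klein_def lift_point_unklein[OF hyperboloid_cone[OF assms]] normalize_cone_def using pos by simp
qed

lemma hyp_dist_klein: "hyp_dist p q = arcosh (- lform (klein p) (klein q))"
  by (simp add: hyp_dist_def klein_def normalize_cone_lform lform_lift_point diff_divide_distrib)

lemma hyp_dist_eq_iff:
  assumes "p \<in> hyp_space" "q \<in> hyp_space" "p' \<in> hyp_space" "q' \<in> hyp_space"
  shows "hyp_dist p q = hyp_dist p' q' \<longleftrightarrow> lform (klein p) (klein q) = lform (klein p') (klein q')"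
proof
  assume "hyp_dist p q = hyp_dist p' q'"
  then have "cosh (arcosh (- lform (klein p) (klein q))) = cosh (arcosh (- lform (klein p') (klein q')))"
    by (simp add: hyp_dist_klein)
  moreover have "1 \<le> - lform (klein p) (klein q)" "1 \<le> - lform (klein p') (klein q')"
    using reverse_cauchy_schwarz[OF klein_hyperboloid klein_hyperboloid] assms by force+
  ultimately show "lform (klein p) (klein q) = lform (klein p') (klein q')" by simp
qed (simp add: hyp_dist_klein)

text \<open>The half axis point goes to \<open>(1 / sqrt 3) *\<^sub>R (axis (Some b) 1 + 2 *\<^sub>R
  origin)\<close> on the hyperboloid, which explains the coefficients: for \<open>K = klein\<close>
  they return the standard basis. For \<open>K = klein \<circ> g\<close> they return the columns of
  the matrix of \<open>g\<close>.\<close>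

definition basis_comb :: "(real ^ ('n::finite) \<Rightarrow> real ^ 'n option) \<Rightarrow> 'n option \<Rightarrow> real ^ 'n option" where
  "basis_comb K i = (case i of None \<Rightarrow> K 0 | Some b \<Rightarrow> sqrt 3 *\<^sub>R K ((1 / 2) *\<^sub>R axis b 1) - 2 *\<^sub>R K 0)"

lemma zero_hyp_space: "0 \<in> hyp_space" and half_axis_hyp_space: "(1 / 2) *\<^sub>R axis b 1 \<in> hyp_space"
  by (simp_all add: hyp_space_iff inner_axis_axis)

text \<open>The points \<open>0\<close> and \<open>axis b (1 / 2)\<close> of the ball lift to a basis of the Lorentz space.\<close>

lemma basis_comb_klein:
  fixes i :: "('n::finite) option"
  shows "basis_comb klein i = axis i 1"
proof -
  have "lift_point (0 :: real ^ 'n) = origin" by (simp add: vec_eq_iff lift_point_def axis_def split: option.split)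
  moreover have "lform (lift_point (0 :: real ^ 'n)) (lift_point 0) = - 1" by (simp add: lform_lift_point)
  ultimately have 0: "klein (0 :: real ^ 'n) = origin" by (simp add: klein_def normalize_cone_def)
  show ?thesis
  proof (cases i)
    case None
    then show ?thesis by (simp add: basis_comb_def 0)
  next
    case (Some b)
    have l: "lift_point ((1 / 2) *\<^sub>R axis b 1) = (1 / 2) *\<^sub>R axis (Some b) 1 + origin"
      by (simp add: vec_eq_iff lift_point_def axis_def split: option.split)
    have q: "- lform (lift_point ((1 / 2) *\<^sub>R axis b 1)) (lift_point ((1 / 2) *\<^sub>R axis b 1)) = 3 / 4"
      by (simp add: lform_lift_point inner_axis_axis)
    have "sqrt 3 * (1 / sqrt (3 / 4)) = (2 :: real)" by (simp add: real_sqrt_divide)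
    then have "sqrt 3 *\<^sub>R klein ((1 / 2) *\<^sub>R axis b 1) = 2 *\<^sub>R lift_point ((1 / 2) *\<^sub>R axis b 1)"
      unfolding klein_def normalize_cone_def q scaleR_scaleR by (rule arg_cong)
    then show ?thesis by (simp add: Some basis_comb_def 0 l scaleR_add_right)
  qed
qed

lemma lform_basis_comb:
  assumes "\<And>p q. p \<in> hyp_space \<Longrightarrow> q \<in> hyp_space \<Longrightarrow> lform (K p) (K q) = lform (K' p) (K' q)"
  shows "lform (basis_comb K i) (basis_comb K j) = lform (basis_comb K' i) (basis_comb K' j)"
    and "p \<in> hyp_space \<Longrightarrow> lform (K p) (basis_comb K j) = lform (K' p) (basis_comb K' j)"
proof -
  have K: "lform (K 0) (K 0) = lform (K' 0) (K' 0)"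
    "lform (K 0) (K ((1 / 2) *\<^sub>R axis b 1)) = lform (K' 0) (K' ((1 / 2) *\<^sub>R axis b 1))"
    "lform (K ((1 / 2) *\<^sub>R axis b 1)) (K 0) = lform (K' ((1 / 2) *\<^sub>R axis b 1)) (K' 0)"
    "lform (K ((1 / 2) *\<^sub>R axis b 1)) (K ((1 / 2) *\<^sub>R axis c 1))
      = lform (K' ((1 / 2) *\<^sub>R axis b 1)) (K' ((1 / 2) *\<^sub>R axis c 1))" for b c
    by (intro assms zero_hyp_space half_axis_hyp_space)+
  show "lform (basis_comb K i) (basis_comb K j) = lform (basis_comb K' i) (basis_comb K' j)"
    by (cases i; cases j) (simp_all only: basis_comb_def option.case lform_simps K)
  assume p: "p \<in> hyp_space"
  have Kp: "lform (K p) (K 0) = lform (K' p) (K' 0)"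
    "lform (K p) (K ((1 / 2) *\<^sub>R axis b 1)) = lform (K' p) (K' ((1 / 2) *\<^sub>R axis b 1))" for b
    by (intro assms p zero_hyp_space half_axis_hyp_space)+
  show "lform (K p) (basis_comb K j) = lform (K' p) (basis_comb K' j)"
    by (cases j) (simp_all only: basis_comb_def option.case lform_simps Kp)
qed

definition isom_matrix :: "(real ^ ('n::finite) \<Rightarrow> real ^ 'n) \<Rightarrow> real ^ 'n option ^ 'n option" where
  "isom_matrix g = (\<chi> r c. basis_comb (klein \<circ> g) c $ r)"

definition matrix_isom :: "real ^ ('n::finite) option ^ 'n option \<Rightarrow> real ^ 'n \<Rightarrow> real ^ 'n" where
  "matrix_isom A = (\<lambda>p\<in>hyp_space. unklein (A *v klein p))"

lemma isom_matrix_axis: "isom_matrix g *v axis i 1 = basis_comb (klein \<circ> g) i"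
  by (simp add: matrix_vector_mult_basis column_def isom_matrix_def vec_eq_iff)

lemma matrix_vector_expand:
  fixes A :: "real ^ 'm ^ 'k"
  shows "A *v x = (\<Sum>i\<in>UNIV. x $ i *\<^sub>R (A *v axis i 1))"
  by (simp add: vec_eq_iff matrix_vector_mult_def axis_def if_distrib[of "\<lambda>y. _ * y"] mult.commute cong: if_cong)

lemma lform_sum_left: "lform (\<Sum>i\<in>S. f i) y = (\<Sum>i\<in>S. lform (f i) y)"
  by (induction S rule: infinite_finite_induct) (simp_all add: lform_simps)

lemma lform_sum_right: "lform y (\<Sum>i\<in>S. f i) = (\<Sum>i\<in>S. lform y (f i))"
  by (induction S rule: infinite_finite_induct) (simp_all add: lform_simps)

lemma lform_preserved:
  assumes "\<And>i j. lform (A *v axis i 1) (A *v axis j 1) = lform (axis i 1) (axis j 1)"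
  shows "lform (A *v x) (A *v y) = lform x y"
proof -
  have "lform (A *v x) (A *v y) = (\<Sum>j\<in>UNIV. \<Sum>i\<in>UNIV. y $ j * (x $ i * lform (axis i 1) (axis j 1)))"
    unfolding matrix_vector_expand[of A x] matrix_vector_expand[of A y]
    by (simp add: lform_sum_left lform_sum_right lform_scale_left lform_scale_right assms sum_distrib_left)
  also have "\<dots> = lform (mat 1 *v x) (mat 1 *v y)"
    unfolding matrix_vector_expand[of "mat 1" x] matrix_vector_expand[of "mat 1" y]
    by (simp add: lform_sum_left lform_sum_right lform_scale_left lform_scale_right sum_distrib_left)
  finally show ?thesis by simp
qed

lemma lform_nondegenerate:
  assumes "\<And>y. lform w y = 0"
  shows "w = 0"
proof -
  have "lform w (w - (2 * w $ None) *\<^sub>R origin) = w \<bullet> w"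
    by (simp add: lform_def inner_diff_right algebra_simps)
  with assms show ?thesis by simp
qed

lemma lorentz_surj:
  assumes "A \<in> lorentz"
  shows "surj ((*v) A)"
proof -
  have "inj ((*v) A)"
  proof (rule linear_injective_0[THEN iffD2, OF matrix_vector_mul_linear], intro allI impI)
    fix x assume "A *v x = 0"
    then have "lform x y = 0" for y using lform_lorentz[OF assms, of x y] by (simp add: lform_simps)
    then show "x = 0" by (rule lform_nondegenerate)
  qed
  then show ?thesis by (rule linear_inj_imp_surj[OF matrix_vector_mul_linear])
qed

lemma lorentz_inverse:
  assumes A: "A \<in> lorentz"
  obtains B where "B \<in> lorentz" "\<And>x. A *v (B *v x) = x" "\<And>x. B *v (A *v x) = x"
proof -
  obtain B where B: "A ** B = mat 1"
    using lorentz_surj[OF A] matrix_right_invertible_surjective by blast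
  then have B': "B ** A = mat 1" by (simp add: matrix_left_right_inverse)
  have AB: "A *v (B *v x) = x" "B *v (A *v x) = x" for x
    unfolding matrix_vector_mul_assoc B B' by simp_all
  have "B \<in> lorentz"
  proof (rule lorentzI)
    show l: "lform (B *v x) (B *v y) = lform x y" for x y
      using lform_lorentz[OF A, of "B *v x" "B *v y"] unfolding AB by simp
    have "lform (B *v origin) (B *v (A *v origin)) = lform origin (A *v origin)" by (rule l)
    then show "(B *v origin) $ None > 0" unfolding AB using lorentz_origin_None[OF A] by simp
  qed
  then show ?thesis by (rule that) (rule AB)+
qed

lemma hyp_isomD:
  assumes "g \<in> hyp_isom"
  shows "p \<in> hyp_space \<Longrightarrow> g p \<in> hyp_space" "g \<in> extensional hyp_space"
    "p \<in> hyp_space \<Longrightarrow> q \<in> hyp_space \<Longrightarrow> lform (klein (g p)) (klein (g q)) = lform (klein p) (klein q)"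
proof -
  have g: "g \<in> Bij hyp_space" and d: "\<forall>x\<in>hyp_space. \<forall>y\<in>hyp_space. hyp_dist (g x) (g y) = hyp_dist x y"
    using assms by (auto simp: hyp_isom_def)
  show gp: "g p \<in> hyp_space" if "p \<in> hyp_space" for p using Bij_imp_funcset[OF g] that by auto
  show "g \<in> extensional hyp_space" by (rule Bij_imp_extensional[OF g])
  show "lform (klein (g p)) (klein (g q)) = lform (klein p) (klein q)" if "p \<in> hyp_space" "q \<in> hyp_space"
    by (rule hyp_dist_eq_iff[OF gp[OF that(1)] gp[OF that(2)] that, THEN iffD1]) (simp add: d that)
qed

text \<open>Distances determine the products of the columns with each other, so the matrix preserves
  the form. They also determine the products of \<open>klein (g p)\<close> with the columns; these
  agree with those of the image of \<open>klein p\<close>, and the columns span.\<close>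

lemma isom_matrix_lorentz:
  assumes g: "g \<in> hyp_isom"
  shows "isom_matrix g \<in> lorentz"
    and "p \<in> hyp_space \<Longrightarrow> isom_matrix g *v klein p = klein (g p)"
proof -
  let ?A = "isom_matrix g"
  have K: "lform ((klein \<circ> g) p) ((klein \<circ> g) q) = lform (klein p) (klein q)" if "p \<in> hyp_space" "q \<in> hyp_space" for p q
    using hyp_isomD(3)[OF g that] by simp
  have b: "lform (basis_comb (klein \<circ> g) i) (basis_comb (klein \<circ> g) j) = lform (basis_comb klein i) (basis_comb klein j)"
    "p \<in> hyp_space \<Longrightarrow> lform ((klein \<circ> g) p) (basis_comb (klein \<circ> g) j) = lform (klein p) (basis_comb klein j)" for i j p
    by (rule lform_basis_comb, rule K; assumption)+
  have pres: "lform (?A *v x) (?A *v y) = lform x y" for x y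
  proof (rule lform_preserved)
    show "lform (?A *v axis i 1) (?A *v axis j 1) = lform (axis i 1) (axis j 1)" for i j
      unfolding isom_matrix_axis using b(1)[of i j] by (simp only: basis_comb_klein)
  qed
  show L: "?A \<in> lorentz"
  proof (rule lorentzI[OF pres])
    have "?A *v origin = klein (g 0)" unfolding isom_matrix_axis by (simp add: basis_comb_def)
    then show "(?A *v origin) $ None > 0"
      using klein_hyperboloid[OF hyp_isomD(1)[OF g zero_hyp_space]] by (simp add: hyperboloid_iff)
  qed
  assume p: "p \<in> hyp_space"
  have "lform (?A *v klein p - klein (g p)) (?A *v axis j 1) = 0" for j
  proof -
    have "lform (klein (g p)) (?A *v axis j 1) = lform (klein p) (axis j 1)"
      using b(2)[OF p, of j] unfolding isom_matrix_axis basis_comb_klein by simp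
    then show ?thesis unfolding lform_diff_left pres by simp
  qed
  then have "lform (?A *v klein p - klein (g p)) (?A *v y) = 0" for y
    by (subst matrix_vector_expand) (simp add: lform_sum_right lform_scale_right)
  then have z: "lform (?A *v klein p - klein (g p)) (?A *v y) = 0" for y .
  have "lform (?A *v klein p - klein (g p)) y = 0" for y
  proof -
    obtain x where x: "y = ?A *v x" using lorentz_surj[OF L] by (rule surjE)
    show ?thesis unfolding x by (rule z)
  qed
  then have "?A *v klein p - klein (g p) = 0" by (rule lform_nondegenerate)
  then show "?A *v klein p = klein (g p)" by simp
qed

lemma matrix_isom_apply:
  assumes A: "A \<in> lorentz" and p: "p \<in> hyp_space"
  shows "matrix_isom A p \<in> hyp_space" "klein (matrix_isom A p) = A *v klein p"
  using lorentz_hyperboloid[OF A klein_hyperboloid[OF p]] p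
  by (simp_all add: matrix_isom_def unklein_hyp_space hyperboloid_cone klein_unklein)

lemma matrix_isom_hyp_isom:
  assumes A: "A \<in> lorentz"
  shows "matrix_isom A \<in> hyp_isom"
proof -
  obtain B where B: "B \<in> lorentz" "\<And>x. A *v (B *v x) = x" "\<And>x. B *v (A *v x) = x"
    by (rule lorentz_inverse[OF A], rule that; assumption)
  have inv: "matrix_isom C (matrix_isom D p) = p"
    if "C \<in> lorentz" "D \<in> lorentz" "\<And>x. C *v (D *v x) = x" "p \<in> hyp_space" for C D p
    using matrix_isom_apply[OF that(2,4)] that by (simp add: matrix_isom_def[of C] unklein_klein)
  have "bij_betw (matrix_isom A) hyp_space hyp_space"
    by (rule bij_betw_byWitness[where f' = "matrix_isom B"])
      (auto simp: inv A B matrix_isom_apply(1))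
  moreover have "hyp_dist (matrix_isom A p) (matrix_isom A q) = hyp_dist p q" if "p \<in> hyp_space" "q \<in> hyp_space" for p q
    using that A by (simp add: hyp_dist_eq_iff matrix_isom_apply)
  ultimately show ?thesis by (auto simp: hyp_isom_def Bij_def matrix_isom_def)
qed

lemma isom_matrix_matrix_isom:
  assumes A: "A \<in> lorentz"
  shows "isom_matrix (matrix_isom A) = A"
proof -
  have "basis_comb (klein \<circ> matrix_isom A) i = A *v basis_comb klein i" for i
    using matrix_isom_apply(2)[OF A zero_hyp_space] matrix_isom_apply(2)[OF A half_axis_hyp_space]
    by (simp add: basis_comb_def matrix_vector_mult_diff_distrib matrix_vector_mult_scaleR split: option.split)
  then have "isom_matrix (matrix_isom A) *v axis i 1 = A *v axis i 1" for i
    unfolding isom_matrix_axis basis_comb_klein by simp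
  then have "isom_matrix (matrix_isom A) *v x = A *v x" for x
    unfolding matrix_vector_expand[of _ x] by simp
  then show ?thesis by (simp add: matrix_eq)
qed

lemma matrix_isom_isom_matrix:
  assumes g: "g \<in> hyp_isom"
  shows "matrix_isom (isom_matrix g) = g"
proof
  fix p
  show "matrix_isom (isom_matrix g) p = g p"
  proof (cases "p \<in> hyp_space")
    case True
    then show ?thesis
      using isom_matrix_lorentz(2)[OF g True] hyp_isomD(1)[OF g True] by (simp add: matrix_isom_def unklein_klein)
  qed (use hyp_isomD(2)[OF g] in \<open>simp add: matrix_isom_def extensional_def\<close>)
qed

lemma carrier_hyp_isom_group [simp]: "carrier hyp_isom_group = hyp_isom"
  by (simp add: hyp_isom_group_def)

lemma matrix_isom_mult:
  assumes "A \<in> lorentz" "B \<in> lorentz"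
  shows "matrix_isom A \<otimes>\<^bsub>hyp_isom_group\<^esub> matrix_isom B = matrix_isom (A ** B)"
proof -
  have "matrix_isom A \<in> Bij hyp_space" "matrix_isom B \<in> Bij hyp_space"
    using matrix_isom_hyp_isom assms by (auto simp: hyp_isom_def)
  then have "matrix_isom A \<otimes>\<^bsub>hyp_isom_group\<^esub> matrix_isom B = compose hyp_space (matrix_isom A) (matrix_isom B)"
    by (simp add: hyp_isom_group_def BijGroup_def)
  also have "\<dots> = matrix_isom (A ** B)"
  proof
    fix p
    show "compose hyp_space (matrix_isom A) (matrix_isom B) p = matrix_isom (A ** B) p"
      using matrix_isom_apply[OF assms(2), of p]
      by (cases "p \<in> hyp_space") (simp_all add: compose_def matrix_isom_def[of A] matrix_isom_def[of "A ** B"] matrix_vector_mul_assoc)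
  qed
  finally show ?thesis .
qed

lemma isom_matrix_mult:
  assumes "g \<in> hyp_isom" "h \<in> hyp_isom"
  shows "g \<otimes>\<^bsub>hyp_isom_group\<^esub> h \<in> hyp_isom"
    and "isom_matrix (g \<otimes>\<^bsub>hyp_isom_group\<^esub> h) = isom_matrix g ** isom_matrix h"
proof -
  note L = isom_matrix_lorentz(1)[OF assms(1)] isom_matrix_lorentz(1)[OF assms(2)]
  have eq: "g \<otimes>\<^bsub>hyp_isom_group\<^esub> h = matrix_isom (isom_matrix g ** isom_matrix h)"
    using matrix_isom_mult[OF L] by (simp only: matrix_isom_isom_matrix assms)
  show "g \<otimes>\<^bsub>hyp_isom_group\<^esub> h \<in> hyp_isom"
    unfolding eq by (intro matrix_isom_hyp_isom lorentz_mult L)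
  show "isom_matrix (g \<otimes>\<^bsub>hyp_isom_group\<^esub> h) = isom_matrix g ** isom_matrix h"
    unfolding eq by (intro isom_matrix_matrix_isom lorentz_mult L)
qed

lemma continuous_lift_point: "continuous_on S lift_point"
  unfolding lift_point_def
proof (intro continuous_on_vec_lambda)
  show "continuous_on S (\<lambda>p. case i of None \<Rightarrow> 1 | Some b \<Rightarrow> p $ b)" for i
    by (cases i) (auto intro!: continuous_intros)
qed

lemma continuous_klein: "continuous_on hyp_space klein"
  unfolding klein_def
  by (rule continuous_on_compose2[OF continuous_normalize_cone continuous_lift_point]) (auto simp: lift_point_cone)

lemma continuous_unklein: "continuous_on cone unklein"
  unfolding unklein_def
  by (intro continuous_intros) (use cone_None_pos in fastforce)

lemma topspace_hyp_isom_topology: "topspace hyp_isom_topology = hyp_isom"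
proof -
  have "hyp_isom \<subseteq> hyp_space \<rightarrow>\<^sub>E hyp_space"
    using hyp_isomD by (auto simp: PiE_def Pi_def)
  then show ?thesis by (auto simp: hyp_isom_topology_def)
qed

text \<open>The columns are continuous functions of the values of \<open>g\<close> at finitely many
  points, so pointwise convergence suffices.\<close>

lemma continuous_map_isom_matrix: "continuous_map hyp_isom_topology euclidean isom_matrix"
proof -
  define pt :: "'a option \<Rightarrow> real ^ 'a" where "pt i = (case i of None \<Rightarrow> 0 | Some b \<Rightarrow> (1 / 2) *\<^sub>R axis b 1)" for i
  have pt: "pt i \<in> hyp_space" for i
    unfolding pt_def by (cases i) (simp_all add: zero_hyp_space half_axis_hyp_space del: scaleR_half_double)
  define D where "D = {E :: 'a option \<Rightarrow> real ^ 'a. \<forall>i. E i \<in> hyp_space}"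
  define M where "M E = (\<chi> r c. (case c of None \<Rightarrow> klein (E None)
     | Some b \<Rightarrow> sqrt 3 *\<^sub>R klein (E (Some b)) - 2 *\<^sub>R klein (E None)) $ r)" for E :: "'a option \<Rightarrow> real ^ 'a"
  have eq: "isom_matrix g = M (\<lambda>i. g (pt i))" for g :: "real ^ 'a \<Rightarrow> real ^ 'a"
    by (simp add: isom_matrix_def M_def basis_comb_def pt_def vec_eq_iff split: option.split)
  have "continuous_map hyp_isom_topology (product_topology (\<lambda>_. euclidean) UNIV) (\<lambda>g i. g (pt i))"
  proof (rule continuous_map_componentwise_UNIV[THEN iffD2], rule allI)
    fix i
    have "continuous_map (product_topology (\<lambda>_. top_of_set hyp_space) hyp_space) (top_of_set hyp_space) (\<lambda>g. g (pt i))"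
      by (rule continuous_map_product_projection[OF pt])
    then have "continuous_map (product_topology (\<lambda>_. top_of_set hyp_space) hyp_space) euclidean (\<lambda>g. g (pt i))"
      by (rule continuous_map_into_fulltopology)
    then show "continuous_map hyp_isom_topology euclidean (\<lambda>g. g (pt i))"
      unfolding hyp_isom_topology_def by (rule continuous_map_from_subtopology)
  qed
  then have "continuous_map hyp_isom_topology (top_of_set D) (\<lambda>g i. g (pt i))"
    unfolding euclidean_product_topology
    by (rule continuous_map_into_subtopology) (auto simp: topspace_hyp_isom_topology D_def hyp_isomD(1) pt)
  moreover have "continuous_map (top_of_set D) euclidean M"
  proof -
    have k: "continuous_on D (\<lambda>E. klein (E i))" for i
      by (rule continuous_on_compose2[OF continuous_klein continuous_on_product_then_coordinatewise[OF continuous_on_id]])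
        (auto simp: D_def)
    have "continuous_on D M"
      unfolding M_def
    proof (intro continuous_on_vec_lambda)
      show "continuous_on D (\<lambda>E. (case c of None \<Rightarrow> klein (E None)
         | Some b \<Rightarrow> sqrt 3 *\<^sub>R klein (E (Some b)) - 2 *\<^sub>R klein (E None)) $ r)" for r c
        by (cases c) (auto intro!: continuous_intros k)
    qed
    then show ?thesis by (simp add: continuous_map_iff_continuous)
  qed
  ultimately have "continuous_map hyp_isom_topology euclidean (M \<circ> (\<lambda>g i. g (pt i)))"
    by (rule continuous_map_compose)
  then show ?thesis by (simp add: comp_def flip: eq)
qed

lemma continuous_map_matrix_isom:
  assumes f: "continuous_on S f" and L: "\<And>x. x \<in> S \<Longrightarrow> f x \<in> lorentz"
  shows "continuous_map (top_of_set S) hyp_isom_topology (\<lambda>x. matrix_isom (f x))"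
  unfolding hyp_isom_topology_def
proof (rule continuous_map_into_subtopology)
  show "continuous_map (top_of_set S) (product_topology (\<lambda>_. top_of_set hyp_space) hyp_space) (\<lambda>x. matrix_isom (f x))"
    unfolding continuous_map_componentwise
  proof (intro conjI ballI)
    show "(\<lambda>x. matrix_isom (f x)) ` topspace (top_of_set S) \<subseteq> extensional hyp_space"
      by (auto simp: matrix_isom_def)
    fix p :: "real ^ 'b" assume p: "p \<in> hyp_space"
    have "continuous_on S (\<lambda>x. unklein (f x *v klein p))"
      by (rule continuous_on_compose2[OF continuous_unklein continuous_on_matrix_vector_mult[OF f continuous_on_const]])
        (use L lorentz_cone hyperboloid_cone klein_hyperboloid[OF p] in blast)
    then have "continuous_on S (\<lambda>x. matrix_isom (f x) p)" using p by (simp add: matrix_isom_def)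
    then show "continuous_map (top_of_set S) (top_of_set hyp_space) (\<lambda>x. matrix_isom (f x) p)"
      using matrix_isom_apply(1)[OF L p] by (intro continuous_map_into_subtopology) auto
  qed
qed (auto simp: matrix_isom_hyp_isom L)

definition matrix_character :: "real ^ ('n::finite) option ^ 'n option \<Rightarrow> real" where
  "matrix_character A = orientation_character (matrix_isom A)"

text \<open>On the ball this isometry is the linear map \<open>R\<close>, diagonal with a single
  entry -1, so its derivative at \<open>0\<close> has determinant -1.\<close>

lemma matrix_character_reflection:
  fixes b :: "'n::finite"
  shows "matrix_character (reflection_matrix (axis (Some b) 1)) = - 1"
proof -
  define R :: "real ^ 'n ^ 'n" where "R = (\<chi> i j. if i = j then (if i = b then - 1 else 1) else 0)"
  let ?w = "axis (Some b) 1 :: real ^ 'n option"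
  have w: "?w $ None = 0" "?w \<noteq> 0" "lform ?w ?w = 1"
    by (simp_all add: axis_def lform_def inner_axis_axis[of "Some b" 1 "Some b" 1, unfolded axis_def])
      (metis axis_def axis_eq_0_iff one_neq_zero)
  have lk: "reflection_matrix ?w *v lift_point p = lift_point (R *v p)" for p
  proof -
    have "(reflection_matrix ?w *v lift_point p) $ i = lift_point (R *v p) $ i" for i
    proof (cases i)
      case None
      then show ?thesis by (simp add: reflection_matrix_mult lreflect_def w)
    next
      case (Some c)
      have "lform (lift_point p) ?w = p $ b" by (simp add: lform_def inner_axis w)
      moreover have "(R *v p) $ c = (if c = b then - p $ c else p $ c)"
        by (simp add: R_def matrix_vector_mult_def if_distrib[of "\<lambda>y. y * _"] cong: if_cong)
      moreover have "?w $ Some c = (if c = b then 1 else 0)" by (simp add: axis_def)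
      ultimately show ?thesis using Some by (simp add: reflection_matrix_mult lreflect_def w)
    qed
    then show ?thesis by (simp add: vec_eq_iff)
  qed
  have eq: "matrix_isom (reflection_matrix ?w) p = R *v p" if p: "p \<in> hyp_space" for p
  proof -
    have c: "1 / sqrt (- lform (lift_point p) (lift_point p)) \<noteq> 0"
      using p by (simp add: lform_lift_point hyp_space_iff)
    have "reflection_matrix ?w *v klein p = (1 / sqrt (- lform (lift_point p) (lift_point p))) *\<^sub>R lift_point (R *v p)"
      by (simp only: klein_def normalize_cone_def matrix_vector_mult_scaleR lk)
    then have "unklein (reflection_matrix ?w *v klein p) = unklein (lift_point (R *v p))"
      using unklein_scale[OF c] by simp
    then show ?thesis using p by (simp add: matrix_isom_def unklein_def vec_eq_iff)
  qed
  have "\<not> orientation_preserving (matrix_isom (reflection_matrix ?w))"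
  proof
    assume "orientation_preserving (matrix_isom (reflection_matrix ?w))"
    then obtain D where D: "(matrix_isom (reflection_matrix ?w) has_derivative D) (at 0)" "det (matrix D) > 0"
      using zero_hyp_space unfolding orientation_preserving_def by blast
    have "((*v) R has_derivative D) (at 0)"
      by (rule has_derivative_transform_within_open[OF D(1), of hyp_space])
        (auto simp: eq zero_hyp_space, simp add: hyp_space_def)
    moreover have "((*v) R has_derivative (*v) R) (at 0)"
      by (rule bounded_linear_imp_has_derivative[OF matrix_vector_mul_bounded_linear])
    ultimately have "D = (*v) R" by (rule has_derivative_unique)
    then have "matrix D = R" by simp
    moreover have "det R = (\<Prod>i\<in>UNIV. R $ i $ i)" by (rule det_diagonal) (simp add: R_def)
    moreover have "(\<Prod>i\<in>UNIV. R $ i $ i) = - 1" by (simp add: R_def prod.delta)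
    ultimately show False using D(2) by simp
  qed
  then show ?thesis by (simp add: matrix_character_def orientation_character_def)
qed

section \<open>Cochains on isometries as cochains on matrices\<close>

definition on_matrices ::
    "nat \<Rightarrow> ((nat \<Rightarrow> real ^ ('n::finite) \<Rightarrow> real ^ 'n) \<Rightarrow> real) \<Rightarrow> (nat \<Rightarrow> real ^ 'n option ^ 'n option) \<Rightarrow> real" where
  "on_matrices q f A = f (\<lambda>i\<in>{..q}. matrix_isom (A i))"

text \<open>Padding with the identity produces a member of \<open>lorentz_seq\<close>; a cochain of
  degree \<open>q\<close> does not see it.\<close>

definition tuple_matrices ::
    "nat \<Rightarrow> (nat \<Rightarrow> real ^ ('n::finite) \<Rightarrow> real ^ 'n) \<Rightarrow> nat \<Rightarrow> real ^ 'n option ^ 'n option" where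
  "tuple_matrices q x i = (if i \<le> q then isom_matrix (x i) else mat 1)"

definition on_isometries ::
    "nat \<Rightarrow> ((nat \<Rightarrow> real ^ ('n::finite) option ^ 'n option) \<Rightarrow> real) \<Rightarrow> (nat \<Rightarrow> real ^ 'n \<Rightarrow> real ^ 'n) \<Rightarrow> real" where
  "on_isometries q \<phi> x = (if x \<in> tuples hyp_isom_group q then \<phi> (tuple_matrices q x) else 0)"

lemma tuple_isom: "x \<in> tuples hyp_isom_group q \<Longrightarrow> i \<le> q \<Longrightarrow> x i \<in> hyp_isom"
  by (auto simp: tuples_def)

lemma tuple_matrices_lorentz_seq: "x \<in> tuples hyp_isom_group q \<Longrightarrow> tuple_matrices q x \<in> lorentz_seq"
  by (simp add: lorentz_seq_def tuple_matrices_def isom_matrix_lorentz(1) tuple_isom mat_1_lorentz)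

lemma matrix_tuple: "A \<in> lorentz_seq \<Longrightarrow> (\<lambda>i\<in>{..q}. matrix_isom (A i)) \<in> tuples hyp_isom_group q"
  by (simp add: tuples_def lorentz_seq_def matrix_isom_hyp_isom)

lemma matrix_tuple_matrices:
  assumes "x \<in> tuples hyp_isom_group q"
  shows "(\<lambda>i\<in>{..q}. matrix_isom (tuple_matrices q x i)) = x"
proof
  fix i
  show "(\<lambda>i\<in>{..q}. matrix_isom (tuple_matrices q x i)) i = x i"
  proof (cases "i \<le> q")
    case True
    then show ?thesis using matrix_isom_isom_matrix[OF tuple_isom[OF assms True]] by (simp add: tuple_matrices_def)
  next
    case False
    have "x i = undefined" using assms[unfolded tuples_def] False by (intro PiE_arb) auto
    then show ?thesis using False by simp
  qed
qed

lemma on_matrices_tuple: "x \<in> tuples hyp_isom_group q \<Longrightarrow> on_matrices q f (tuple_matrices q x) = f x"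
  by (simp only: on_matrices_def matrix_tuple_matrices)

lemma tuples_omit: "x \<in> tuples G (Suc q) \<Longrightarrow> omit q j x \<in> tuples G q"
  by (auto simp: tuples_def omit_def)

lemma cobd_on_matrices:
  assumes "A \<in> lorentz_seq"
  shows "cobd q (on_matrices q f) A = coboundary hyp_isom_group q f (\<lambda>i\<in>{..Suc q}. matrix_isom (A i))"
proof -
  have "(\<lambda>i\<in>{..q}. matrix_isom ((A \<circ> skip j) i)) = omit q j (\<lambda>i\<in>{..Suc q}. matrix_isom (A i))" for j
    by (rule ext) (simp add: omit_def skip_def)
  then show ?thesis
    using matrix_tuple[OF assms] by (simp only: cobd_def coboundary_def on_matrices_def if_True)
qed

lemma coboundary_on_isometries:
  assumes \<phi>: "depends_upto q \<phi>"
  shows "coboundary hyp_isom_group q (on_isometries q \<phi>) = on_isometries (Suc q) (cobd q \<phi>)"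
proof
  fix x :: "nat \<Rightarrow> real ^ 'a \<Rightarrow> real ^ 'a"
  have "on_isometries q \<phi> (omit q j x) = \<phi> (tuple_matrices (Suc q) x \<circ> skip j)"
    if x: "x \<in> tuples hyp_isom_group (Suc q)" for j
  proof -
    have "\<phi> (tuple_matrices q (omit q j x)) = \<phi> (tuple_matrices (Suc q) x \<circ> skip j)"
      by (rule depends_uptoD[OF \<phi>]) (simp add: tuple_matrices_def omit_def skip_def)
    then show ?thesis using tuples_omit[OF x] by (simp add: on_isometries_def)
  qed
  then show "coboundary hyp_isom_group q (on_isometries q \<phi>) x = on_isometries (Suc q) (cobd q \<phi>) x"
    by (simp add: coboundary_def on_isometries_def[of "Suc q"] cobd_def)
qed

lemma topspace_isometry_tuples:
  "topspace (product_topology (\<lambda>_. hyp_isom_topology) {..q}) = tuples hyp_isom_group q"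
  by (simp add: topspace_hyp_isom_topology tuples_def)

abbreviation isometry_cochains :: "nat \<Rightarrow> ((nat \<Rightarrow> real ^ ('n::finite) \<Rightarrow> real ^ 'n) \<Rightarrow> real) set" where
  "isometry_cochains \<equiv> continuous_cochains hyp_isom_group hyp_isom_topology orientation_character"

abbreviation bounded_isometry_cochains :: "nat \<Rightarrow> ((nat \<Rightarrow> real ^ ('n::finite) \<Rightarrow> real ^ 'n) \<Rightarrow> real) set" where
  "bounded_isometry_cochains \<equiv> bounded_cochains hyp_isom_group hyp_isom_topology orientation_character"

lemma isometry_cochainsD:
  fixes f :: "(nat \<Rightarrow> real ^ ('n::finite) \<Rightarrow> real ^ 'n) \<Rightarrow> real"
  assumes "f \<in> isometry_cochains q"
  shows "continuous_map (product_topology (\<lambda>_. hyp_isom_topology) {..q}) euclideanreal f"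
    and "x \<notin> tuples hyp_isom_group q \<Longrightarrow> f x = 0"
    and "g \<in> hyp_isom \<Longrightarrow> x \<in> tuples hyp_isom_group q \<Longrightarrow>
      orientation_character g * f x = f (\<lambda>i\<in>{..q}. g \<otimes>\<^bsub>hyp_isom_group\<^esub> x i)"
  using assms by (simp_all add: continuous_cochains_def)

locale isometry_complex = sign_character "matrix_character :: real ^ ('n::finite) option ^ 'n option \<Rightarrow> real" a n
  for a :: "'n::finite" and n
begin

lemma on_matrices_mcochain:
  fixes f :: "(nat \<Rightarrow> real ^ 'n \<Rightarrow> real ^ 'n) \<Rightarrow> real"
  assumes f: "f \<in> isometry_cochains q"
  shows "mcochain q (on_matrices q f)"
  unfolding mcochain_def
proof (intro conjI ballI)
  show "depends_upto q (on_matrices q f)"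
    unfolding depends_upto_def on_matrices_def by (intro allI impI arg_cong[of _ _ f] restrict_ext) simp
  have "continuous_map (top_of_set lorentz_seq) (product_topology (\<lambda>_. hyp_isom_topology) {..q})
      (\<lambda>A. \<lambda>i\<in>{..q}. matrix_isom (A i) :: real ^ 'n \<Rightarrow> real ^ 'n)"
    unfolding continuous_map_componentwise
  proof (intro conjI ballI)
    show "(\<lambda>A. \<lambda>i\<in>{..q}. matrix_isom (A i) :: real ^ 'n \<Rightarrow> real ^ 'n) ` topspace (top_of_set lorentz_seq) \<subseteq> extensional {..q}"
      by auto
    fix k assume k: "k \<in> {..q}"
    have "continuous_map (top_of_set lorentz_seq) hyp_isom_topology (\<lambda>A. matrix_isom (A k) :: real ^ 'n \<Rightarrow> real ^ 'n)"
      by (rule continuous_map_matrix_isom[OF continuous_on_product_then_coordinatewise[OF continuous_on_id]])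
        (rule lorentz_seqD)
    then show "continuous_map (top_of_set lorentz_seq) hyp_isom_topology
        (\<lambda>A. (\<lambda>i\<in>{..q}. matrix_isom (A i) :: real ^ 'n \<Rightarrow> real ^ 'n) k)"
      using k by simp
  qed
  from continuous_map_compose[OF this isometry_cochainsD(1)[OF f]]
  show "continuous_on lorentz_seq (on_matrices q f)"
    by (simp add: comp_def on_matrices_def[abs_def])
next
  fix A :: "real ^ 'n option ^ 'n option" and g :: "nat \<Rightarrow> real ^ 'n option ^ 'n option" assume A: "A \<in> lorentz" and g: "g \<in> lorentz_seq"
  have "matrix_character A * on_matrices q f g
      = f (\<lambda>i\<in>{..q}. matrix_isom A \<otimes>\<^bsub>hyp_isom_group\<^esub> (\<lambda>i\<in>{..q}. matrix_isom (g i)) i)"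
    unfolding matrix_character_def on_matrices_def
    by (rule isometry_cochainsD(3)[OF f matrix_isom_hyp_isom[OF A] matrix_tuple[OF g]])
  also have "\<dots> = on_matrices q f (\<lambda>i. A ** g i)"
    unfolding on_matrices_def
    by (intro arg_cong[of _ _ f] restrict_ext) (simp add: matrix_isom_mult A lorentz_seqD[OF g])
  finally show "on_matrices q f (\<lambda>i. A ** g i) = matrix_character A * on_matrices q f g" by simp
qed

lemma on_isometries_cochain:
  assumes \<phi>: "mcochain q \<phi>"
  shows "on_isometries q \<phi> \<in> isometry_cochains q"
  unfolding continuous_cochains_def mem_Collect_eq carrier_hyp_isom_group
proof (intro conjI allI impI ballI)
  let ?X = "product_topology (\<lambda>_. hyp_isom_topology :: (real ^ 'n \<Rightarrow> real ^ 'n) topology) {..q}"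
  have "continuous_map ?X euclidean (\<lambda>x. tuple_matrices q x i)" for i
  proof (cases "i \<le> q")
    case True
    then have "continuous_map ?X hyp_isom_topology (\<lambda>x. x i)"
      by (intro continuous_map_product_projection) simp
    from continuous_map_compose[OF this continuous_map_isom_matrix]
    show ?thesis using True by (simp add: comp_def tuple_matrices_def)
  qed (simp add: tuple_matrices_def)
  then have "continuous_map ?X (product_topology (\<lambda>_. euclidean) UNIV) (tuple_matrices q)"
    unfolding continuous_map_componentwise_UNIV ..
  then have "continuous_map ?X (top_of_set lorentz_seq) (tuple_matrices q)"
    unfolding euclidean_product_topology
    by (rule continuous_map_into_subtopology)
      (simp add: topspace_isometry_tuples tuple_matrices_lorentz_seq Pi_iff del: topspace_product_topology)
  moreover have "continuous_map (top_of_set lorentz_seq) euclideanreal \<phi>"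
    using mcochainD(2)[OF \<phi>] by simp
  ultimately have "continuous_map ?X euclideanreal (\<phi> \<circ> tuple_matrices q)"
    by (rule continuous_map_compose)
  then show "continuous_map ?X euclideanreal (on_isometries q \<phi>)"
    by (rule continuous_map_eq)
      (simp add: topspace_isometry_tuples on_isometries_def del: topspace_product_topology)
next
  fix x :: "nat \<Rightarrow> real ^ 'n \<Rightarrow> real ^ 'n" assume "x \<notin> tuples hyp_isom_group q"
  then show "on_isometries q \<phi> x = 0" by (simp add: on_isometries_def)
next
  fix g :: "real ^ 'n \<Rightarrow> real ^ 'n" and x :: "nat \<Rightarrow> real ^ 'n \<Rightarrow> real ^ 'n" assume g: "g \<in> hyp_isom" and x: "x \<in> tuples hyp_isom_group q"
  let ?y = "\<lambda>i\<in>{..q}. g \<otimes>\<^bsub>hyp_isom_group\<^esub> x i"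
  have y: "?y \<in> tuples hyp_isom_group q"
    using isom_matrix_mult(1)[OF g tuple_isom[OF x]] by (simp add: tuples_def)
  have "\<phi> (tuple_matrices q ?y) = \<phi> (\<lambda>i. isom_matrix g ** tuple_matrices q x i)"
    by (rule depends_uptoD[OF mcochainD(1)[OF \<phi>]])
      (simp add: tuple_matrices_def isom_matrix_mult(2)[OF g tuple_isom[OF x]])
  also have "\<dots> = matrix_character (isom_matrix g) * \<phi> (tuple_matrices q x)"
    by (rule mcochainD(3)[OF \<phi> isom_matrix_lorentz(1)[OF g] tuple_matrices_lorentz_seq[OF x]])
  also have "matrix_character (isom_matrix g) = orientation_character g"
    by (simp add: matrix_character_def matrix_isom_isom_matrix g)
  finally show "orientation_character g * on_isometries q \<phi> x = on_isometries q \<phi> ?y"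
    using x y by (simp only: on_isometries_def if_True)
qed

lemma on_isometries_bounded:
  assumes \<phi>: "mcochain q \<phi>" and K: "\<And>g. g \<in> lorentz_seq \<Longrightarrow> \<bar>\<phi> g\<bar> \<le> K"
  shows "on_isometries q \<phi> \<in> bounded_isometry_cochains q"
proof -
  have "bounded (on_isometries q \<phi> ` tuples hyp_isom_group q)"
    by (rule boundedI[of _ K]) (auto simp: on_isometries_def intro!: K tuple_matrices_lorentz_seq)
  then show ?thesis using on_isometries_cochain[OF \<phi>] by (simp add: bounded_cochains_def)
qed

definition project :: "((nat \<Rightarrow> real ^ 'n \<Rightarrow> real ^ 'n) \<Rightarrow> real) \<Rightarrow> (nat \<Rightarrow> real ^ 'n \<Rightarrow> real ^ 'n) \<Rightarrow> real" where
  "project f = on_isometries n (average (on_matrices n f))"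

lemma on_matrices_cocycle:
  fixes f :: "(nat \<Rightarrow> real ^ 'n \<Rightarrow> real ^ 'n) \<Rightarrow> real"
  assumes f: "f \<in> cocycles hyp_isom_group isometry_cochains q"
  shows "mcochain q (on_matrices q f)" "g \<in> lorentz_seq \<Longrightarrow> cobd q (on_matrices q f) g = 0"
  using f by (simp_all add: cocycles_def on_matrices_mcochain cobd_on_matrices)

lemma project_cocycle:
  assumes f: "f \<in> cocycles hyp_isom_group isometry_cochains n"
  shows "project f \<in> cocycles hyp_isom_group bounded_isometry_cochains n"
proof -
  note u = on_matrices_cocycle[OF f]
  have "\<exists>K. \<forall>g\<in>lorentz_seq. \<bar>average (on_matrices n f) g\<bar> \<le> K" by (rule average_cocycle_bounded[OF u])
  then obtain K where K: "\<forall>g\<in>lorentz_seq. \<bar>average (on_matrices n f) g\<bar> \<le> K" ..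
  have "project f \<in> bounded_isometry_cochains n"
    unfolding project_def by (rule on_isometries_bounded[OF average_mcochain[OF u(1)]]) (rule K[rule_format])
  moreover have "coboundary hyp_isom_group n (project f) x = 0" for x
    unfolding project_def coboundary_on_isometries[OF mcochainD(1)[OF average_mcochain[OF u(1)]]]
    by (simp add: on_isometries_def average_cocycle[OF u] tuple_matrices_lorentz_seq)
  ultimately show ?thesis by (simp add: cocycles_def)
qed

lemma sup_norm_project:
  assumes f: "f \<in> cocycles hyp_isom_group isometry_cochains n"
  shows "sup_norm hyp_isom_group n (project f) \<le> sup_norm hyp_isom_group n f"
proof (cases "sup_norm hyp_isom_group n f")
  case (real B)
  have "\<bar>on_matrices n f g\<bar> \<le> B" if "g \<in> lorentz_seq" for g
  proof -
    have "ennreal \<bar>on_matrices n f g\<bar> \<le> sup_norm hyp_isom_group n f"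
      unfolding sup_norm_def on_matrices_def by (rule SUP_upper[OF matrix_tuple[OF that]])
    then show ?thesis using real by simp
  qed
  then have "\<bar>average (on_matrices n f) g\<bar> \<le> B" if "g \<in> lorentz_seq" for g
    by (rule average_bound[OF on_matrices_cocycle(1)[OF f] _ that])
  then show ?thesis
    unfolding real(2) sup_norm_def[of _ _ "project f"]
    by (intro SUP_least) (simp add: project_def on_isometries_def tuple_matrices_lorentz_seq real(1))
qed simp

lemma project_homotopy:
  assumes f: "f \<in> cocycles hyp_isom_group isometry_cochains n" and p: "Suc p = n"
  shows "(\<lambda>x. project f x - f x) = coboundary hyp_isom_group p (on_isometries p (homotopy p (on_matrices n f)))"
proof
  note u = on_matrices_cocycle[OF f, folded p]
  fix x
  have "cobd p (homotopy p (on_matrices n f)) (tuple_matrices n x) = average (on_matrices n f) (tuple_matrices n x) - f x"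
    if x: "x \<in> tuples hyp_isom_group n"
    using homotopy_identity[OF u tuple_matrices_lorentz_seq[OF x[folded p]]] on_matrices_tuple[OF x, of f]
    unfolding p by simp
  moreover have "f x = 0" if "x \<notin> tuples hyp_isom_group n"
    using f that isometry_cochainsD(2) by (auto simp: cocycles_def)
  ultimately show "project f x - f x = coboundary hyp_isom_group p (on_isometries p (homotopy p (on_matrices n f))) x"
    unfolding coboundary_on_isometries[OF mcochainD(1)[OF homotopy_mcochain[OF u(1)]], unfolded p]
    by (simp add: project_def on_isometries_def)
qed

text \<open>One homotopy serves both cocomplexes: it is a sum of \<open>Suc p\<close> averaged
  values of the cocycle, hence bounded whenever the cocycle is.\<close>

lemma project_cohomologous:
  assumes f: "f \<in> cocycles hyp_isom_group isometry_cochains n"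
  shows "(\<lambda>x. project f x - f x) \<in> coboundaries hyp_isom_group isometry_cochains n"
    and "f \<in> bounded_isometry_cochains n \<Longrightarrow>
      (\<lambda>x. project f x - f x) \<in> coboundaries hyp_isom_group bounded_isometry_cochains n"
proof -
  obtain p where p: "Suc p = n" using dim_ge by (cases n) auto
  note u = on_matrices_cocycle(1)[OF f, folded p]
  let ?h = "homotopy p (on_matrices (Suc p) f)"
  have h: "(\<lambda>x. project f x - f x) = coboundary hyp_isom_group p (on_isometries p ?h)"
    using project_homotopy[OF f p] unfolding p .
  have cb: "coboundaries hyp_isom_group C n = coboundary hyp_isom_group p ` C p"
    for C :: "nat \<Rightarrow> ((nat \<Rightarrow> real ^ 'n \<Rightarrow> real ^ 'n) \<Rightarrow> real) set"
    by (simp add: coboundaries_def flip: p)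
  have "on_isometries p ?h \<in> isometry_cochains p" by (rule on_isometries_cochain[OF homotopy_mcochain[OF u]])
  then show "(\<lambda>x. project f x - f x) \<in> coboundaries hyp_isom_group isometry_cochains n"
    unfolding h cb by (rule imageI)
  assume "f \<in> bounded_isometry_cochains n"
  then have "bounded (f ` tuples hyp_isom_group n)" by (simp add: bounded_cochains_def)
  then obtain B where B: "\<And>y. y \<in> f ` tuples hyp_isom_group n \<Longrightarrow> norm y \<le> B"
    unfolding bounded_iff by (elim exE) (rule that, blast)
  have "\<bar>on_matrices (Suc p) f g\<bar> \<le> B" if "g \<in> lorentz_seq" for g
    using B[OF imageI[OF matrix_tuple[OF that]]] unfolding p by (simp add: on_matrices_def)
  then have "\<bar>?h g\<bar> \<le> real (Suc p) * B" if "g \<in> lorentz_seq" for g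
    by (rule homotopy_bound[OF u _ that])
  then have "on_isometries p ?h \<in> bounded_isometry_cochains p"
    by (rule on_isometries_bounded[OF homotopy_mcochain[OF u]])
  then show "(\<lambda>x. project f x - f x) \<in> coboundaries hyp_isom_group bounded_isometry_cochains n"
    unfolding h cb by (rule imageI)
qed

text \<open>Averaging turns \<open>f - f'\<close> into the coboundary of an averaged cochain of
  degree \<open>n - 1\<close>, which is zero by \<open>average_vanishes\<close>.\<close>

lemma project_class:
  assumes "(f, f') \<in> cohomologous hyp_isom_group isometry_cochains n"
  shows "project f = project f'"
proof -
  obtain p where p: "Suc p = n" using dim_ge by (cases n) auto
  have f: "f \<in> cocycles hyp_isom_group isometry_cochains n" and f': "f' \<in> cocycles hyp_isom_group isometry_cochains n"
    and "(\<lambda>x. f x - f' x) \<in> coboundaries hyp_isom_group isometry_cochains n"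
    using assms by (simp_all add: cohomologous_def)
  then obtain u where u: "u \<in> isometry_cochains p" and ff': "(\<lambda>x. f x - f' x) = coboundary hyp_isom_group p u"
    unfolding coboundaries_def p[symmetric] nat.case by (elim imageE)
  note m = on_matrices_mcochain[OF u] and mf = on_matrices_cocycle(1)[OF f] and mf' = on_matrices_cocycle(1)[OF f']
  have "average (on_matrices n f) g = average (on_matrices n f') g" if g: "g \<in> lorentz_seq" for g
  proof -
    have d: "cobd p (on_matrices p u) A = on_matrices n f A - on_matrices n f' A" if "A \<in> lorentz_seq" for A
      using fun_cong[OF ff', of "\<lambda>i\<in>{..n}. matrix_isom (A i)"]
      unfolding cobd_on_matrices[OF that] on_matrices_def p by simp
    have int: "integrable haar_seq (\<lambda>\<omega>. v (\<lambda>i. g i ** \<omega> i))" if "mcochain n v" for v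
      by (rule haar_seq_bounded_integrable[OF continuous_section(1)[OF mcochainD(2)[OF that] g]])
    have "average (on_matrices n f) g - average (on_matrices n f') g
        = (\<integral>\<omega>. on_matrices n f (\<lambda>i. g i ** \<omega> i) - on_matrices n f' (\<lambda>i. g i ** \<omega> i) \<partial>haar_seq)"
      unfolding average_def by (rule Bochner_Integration.integral_diff[OF int[OF mf] int[OF mf'], symmetric])
    also have "\<dots> = (\<integral>\<omega>. cobd p (on_matrices p u) (\<lambda>i. g i ** \<omega> i) \<partial>haar_seq)"
      by (rule Bochner_Integration.integral_cong[OF refl]) (simp add: d lorentz_seq_stabilizer g space_haar_seq)
    also have "\<dots> = cobd p (average (on_matrices p u)) g" by (rule average_cobd[OF m g, symmetric])
    also have "\<dots> = 0" by (simp add: cobd_def average_vanishes[OF m p] lorentz_seq_skip g)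
    finally show ?thesis by simp
  qed
  then show ?thesis unfolding project_def on_isometries_def by (auto simp: tuple_matrices_lorentz_seq)
qed

end

section \<open>Comparison maps with a norm-nonincreasing projection\<close>

locale cochain_spaces =
  fixes C :: "nat \<Rightarrow> ((nat \<Rightarrow> 'a) \<Rightarrow> real) set"
  assumes zero: "(\<lambda>_. 0) \<in> C q"
    and comb: "f \<in> C q \<Longrightarrow> g \<in> C q \<Longrightarrow> (\<lambda>x. r * f x + s * g x) \<in> C q"

lemma coboundary_comb:
  "coboundary G q (\<lambda>x. r * f x + s * g x) = (\<lambda>x. r * coboundary G q f x + s * coboundary G q g x)"
  by (rule ext) (simp add: coboundary_def sum.distrib sum_distrib_left algebra_simps)

context cochain_spaces
begin

lemma coboundaries_zero: "(\<lambda>_. 0) \<in> coboundaries G C q"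
proof (cases q)
  case (Suc p)
  have "coboundary G p (\<lambda>_. 0) = (\<lambda>_. 0)" by (rule ext) (simp add: coboundary_def)
  then show ?thesis using imageI[OF zero[of p], of "coboundary G p"] by (simp add: coboundaries_def Suc)
qed (simp add: coboundaries_def)

lemma coboundaries_comb:
  assumes f: "f \<in> coboundaries G C q" and g: "g \<in> coboundaries G C q"
  shows "(\<lambda>x. r * f x + s * g x) \<in> coboundaries G C q"
proof (cases q)
  case (Suc p)
  obtain f' g' where f': "f' \<in> C p" "f = coboundary G p f'" and g': "g' \<in> C p" "g = coboundary G p g'"
    using f g by (auto simp: coboundaries_def Suc)
  show ?thesis
    using imageI[OF comb[OF f'(1) g'(1), of r s], of "coboundary G p"]
    by (simp add: coboundaries_def Suc f'(2) g'(2) coboundary_comb)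
qed (use f g in \<open>simp add: coboundaries_def\<close>)

lemma cocycles_comb:
  "f \<in> cocycles G C q \<Longrightarrow> g \<in> cocycles G C q \<Longrightarrow> (\<lambda>x. r * f x + s * g x) \<in> cocycles G C q"
  by (simp add: cocycles_def comb coboundary_comb)

lemma cohomologous_comb:
  assumes "(f, f') \<in> cohomologous G C q" "(g, g') \<in> cohomologous G C q"
  shows "((\<lambda>x. r * f x + s * g x), (\<lambda>x. r * f' x + s * g' x)) \<in> cohomologous G C q"
proof -
  have "(\<lambda>x. (r * f x + s * g x) - (r * f' x + s * g' x)) = (\<lambda>x. r * (f x - f' x) + s * (g x - g' x))"
    by (simp add: algebra_simps)
  then show ?thesis
    using assms by (simp add: cohomologous_def cocycles_comb coboundaries_comb)
qed

lemma cohomologous_refl: "f \<in> cocycles G C q \<Longrightarrow> (f, f) \<in> cohomologous G C q"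
  by (simp add: cohomologous_def coboundaries_zero)

lemma equiv_cohomologous: "equiv (cocycles G C q) (cohomologous G C q)"
proof (rule equivI)
  show "cohomologous G C q \<subseteq> cocycles G C q \<times> cocycles G C q" by (auto simp: cohomologous_def)
  show "refl_on (cocycles G C q) (cohomologous G C q)"
    by (rule refl_onI) (rule cohomologous_refl)
  show "sym (cohomologous G C q)"
  proof (rule symI)
    fix f g assume "(f, g) \<in> cohomologous G C q"
    then show "(g, f) \<in> cohomologous G C q"
      using coboundaries_comb[of "\<lambda>x. f x - g x" G q "\<lambda>x. f x - g x" "- 1" 0] by (simp add: cohomologous_def)
  qed
  show "trans (cohomologous G C q)"
  proof (rule transI)
    fix f g h assume "(f, g) \<in> cohomologous G C q" "(g, h) \<in> cohomologous G C q"
    then show "(f, h) \<in> cohomologous G C q"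
      using coboundaries_comb[of "\<lambda>x. f x - g x" G q "\<lambda>x. g x - h x" 1 1] by (simp add: cohomologous_def)
  qed
qed

lemma UN_class:
  assumes "\<And>a. a \<in> S \<Longrightarrow> (h, k a) \<in> cohomologous G C q" "S \<noteq> {}"
  shows "(\<Union>a\<in>S. cohomologous G C q `` {k a}) = cohomologous G C q `` {h}"
proof -
  have "cohomologous G C q `` {k a} = cohomologous G C q `` {h}" if "a \<in> S" for a
    using equiv_class_eq[OF equiv_cohomologous assms(1)[OF that]] by simp
  then show ?thesis using assms(2) by simp
qed

lemma class_scale_class:
  assumes f: "f \<in> cocycles G C q"
  shows "class_scale G C q r (cohomologous G C q `` {f}) = cohomologous G C q `` {\<lambda>x. r * f x}"
  unfolding class_scale_def
proof (rule UN_class)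
  fix a assume "a \<in> cohomologous G C q `` {f}"
  then show "((\<lambda>x. r * f x), (\<lambda>x. r * a x)) \<in> cohomologous G C q"
    using cohomologous_comb[of f a G q f a r 0] by simp
qed (use cohomologous_refl[OF f] in auto)

lemma class_add_class:
  assumes f: "f \<in> cocycles G C q" and g: "g \<in> cocycles G C q"
  shows "class_add G C q (cohomologous G C q `` {f}) (cohomologous G C q `` {g}) = cohomologous G C q `` {\<lambda>x. f x + g x}"
proof -
  have "(\<Union>b\<in>cohomologous G C q `` {g}. cohomologous G C q `` {\<lambda>x. a x + b x}) = cohomologous G C q `` {\<lambda>x. f x + g x}"
    if a: "a \<in> cohomologous G C q `` {f}" for a
  proof (rule UN_class)
    fix b assume "b \<in> cohomologous G C q `` {g}"
    then show "((\<lambda>x. f x + g x), (\<lambda>x. a x + b x)) \<in> cohomologous G C q"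
      using cohomologous_comb[of f a G q g b 1 1] a by simp
  qed (use cohomologous_refl[OF g] in auto)
  then show ?thesis unfolding class_add_def using cohomologous_refl[OF f] by auto
qed

end

text \<open>The formal half of the argument. Cohomology between \<open>P f\<close> and
  \<open>f\<close> is required in each cocomplex separately: in \<open>C\<close> it yields
  surjectivity of the comparison map, and in \<open>B\<close> it yields injectivity and the
  isometry.\<close>

locale cochain_projection = C: cochain_spaces C + B: cochain_spaces B
  for C B :: "nat \<Rightarrow> ((nat \<Rightarrow> 'a) \<Rightarrow> real) set" +
  fixes G :: "('a, 'b) monoid_scheme" and q :: nat and P :: "((nat \<Rightarrow> 'a) \<Rightarrow> real) \<Rightarrow> (nat \<Rightarrow> 'a) \<Rightarrow> real"
  assumes sub: "B k \<subseteq> C k"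
    and P_cocycle: "f \<in> cocycles G C q \<Longrightarrow> P f \<in> cocycles G B q"
    and P_norm: "f \<in> cocycles G C q \<Longrightarrow> sup_norm G q (P f) \<le> sup_norm G q f"
    and P_cohomologous: "f \<in> cocycles G C q \<Longrightarrow> (\<lambda>x. P f x - f x) \<in> coboundaries G C q"
    and P_cohomologous_sub: "f \<in> cocycles G B q \<Longrightarrow> (\<lambda>x. P f x - f x) \<in> coboundaries G B q"
    and P_class: "(f, f') \<in> cohomologous G C q \<Longrightarrow> P f = P f'"
begin

lemma cocycles_sub: "f \<in> cocycles G B q \<Longrightarrow> f \<in> cocycles G C q"
  using sub by (auto simp: cocycles_def)

lemma cohomologous_sub: "(f, g) \<in> cohomologous G B q \<Longrightarrow> (f, g) \<in> cohomologous G C q"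
  using sub cocycles_sub by (cases q) (auto simp: cohomologous_def coboundaries_def)

lemma P_rel: "f \<in> cocycles G C q \<Longrightarrow> (P f, f) \<in> cohomologous G C q"
  using P_cohomologous P_cocycle cocycles_sub by (simp add: cohomologous_def)

lemma P_rel_sub: "f \<in> cocycles G B q \<Longrightarrow> (P f, f) \<in> cohomologous G B q"
  using P_cohomologous_sub P_cocycle cocycles_sub by (simp add: cohomologous_def)

lemma comparison_class:
  assumes f: "f \<in> cocycles G B q"
  shows "comparison_map G C q (cohomologous G B q `` {f}) = cohomologous G C q `` {f}"
  unfolding comparison_map_def
  by (rule C.UN_class) (use cohomologous_sub B.cohomologous_refl[OF f] in auto)

lemma cohomologyE:
  assumes "\<beta> \<in> cohomology G B q"
  obtains f where "f \<in> cocycles G B q" "\<beta> = cohomologous G B q `` {f}"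
  using assms unfolding cohomology_def by (rule quotientE)

text \<open>If \<open>f\<close> and \<open>g\<close> become cohomologous in \<open>C\<close>, then
  \<open>P f = P g\<close>, and within \<open>B\<close> each of them is cohomologous to its
  projection. Conversely, every class of \<open>C\<close> contains a cocycle \<open>P f\<close> of
  \<open>B\<close>.\<close>

lemma comparison_bij: "bij_betw (comparison_map G C q) (cohomology G B q) (cohomology G C q)"
proof (rule bij_betw_imageI)
  show "inj_on (comparison_map G C q) (cohomology G B q)"
  proof (rule inj_onI)
    fix \<alpha> \<beta> assume \<alpha>: "\<alpha> \<in> cohomology G B q" and \<beta>: "\<beta> \<in> cohomology G B q"
      and eq: "comparison_map G C q \<alpha> = comparison_map G C q \<beta>"
    obtain f where f: "f \<in> cocycles G B q" "\<alpha> = cohomologous G B q `` {f}" using \<alpha> by (rule cohomologyE)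
    obtain g where g: "g \<in> cocycles G B q" "\<beta> = cohomologous G B q `` {g}" using \<beta> by (rule cohomologyE)
    have "cohomologous G C q `` {f} = cohomologous G C q `` {g}"
      using eq unfolding f(2) g(2) comparison_class[OF f(1)] comparison_class[OF g(1)] .
    then have "(f, g) \<in> cohomologous G C q"
      by (rule eq_equiv_class[OF _ C.equiv_cohomologous]) (rule cocycles_sub[OF g(1)])
    then have "P f = P g" by (rule P_class)
    moreover have "cohomologous G B q `` {P h} = cohomologous G B q `` {h}" if "h \<in> cocycles G B q" for h
      by (rule equiv_class_eq[OF B.equiv_cohomologous P_rel_sub[OF that]])
    ultimately show "\<alpha> = \<beta>" unfolding f(2) g(2) using f(1) g(1) by metis
  qed
  show "comparison_map G C q ` cohomology G B q = cohomology G C q"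
  proof (intro equalityI subsetI)
    fix \<gamma> assume "\<gamma> \<in> comparison_map G C q ` cohomology G B q"
    then obtain \<beta> where \<beta>: "\<beta> \<in> cohomology G B q" "\<gamma> = comparison_map G C q \<beta>" by auto
    obtain f where f: "f \<in> cocycles G B q" "\<beta> = cohomologous G B q `` {f}" using \<beta>(1) by (rule cohomologyE)
    show "\<gamma> \<in> cohomology G C q"
      unfolding \<beta>(2) f(2) comparison_class[OF f(1)] cohomology_def by (rule quotientI[OF cocycles_sub[OF f(1)]])
  next
    fix \<gamma> assume "\<gamma> \<in> cohomology G C q"
    then obtain f where f: "f \<in> cocycles G C q" "\<gamma> = cohomologous G C q `` {f}"
      unfolding cohomology_def by (rule quotientE)
    have "\<gamma> = comparison_map G C q (cohomologous G B q `` {P f})"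
      unfolding comparison_class[OF P_cocycle[OF f(1)]] f(2)
      by (rule equiv_class_eq[OF C.equiv_cohomologous P_rel[OF f(1)], symmetric])
    then show "\<gamma> \<in> comparison_map G C q ` cohomology G B q"
      unfolding cohomology_def by (rule image_eqI) (rule quotientI[OF P_cocycle[OF f(1)]])
  qed
qed

lemma comparison_add:
  assumes "\<alpha> \<in> cohomology G B q" "\<beta> \<in> cohomology G B q"
  shows "comparison_map G C q (class_add G B q \<alpha> \<beta>)
    = class_add G C q (comparison_map G C q \<alpha>) (comparison_map G C q \<beta>)"
proof -
  obtain f where f: "f \<in> cocycles G B q" "\<alpha> = cohomologous G B q `` {f}" using assms(1) by (rule cohomologyE)
  obtain g where g: "g \<in> cocycles G B q" "\<beta> = cohomologous G B q `` {g}" using assms(2) by (rule cohomologyE)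
  have "(\<lambda>x. f x + g x) \<in> cocycles G B q" using B.cocycles_comb[OF f(1) g(1), of 1 1] by simp
  then show ?thesis
    by (simp only: f g B.class_add_class C.class_add_class comparison_class cocycles_sub)
qed

lemma comparison_scale:
  assumes "\<beta> \<in> cohomology G B q"
  shows "comparison_map G C q (class_scale G B q r \<beta>) = class_scale G C q r (comparison_map G C q \<beta>)"
proof -
  obtain f where f: "f \<in> cocycles G B q" "\<beta> = cohomologous G B q `` {f}" using assms by (rule cohomologyE)
  have "(\<lambda>x. r * f x) \<in> cocycles G B q" using B.cocycles_comb[OF f(1) f(1), of r 0] by simp
  then show ?thesis
    by (simp only: f B.class_scale_class C.class_scale_class comparison_class cocycles_sub)
qed

text \<open>The class in \<open>C\<close> has at least the representatives of the class in
  \<open>B\<close>. Conversely, each of its representatives \<open>h\<close> satisfies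
  \<open>P h = P f\<close>, which represents the class in \<open>B\<close> with a norm no larger
  than that of \<open>h\<close>.\<close>

lemma comparison_seminorm:
  assumes "\<beta> \<in> cohomology G B q"
  shows "class_seminorm G q (comparison_map G C q \<beta>) = class_seminorm G q \<beta>"
proof -
  obtain f where f: "f \<in> cocycles G B q" "\<beta> = cohomologous G B q `` {f}" using assms by (rule cohomologyE)
  have "(INF g\<in>cohomologous G B q `` {f}. sup_norm G q g) \<le> sup_norm G q h" if "h \<in> cohomologous G C q `` {f}" for h
  proof -
    have "P h = P f" using P_class that by auto
    then have "(f, P h) \<in> cohomologous G B q"
      using P_rel_sub[OF f(1)] B.equiv_cohomologous[of G q] by (simp add: equiv_def sym_def)
    then have "(INF g\<in>cohomologous G B q `` {f}. sup_norm G q g) \<le> sup_norm G q (P h)"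
      by (intro INF_lower) simp
    also have "\<dots> \<le> sup_norm G q h" using that by (intro P_norm) (auto simp: cohomologous_def)
    finally show ?thesis .
  qed
  moreover have "cohomologous G B q `` {f} \<subseteq> cohomologous G C q `` {f}" using cohomologous_sub by auto
  ultimately show ?thesis
    unfolding f(2) comparison_class[OF f(1)] class_seminorm_def
    by (intro antisym INF_superset_mono INF_greatest) auto
qed

end

section \<open>Continuous and bounded cochains of the isometry group\<close>

lemma cochain_spaces_continuous: "cochain_spaces (continuous_cochains G T e)"
proof
  show "(\<lambda>_. 0) \<in> continuous_cochains G T e q" for q by (simp add: continuous_cochains_def)
  show "(\<lambda>x. r * f x + s * g x) \<in> continuous_cochains G T e q"
    if f: "f \<in> continuous_cochains G T e q" and g: "g \<in> continuous_cochains G T e q" for f g q r s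
    using that
    by (auto simp: continuous_cochains_def distrib_left mult.left_commute
        intro!: continuous_map_add continuous_map_real_mult_left)
qed

lemma cochain_spaces_bounded: "cochain_spaces (bounded_cochains G T e)"
proof
  show "(\<lambda>_. 0) \<in> bounded_cochains G T e q" for q
    by (simp add: bounded_cochains_def cochain_spaces.zero[OF cochain_spaces_continuous] image_constant_conv)
  show "(\<lambda>x. r * f x + s * g x) \<in> bounded_cochains G T e q"
    if f: "f \<in> bounded_cochains G T e q" and g: "g \<in> bounded_cochains G T e q" for f g q r s
  proof -
    have "bounded ((\<lambda>x. r *\<^sub>R f x + s *\<^sub>R g x) ` tuples G q)"
      using f g by (intro bounded_plus_comp bounded_scaleR_comp) (auto simp: bounded_cochains_def)
    then show ?thesis
      using f g by (simp add: bounded_cochains_def cochain_spaces.comb[OF cochain_spaces_continuous])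
  qed
qed

theorem proposition2:
  assumes "CARD('n::finite) \<ge> 2"
  shows
    "let n = CARD('n);
         G = hyp_isom_group :: (real ^ 'n \<Rightarrow> real ^ 'n) monoid;
         C = continuous_cochains G hyp_isom_topology orientation_character;
         Cb = bounded_cochains G hyp_isom_topology orientation_character;
         c = comparison_map G C n
     in bij_betw c (cohomology G Cb n) (cohomology G C n)
      \<and> (\<forall>\<alpha>\<in>cohomology G Cb n. \<forall>\<beta>\<in>cohomology G Cb n.
           c (class_add G Cb n \<alpha> \<beta>) = class_add G C n (c \<alpha>) (c \<beta>))
      \<and> (\<forall>r. \<forall>\<beta>\<in>cohomology G Cb n.
           c (class_scale G Cb n r \<beta>) = class_scale G C n r (c \<beta>))
      \<and> (\<forall>\<beta>\<in>cohomology G Cb n. class_seminorm G n (c \<beta>) = class_seminorm G n \<beta>)"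
proof -
  let ?G = "hyp_isom_group :: (real ^ 'n \<Rightarrow> real ^ 'n) monoid"
  \<comment> \<open>Every coordinate reflection reverses orientation, so an arbitrary axis may be
    distinguished.\<close>
  interpret isometry_complex "undefined :: 'n" "CARD('n)"
  proof
    show "\<bar>matrix_character A\<bar> = 1" for A :: "real ^ 'n option ^ 'n option"
      by (simp add: matrix_character_def orientation_character_def)
  qed (use assms in \<open>simp_all add: matrix_character_reflection\<close>)
  interpret C: cochain_spaces "isometry_cochains :: nat \<Rightarrow> ((nat \<Rightarrow> real ^ 'n \<Rightarrow> real ^ 'n) \<Rightarrow> real) set"
    by (rule cochain_spaces_continuous)
  interpret B: cochain_spaces "bounded_isometry_cochains :: nat \<Rightarrow> ((nat \<Rightarrow> real ^ 'n \<Rightarrow> real ^ 'n) \<Rightarrow> real) set"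
    by (rule cochain_spaces_bounded)
  have sub: "bounded_isometry_cochains k \<subseteq> isometry_cochains k" for k
    by (auto simp: bounded_cochains_def)
  have bc: "f \<in> cocycles ?G isometry_cochains CARD('n)" "f \<in> bounded_isometry_cochains CARD('n)"
    if "f \<in> cocycles ?G bounded_isometry_cochains CARD('n)" for f
    using that sub by (auto simp: cocycles_def)
  interpret cochain_projection isometry_cochains bounded_isometry_cochains ?G "CARD('n)" project
    by unfold_locales
      (fact sub project_cocycle sup_norm_project project_cohomologous(1) project_class
        | rule project_cohomologous(2); erule bc)+
  show ?thesis
    unfolding Let_def
    by (intro conjI ballI allI comparison_bij comparison_add comparison_scale comparison_seminorm)
qed

end
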